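(* Let $r>0$ and $0<\theta<\pi/2$ satisfy $r\cos\theta<1$. For $h>0$ let $R_h$ be the three-dimensional hyperbolic complete orthoscheme, in the projective ball model $\mathbb{B}$, with vertices $$P_0=(r\sin\theta,\ r\cos\theta,\ 0),\quad P_1=(0,\ r\cos\theta,\ 0),\quad P_2=(0,0,0),\quad P_3=(0,0,h),$$ and let $V(h)$ denote its hyperbolic volume. Then the function $V$ on $(0,+\infty)$ attains its maximum value at some $h\in(1,+\infty)$. Moreover, the point $h$ at which this maximum is attained is unique, and for this $h$ the complete orthoscheme $R_h$ is not a Lambert cube.
   Context: The projective ball (Beltrami–Klein) model $\mathbb{B}$ of hyperbolic 3-space is the open unit ball in $\mathbb{R}^3$ centered at the origin, with the metric induced via radial projection from the hyperboloid $\{x\in\mathbb{R}^4: -x_0^2+x_1^2+x_2^2+x_3^2=-1,\ x_0>0\}$ onto the affine hyperplane $x_0=1$; hyperbolic planes are intersections of Euclidean planes with $\mathbb{B}$. Points of $\partial\mathbb{B}$ are called ideal, points outside the closed ball ultraideal. Each ultraideal point $v$ has a polar plane: the hyperbolic plane whose boundary circle is the set of tangency points on $\partial\mathbb{B}$ of the cone from $v$ tangent to $\partial\mathbb{B}$ (it is orthogonal to every hyperbolic line/plane through $v$). Truncation of a Euclidean tetrahedron $R$ at an ultraideal vertex $v$ means replacing $R$ by $R\cap T$, where $T$ is the closed half-space bounded by the polar plane of $v$ not containing $v$. For the tetrahedron with vertices $P_0,P_1,P_2,P_3$ (here $P_1,P_2\in\mathbb{B}$, $P_0,P_3$ are the principal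 vertices, the edge $P_0P_1$ is perpendicular to the face $P_1P_2P_3$ and the face $P_0P_1P_2$ is orthogonal to the edge $P_2P_3$), the complete orthoscheme $R_h$ is the hyperbolic polyhedron obtained from the tetrahedron intersected with $\mathbb{B}$ by truncating at each principal vertex that is ultraideal. Thus $R_h$ is an ordinary orthoscheme (principal vertices ordinary or ideal), a simple frustum (exactly one principal vertex ultraideal), a double frustum (both ultraideal and their polar planes disjoint in the closure of $\mathbb{B}$, or tangent at an ideal point), or a Lambert cube (both ultraideal and their polar planes intersecting in $\mathbb{B}$; then the edge $P_0P_3$ is cut away entirely). For $r>1$, $R_h$ is a Lambert cube exactly when $h>r/\sqrt{r^2-1}$. *)

theory Defs
  imports "HOL-Analysis.Analysis"
begin

definition klein_ball :: "(real^3) set" where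
  "klein_ball = ball 0 1"

definition ultraideal :: "real^3 \<Rightarrow> bool" where
  "ultraideal v \<longleftrightarrow> norm v > 1"

text \<open>Polar plane of an ultraideal point v: the plane through the tangency points of the
  cone from v tangent to the unit sphere, i.e. the affine plane x . v = 1 (intersected with the ball).\<close>
definition polar_plane :: "real^3 \<Rightarrow> (real^3) set" where
  "polar_plane v = {x. inner x v = 1} \<inter> klein_ball"

text \<open>Closed half-space bounded by the polar plane of v not containing v.\<close>
definition polar_halfspace :: "real^3 \<Rightarrow> (real^3) set" where
  "polar_halfspace v = {x. inner x v \<le> 1}"

definition truncate_at :: "real^3 \<Rightarrow> (real^3) set \<Rightarrow> (real^3) set" where
  "truncate_at v R = (if ultraideal v then R \<inter> polar_halfspace v else R)"

definition complete_orthoscheme ::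
  "real^3 \<Rightarrow> real^3 \<Rightarrow> real^3 \<Rightarrow> real^3 \<Rightarrow> (real^3) set" where
  "complete_orthoscheme P0 P1 P2 P3 =
     truncate_at P3 (truncate_at P0 (convex hull {P0, P1, P2, P3} \<inter> klein_ball))"

definition hyp_volume :: "(real^3) set \<Rightarrow> real" where
  "hyp_volume S = integral S (\<lambda>x. 1 / (1 - (norm x)\<^sup>2)\<^sup>2)"

definition is_lambert_cube :: "real^3 \<Rightarrow> real^3 \<Rightarrow> bool" where
  "is_lambert_cube P0 P3 \<longleftrightarrow> ultraideal P0 \<and> ultraideal P3 \<and>
     polar_plane P0 \<inter> polar_plane P3 \<noteq> {}"

definition R_h :: "real \<Rightarrow> real \<Rightarrow> real \<Rightarrow> (real^3) set" where
  "R_h r \<theta> h = complete_orthoscheme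
      (vector [r * sin \<theta>, r * cos \<theta>, 0]) (vector [0, r * cos \<theta>, 0])
      (vector [0, 0, 0]) (vector [0, 0, h])"

definition V_h :: "real \<Rightarrow> real \<Rightarrow> real \<Rightarrow> real" where
  "V_h r \<theta> h = hyp_volume (R_h r \<theta> h)"

end

theory Submission
  imports Defs
begin

text \<open>
  In the Klein model the point (x, y, z) of the prism over the base triangle belongs to the region
  of parameter h exactly when \<sigma> \<le> h \<le> 1 / z, where \<sigma> is the parameter of the slanted plane through it.
  Hence the volume at h is the integral over (0, h] of gain minus loss, where gain is the area
  integral over the slanted face and loss that over the polar face of P3. Both are fans, about the
  line P0 P1 and about the line P2 P3, and become one-dimensional integrals of rational functions.
  Their logarithmic terms along the common edge of the two faces cancel. What is left is,
  up to a positive factor, (length of P0 P3) / tanh (that length), or its analogue for ordinary P0,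
  minus a constant, and this decreases strictly in h as long as the polar planes of P0 and P3 do not meet.
  Once they meet, the gain is strictly smaller than the loss.
\<close>

section \<open>Integrals over real space and over intervals\<close>

text \<open>Both rates are unbounded near h = 1, where P3 becomes ideal, and for e > 1 also near the
  parameter at which the polar planes touch. So V is not differentiated: volumes at two parameters
  are compared by integrating rates that are ordered almost everywhere. The integrals live in the
  extended nonnegative reals, and finiteness comes from a majorant of inverse square root type.

  The denominators come from an isometry that moves P1 to the centre of the ball. The line P0 P1
  becomes a coordinate axis, and 1 - |v|^2 becomes, up to a factor, 1 - s^2 - M Y^2 with Y
  proportional to the distance from the plane y = p.

  Nothing is lost for h \<le> 1, which forces the maximum beyond 1. It need not be a zero of the
  balance: for large e the balance is still positive when the polar planes touch, and this tangent
  configuration, not yet a Lambert cube, is then the maximum.\<close>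

lemma vector3_eq_sum: "(vector [x, y, z] :: real^3) = x *\<^sub>R axis 1 1 + y *\<^sub>R axis 2 1 + z *\<^sub>R axis 3 1"
  by (simp add: vec_eq_iff forall_3 axis_def)

lemma measurable_vector3 [measurable]:
  "(\<lambda>(y, x, z). vector [x, y, z] :: real^3) \<in> borel_measurable (lborel \<Otimes>\<^sub>M (lborel \<Otimes>\<^sub>M lborel))"
  unfolding vector3_eq_sum split_beta' by measurable

lemma prod_Basis_vec3:
  fixes f :: "real^3 \<Rightarrow> 'b::comm_monoid_mult"
  shows "(\<Prod>b\<in>Basis. f b) = f (axis 1 1) * f (axis 2 1) * f (axis 3 1)"
proof -
  have "Basis = (\<lambda>i. axis i 1 :: real^3) ` UNIV"
    by (auto simp: Basis_vec_def)
  moreover have "inj (\<lambda>i::3. axis i 1 :: real^3)"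
    by (auto simp: inj_on_def axis_eq_axis)
  ultimately have "prod f Basis = (\<Prod>i\<in>UNIV. f (axis i 1))"
    using prod.reindex[of "\<lambda>i::3. axis i 1 :: real^3" UNIV f] by (simp only: o_def)
  also have "\<dots> = f (axis 1 1) * f (axis 2 1) * f (axis 3 1)"
    unfolding UNIV_3 by (simp add: ac_simps)
  finally show ?thesis .
qed

text \<open>The order (y, x, z) puts y outermost because both later coordinate changes rescale x and
  z by factors that depend on y alone.\<close>

lemma lborel_vec3:
  "(lborel :: (real^3) measure) =
     distr (lborel \<Otimes>\<^sub>M (lborel \<Otimes>\<^sub>M lborel)) borel (\<lambda>(y, x, z). vector [x, y, z])"
proof (rule lborel_eqI)
  fix l u :: "real^3"
  assume lu: "\<And>b. b \<in> Basis \<Longrightarrow> l \<bullet> b \<le> u \<bullet> b"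
  have le: "l $ i \<le> u $ i" for i
    using lu[of "axis i 1"] by (simp add: inner_axis axis_in_Basis_iff)
  have "(\<lambda>(y, x, z). vector [x, y, z] :: real^3) -` box l u \<inter> space (lborel \<Otimes>\<^sub>M (lborel \<Otimes>\<^sub>M lborel)) =
    {l $ 2 <..< u $ 2} \<times> ({l $ 1 <..< u $ 1} \<times> {l $ 3 <..< u $ 3})"
    by (auto simp: mem_box_cart space_pair_measure forall_3)
  then have "emeasure (distr (lborel \<Otimes>\<^sub>M (lborel \<Otimes>\<^sub>M lborel)) borel (\<lambda>(y, x, z). vector [x, y, z])) (box l u) =
      emeasure (lborel \<Otimes>\<^sub>M (lborel \<Otimes>\<^sub>M lborel)) ({l $ 2 <..< u $ 2} \<times> ({l $ 1 <..< u $ 1} \<times> {l $ 3 <..< u $ 3}))"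
    by (subst emeasure_distr[OF measurable_vector3]) simp_all
  also have "\<dots> = ennreal (u $ 2 - l $ 2) * (ennreal (u $ 1 - l $ 1) * ennreal (u $ 3 - l $ 3))"
    by (simp add: lborel_pair.P.emeasure_pair_measure_Times lborel.emeasure_pair_measure_Times le)
  also have "\<dots> = ennreal ((u $ 1 - l $ 1) * (u $ 2 - l $ 2) * (u $ 3 - l $ 3))"
    proof -
    have "ennreal a * (ennreal b * ennreal c) = ennreal (b * a * c)" if "0 \<le> a" "0 \<le> b" "0 \<le> c" for a b c
      using that by (simp add: ennreal_mult mult_ac)
    then show ?thesis
      using le by simp
  qed
  also have "(u $ 1 - l $ 1) * (u $ 2 - l $ 2) * (u $ 3 - l $ 3) = (\<Prod>b\<in>Basis. (u - l) \<bullet> b)"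
    by (simp add: prod_Basis_vec3 inner_axis)
  finally show "emeasure (distr (lborel \<Otimes>\<^sub>M (lborel \<Otimes>\<^sub>M lborel)) borel (\<lambda>(y, x, z). vector [x, y, z])) (box l u) =
      (\<Prod>b\<in>Basis. (u - l) \<bullet> b)" .
qed simp

lemma nn_integral_vec3:
  fixes f :: "real^3 \<Rightarrow> ennreal"
  assumes [measurable]: "f \<in> borel_measurable borel"
  shows "(\<integral>\<^sup>+v. f v \<partial>lborel) = (\<integral>\<^sup>+y. \<integral>\<^sup>+x. \<integral>\<^sup>+z. f (vector [x, y, z]) \<partial>lborel \<partial>lborel \<partial>lborel)"
proof -
  have m: "(\<lambda>(y, x, z). f (vector [x, y, z])) \<in> borel_measurable (lborel \<Otimes>\<^sub>M (lborel \<Otimes>\<^sub>M lborel))"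
    using measurable_compose[OF measurable_vector3 assms] by (simp add: split_beta')
  have "(\<integral>\<^sup>+v. f v \<partial>lborel) = (\<integral>\<^sup>+w. (case w of (y, x, z) \<Rightarrow> f (vector [x, y, z])) \<partial>(lborel \<Otimes>\<^sub>M (lborel \<Otimes>\<^sub>M lborel)))"
    by (subst lborel_vec3, subst nn_integral_distr[OF measurable_vector3]) (simp_all add: split_beta')
  also have "\<dots> = (\<integral>\<^sup>+y. \<integral>\<^sup>+w. (case w of (x, z) \<Rightarrow> f (vector [x, y, z])) \<partial>(lborel \<Otimes>\<^sub>M lborel) \<partial>lborel)"
    by (subst lborel_pair.P.nn_integral_fst[OF m, symmetric]) simp
  also have "\<dots> = (\<integral>\<^sup>+y. \<integral>\<^sup>+x. \<integral>\<^sup>+z. f (vector [x, y, z]) \<partial>lborel \<partial>lborel \<partial>lborel)"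
  proof (intro nn_integral_cong)
    fix y :: real
    have "(\<lambda>w. case w of (x, z) \<Rightarrow> f (vector [x, y, z])) \<in> borel_measurable (lborel \<Otimes>\<^sub>M lborel)"
      using measurable_compose[OF measurable_Pair1'[of y lborel "lborel \<Otimes>\<^sub>M lborel"] m] by simp
    then show "(\<integral>\<^sup>+w. (case w of (x, z) \<Rightarrow> f (vector [x, y, z])) \<partial>(lborel \<Otimes>\<^sub>M lborel)) =
        (\<integral>\<^sup>+x. \<integral>\<^sup>+z. f (vector [x, y, z]) \<partial>lborel \<partial>lborel)"
      by (subst lborel.nn_integral_fst [symmetric]) simp_all
  qed
  finally show ?thesis .
qed

lemma nn_integral_reciprocal:
  fixes f :: "real \<Rightarrow> real"
  assumes [measurable]: "f \<in> borel_measurable borel" and "1 \<le> b"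
  shows "(\<integral>\<^sup>+z. f z * indicator {1 / b..1} z \<partial>lborel) =
         (\<integral>\<^sup>+h. f (1 / h) * (1 / h\<^sup>2) * indicator {1..b} h \<partial>lborel)"
proof -
  \<comment> \<open>The substitution rule wants an increasing map, so z is reflected first and then
    replaced by -1/h.\<close>
  have "(\<integral>\<^sup>+z. f z * indicator {1 / b..1} z \<partial>lborel) =
      (\<integral>\<^sup>+z. f (- z) * indicator {- 1 / 1..- 1 / b} z \<partial>lborel)"
    by (subst nn_integral_real_affine[where c = "-1" and t = 0])
      (auto intro!: nn_integral_cong simp: indicator_def)
  also have "\<dots> = (\<integral>\<^sup>+h. f (- (- 1 / h)) * (1 / h\<^sup>2) * indicator {1..b} h \<partial>lborel)"
    using \<open>1 \<le> b\<close>
    by (intro nn_integral_substitution)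
      (auto simp: set_borel_measurable_def power2_eq_square intro!: derivative_eq_intros continuous_intros)
  finally show ?thesis
    by simp
qed

text \<open>Majorant for the singularities of the gain. Splitting at \<open>d\<close> and reflecting
  one half bounds it by two integrals of \<open>v powr (-1/2)\<close>.\<close>

lemma nn_integral_inverse_sqrt_finite:
  fixes b d :: real
  shows "(\<integral>\<^sup>+h. ennreal (1 / sqrt \<bar>h - d\<bar>) * indicator {0..b} h \<partial>lborel) < \<infinity>"
proof -
  define B where "B = \<bar>b\<bar> + \<bar>d\<bar>"
  have B: "0 \<le> B" by (simp add: B_def)
  let ?f = "\<lambda>v::real. ennreal (v powr (-1/2)) * indicator {0..B} v"
  have fin: "(\<integral>\<^sup>+v. ?f v \<partial>lborel) < \<infinity>"
    using nn_integral_has_integral_lebesgue'[OF _ has_integral_powr_from_0[of "-1/2" B]] B by simp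
  have fin': "(\<integral>\<^sup>+v. ?f (- v) \<partial>lborel) < \<infinity>"
  proof -
    have "(\<integral>\<^sup>+v. ?f v \<partial>lborel) = ennreal \<bar>- 1\<bar> * (\<integral>\<^sup>+v. ?f (0 + - 1 * v) \<partial>lborel)"
      by (rule nn_integral_real_affine) auto
    then show ?thesis
      using fin by simp
  qed
  have "(\<integral>\<^sup>+h. ennreal (1 / sqrt \<bar>h - d\<bar>) * indicator {0..b} h \<partial>lborel) =
      (\<integral>\<^sup>+v. ennreal (1 / sqrt \<bar>v\<bar>) * indicator {0..b} (d + v) \<partial>lborel)"
    by (subst nn_integral_real_affine[where c = 1 and t = d]) auto
  also have "\<dots> \<le> (\<integral>\<^sup>+v. ?f v + ?f (- v) \<partial>lborel)"
  proof (rule nn_integral_mono)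
    fix v :: real
    show "ennreal (1 / sqrt \<bar>v\<bar>) * indicator {0..b} (d + v) \<le> ?f v + ?f (- v)"
      by (cases "0 \<le> v") (auto simp: indicator_def B_def powr_minus_divide powr_half_sqrt)
  qed
  also have "\<dots> = (\<integral>\<^sup>+v. ?f v \<partial>lborel) + (\<integral>\<^sup>+v. ?f (- v) \<partial>lborel)"
    by (rule nn_integral_add) measurable
  finally show ?thesis
    using fin fin' by (metis (no_types, lifting) ennreal_add_less_top infinity_ennreal_def order_le_less_trans)
qed

lemma nn_integral_interval:
  fixes f :: "real \<Rightarrow> real"
  assumes "(f has_integral I) {a..b}" "\<And>s. s \<in> {a..b} \<Longrightarrow> 0 \<le> f s"
  shows "(\<integral>\<^sup>+s. ennreal (f s) * indicator {a..b} s \<partial>lborel) = ennreal I" "0 \<le> I"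
  using nn_integral_has_integral_lebesgue'[of "{a..b}" f I] has_integral_nonneg[of f I "{a..b}"] assms by auto

lemma nn_integral_split_at:
  fixes f :: "real \<Rightarrow> ennreal"
  assumes [measurable]: "f \<in> borel_measurable borel" and "0 < a" "a < b"
  shows "(\<integral>\<^sup>+h. (if 0 < h \<and> h \<le> b then f h else 0) \<partial>lborel) =
    (\<integral>\<^sup>+h. (if 0 < h \<and> h \<le> a then f h else 0) \<partial>lborel) + (\<integral>\<^sup>+h. (if a < h \<and> h \<le> b then f h else 0) \<partial>lborel)"
proof -
  have "(if 0 < h \<and> h \<le> b then f h else 0) =
      (if 0 < h \<and> h \<le> a then f h else 0) + (if a < h \<and> h \<le> b then f h else 0)" for h
    using assms by auto
  then show ?thesis by (simp only:) (rule nn_integral_add, auto)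
qed

lemma not_AE_if_fails_on_interval:
  fixes c b :: real
  assumes "c < b" "\<And>h. c < h \<Longrightarrow> h < b \<Longrightarrow> \<not> P h"
  shows "\<not> (AE h in lborel. P h)"
proof
  assume "AE h in lborel. P h"
  then have "AE h in lborel. h \<notin> {c<..<b}" by eventually_elim (use assms(2) in auto)
  then have "{c<..<b} \<in> null_sets lborel" by (subst (asm) AE_iff_null_sets [symmetric]) auto
  then show False using assms(1) by (simp add: null_sets_def)
qed

text \<open>Substitute x = s * a y and z = h * b y for each fixed y, then reorder by Tonelli. The
  fan about P0 P1 uses a = (1 - p y) / k and b = (p - y) / p. The fan about P2 P3 uses a = y and b =
  1, so that s is then the slope and h the height.\<close>

lemma nn_integral_fibrewise_scaling:
  fixes F :: "real \<Rightarrow> real \<Rightarrow> real \<Rightarrow> real" and a b :: "real \<Rightarrow> real"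
  assumes F: "(\<lambda>(x, y, z). F x y z) \<in> borel_measurable (borel \<Otimes>\<^sub>M (borel \<Otimes>\<^sub>M borel))"
    and [measurable]: "a \<in> borel_measurable borel" "b \<in> borel_measurable borel" "Measurable.pred borel P"
    and pos: "\<And>y. P y \<Longrightarrow> 0 < a y" "\<And>y. P y \<Longrightarrow> 0 < b y"
    and nonneg: "\<And>x y z. 0 \<le> F x y z"
  shows "(\<integral>\<^sup>+y. \<integral>\<^sup>+x. \<integral>\<^sup>+z. ennreal (if P y then F x y z else 0) \<partial>lborel \<partial>lborel \<partial>lborel) =
    (\<integral>\<^sup>+h. \<integral>\<^sup>+s. \<integral>\<^sup>+y. ennreal (if P y then a y * b y * F (s * a y) y (h * b y) else 0) \<partial>lborel \<partial>lborel \<partial>lborel)"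
proof -
  have meas: "(\<lambda>w. F (f w) (g w) (h w)) \<in> borel_measurable M"
    if "f \<in> borel_measurable M" "g \<in> borel_measurable M" "h \<in> borel_measurable M"
    for f g h :: "'c \<Rightarrow> real" and M
    using measurable_compose[OF measurable_Pair[OF that(1) measurable_Pair[OF that(2,3)]] F] by simp
  note [measurable] = meas
  let ?H = "\<lambda>h s y. ennreal (if P y then a y * b y * F (s * a y) y (h * b y) else 0)"
  have "(\<integral>\<^sup>+x. \<integral>\<^sup>+z. ennreal (if P y then F x y z else 0) \<partial>lborel \<partial>lborel) =
      (\<integral>\<^sup>+s. \<integral>\<^sup>+h. ?H h s y \<partial>lborel \<partial>lborel)" for y
  proof (cases "P y")
    case True
    have "(\<integral>\<^sup>+z. ennreal (F x y z) \<partial>lborel) = ennreal (b y) * (\<integral>\<^sup>+h. ennreal (F x y (h * b y)) \<partial>lborel)" for x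
      by (subst nn_integral_real_affine[where c = "b y" and t = 0])
        (use pos[OF True] in \<open>auto simp: mult.commute\<close>)
    then have "(\<integral>\<^sup>+x. \<integral>\<^sup>+z. ennreal (F x y z) \<partial>lborel \<partial>lborel) =
        (\<integral>\<^sup>+x. ennreal (b y) * (\<integral>\<^sup>+h. ennreal (F x y (h * b y)) \<partial>lborel) \<partial>lborel)"
      by simp
    also have "\<dots> = ennreal (a y) * (\<integral>\<^sup>+s. ennreal (b y) * (\<integral>\<^sup>+h. ennreal (F (s * a y) y (h * b y)) \<partial>lborel) \<partial>lborel)"
      by (subst nn_integral_real_affine[where c = "a y" and t = 0])
        (use pos[OF True] in \<open>auto simp: mult.commute\<close>)
    also have "\<dots> = (\<integral>\<^sup>+s. \<integral>\<^sup>+h. ennreal (a y) * (ennreal (b y) * ennreal (F (s * a y) y (h * b y))) \<partial>lborel \<partial>lborel)"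
      by (simp add: nn_integral_cmult)
    also have "\<dots> = (\<integral>\<^sup>+s. \<integral>\<^sup>+h. ?H h s y \<partial>lborel \<partial>lborel)"
      using pos[OF True] nonneg True by (simp add: ennreal_mult mult.assoc)
    finally show ?thesis
      using True by simp
  qed simp
  then have "(\<integral>\<^sup>+y. \<integral>\<^sup>+x. \<integral>\<^sup>+z. ennreal (if P y then F x y z else 0) \<partial>lborel \<partial>lborel \<partial>lborel) =
      (\<integral>\<^sup>+y. \<integral>\<^sup>+s. \<integral>\<^sup>+h. ?H h s y \<partial>lborel \<partial>lborel \<partial>lborel)"
    by simp
  also have "\<dots> = (\<integral>\<^sup>+s. \<integral>\<^sup>+y. \<integral>\<^sup>+h. ?H h s y \<partial>lborel \<partial>lborel \<partial>lborel)"
    by (rule lborel_pair.Fubini') measurable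
  also have "\<dots> = (\<integral>\<^sup>+s. \<integral>\<^sup>+h. \<integral>\<^sup>+y. ?H h s y \<partial>lborel \<partial>lborel \<partial>lborel)"
    by (intro nn_integral_cong lborel_pair.Fubini') measurable
  also have "\<dots> = (\<integral>\<^sup>+h. \<integral>\<^sup>+s. \<integral>\<^sup>+y. ?H h s y \<partial>lborel \<partial>lborel \<partial>lborel)"
    by (rule lborel_pair.Fubini') measurable
  finally show ?thesis .
qed

section \<open>The volume as an integral of gain minus loss\<close>

definition klein_density :: "real \<Rightarrow> real \<Rightarrow> real \<Rightarrow> real" where
  "klein_density x y z = (if x\<^sup>2 + y\<^sup>2 + z\<^sup>2 < 1 then 1 / (1 - (x\<^sup>2 + y\<^sup>2 + z\<^sup>2))\<^sup>2 else 0)"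

lemma klein_density_nonneg [simp]: "0 \<le> klein_density x y z"
  by (simp add: klein_density_def)

text \<open>Here p = r cos \<theta> and k e = r sin \<theta>. The Klein coordinate of P0 along the line P1 P0, as seen from P1,
  is e, so P0 is ultraideal exactly when e > 1.\<close>

locale orthoscheme =
  fixes p k e :: real
  assumes p_pos: "0 < p" and k_pos: "0 < k" and e_pos: "0 < e" and pk: "p\<^sup>2 + k\<^sup>2 = 1"
begin

lemma k_sq: "k\<^sup>2 = 1 - p\<^sup>2"
  using pk by simp

lemma p_less_1: "p < 1"
  using pk p_pos k_pos by (smt (verit) one_power2 power_mono zero_less_power)

text \<open>The strict inequalities discard only null sets. The last inequality is the truncation at
  P0; it is imposed for every P0, since it holds automatically when P0 is not ultraideal, as the
  proof of \<open>R_h_iff\<close> shows.\<close>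

definition prism :: "real \<Rightarrow> real \<Rightarrow> real \<Rightarrow> bool" where
  "prism x y z \<longleftrightarrow> 0 \<le> x \<and> x * p \<le> y * (k * e) \<and> 0 < y \<and> y < p \<and> 0 < z \<and> k * e * x + p * y \<le> 1"

definition region :: "real \<Rightarrow> real \<Rightarrow> real \<Rightarrow> real \<Rightarrow> real" where
  "region h x y z = (if prism x y z \<and> z * p \<le> h * (p - y) \<and> z * h \<le> 1 then klein_density x y z else 0)"

text \<open>With \<sigma> = z p / (p - y), the condition \<open>z\<^sup>2 * p \<le> p - y\<close>
  reads \<sigma> \<le> 1/z: the point lies in the region for some parameter. \<open>swept\<close>
  collects the points that have entered by parameter h, \<open>removed\<close> those that have left
  again.\<close>

definition swept :: "real \<Rightarrow> real \<Rightarrow> real \<Rightarrow> real \<Rightarrow> real" where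
  "swept h x y z = (if prism x y z \<and> z * p \<le> h * (p - y) \<and> z\<^sup>2 * p \<le> p - y then klein_density x y z else 0)"

definition removed :: "real \<Rightarrow> real \<Rightarrow> real \<Rightarrow> real \<Rightarrow> real" where
  "removed h x y z = (if prism x y z \<and> 1 < z * h \<and> z\<^sup>2 * p \<le> p - y then klein_density x y z else 0)"

definition vol :: "(real \<Rightarrow> real \<Rightarrow> real \<Rightarrow> real) \<Rightarrow> ennreal" where
  "vol F = (\<integral>\<^sup>+y. \<integral>\<^sup>+x. \<integral>\<^sup>+z. ennreal (F x y z) \<partial>lborel \<partial>lborel \<partial>lborel)"

lemma swept_nonneg [simp]: "0 \<le> swept h x y z" and removed_nonneg [simp]: "0 \<le> removed h x y z"
  and region_nonneg [simp]: "0 \<le> region h x y z"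
  by (simp_all add: swept_def removed_def region_def)

lemma measurable_swept:
  "(\<lambda>(x, y, z). swept h x y z) \<in> borel_measurable (borel \<Otimes>\<^sub>M (borel \<Otimes>\<^sub>M borel))"
  unfolding swept_def prism_def klein_density_def split_beta' by measurable

lemma measurable_removed:
  "(\<lambda>(x, y, z). removed h x y z) \<in> borel_measurable (borel \<Otimes>\<^sub>M (borel \<Otimes>\<^sub>M borel))"
  unfolding removed_def prism_def klein_density_def split_beta' by measurable

lemma measurable_region:
  "(\<lambda>(x, y, z). region h x y z) \<in> borel_measurable (borel \<Otimes>\<^sub>M (borel \<Otimes>\<^sub>M borel))"
  unfolding region_def prism_def klein_density_def split_beta' by measurable

lemma region_plus_removed:
  assumes "0 < h"
  shows "region h x y z + removed h x y z = swept h x y z"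
proof (cases "prism x y z")
  case True
  then have z: "0 < z" and y: "0 < p - y"
    by (auto simp: prism_def)
  have 1: "z\<^sup>2 * p \<le> p - y" if "z * p \<le> h * (p - y)" "z * h \<le> 1"
  proof -
    have "z\<^sup>2 * p = z * (z * p)" by (simp add: power2_eq_square)
    also have "\<dots> \<le> z * (h * (p - y))" using that z by simp
    also have "\<dots> = (z * h) * (p - y)" by simp
    also have "\<dots> \<le> 1 * (p - y)" using that y by (intro mult_right_mono) auto
    finally show ?thesis by simp
  qed
  have 2: "z * p \<le> h * (p - y)" if "z\<^sup>2 * p \<le> p - y" "1 < z * h"
  proof -
    have "z * (z * p) \<le> p - y" using that by (simp add: power2_eq_square mult.assoc)
    also have "1 * (p - y) \<le> (z * h) * (p - y)" using that y by (intro mult_right_mono) auto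
    then have "p - y \<le> z * (h * (p - y))" by (simp only: mult.assoc mult_1)
    finally show ?thesis using z by (simp only: mult_le_cancel_left_pos)
  qed
  show ?thesis
  proof (cases "z * h \<le> 1")
    case zh: True
    then have "z * p \<le> h * (p - y) \<and> z * h \<le> 1 \<longleftrightarrow> z * p \<le> h * (p - y) \<and> z\<^sup>2 * p \<le> p - y" "\<not> 1 < z * h"
      using 1 by (blast, simp only: not_less)
    then show ?thesis
      unfolding region_def removed_def swept_def by (simp only: if_False simp_thms add_0_right)
  next
    case zh: False
    then have "1 < z * h \<and> z\<^sup>2 * p \<le> p - y \<longleftrightarrow> z * p \<le> h * (p - y) \<and> z\<^sup>2 * p \<le> p - y"
      using 2 by (meson not_le)
    then show ?thesis
      unfolding region_def removed_def swept_def using zh by (simp only: if_False simp_thms add_0_left)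
  qed
qed (simp add: region_def removed_def swept_def)

lemma vol_region_plus_removed:
  assumes "0 < h"
  shows "vol (region h) + vol (removed h) = vol (swept h)"
proof -
  have meas: "(\<lambda>w. F (f w) (g w) (h w)) \<in> borel_measurable M"
    if F: "(\<lambda>(x, y, z). F x y z) \<in> borel_measurable (borel \<Otimes>\<^sub>M (borel \<Otimes>\<^sub>M borel))"
    and "f \<in> borel_measurable M" "g \<in> borel_measurable M" "h \<in> borel_measurable M"
    for f g h :: "'c \<Rightarrow> real" and M and F :: "real \<Rightarrow> real \<Rightarrow> real \<Rightarrow> real"
    using measurable_compose[OF measurable_Pair[OF that(2) measurable_Pair[OF that(3,4)]] F] by simp
  note [measurable] = meas[OF measurable_region] meas[OF measurable_removed]
  show ?thesis
    unfolding vol_def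
    by (subst nn_integral_add [symmetric], measurable, measurable)+
      (simp add: region_plus_removed[OF assms] flip: ennreal_plus)
qed

text \<open>An isometry moving P1 to the centre has coordinates s = k x / (1 - p y), (p - y) / (1 -
  p y) and k z / (1 - p y). On the slanted plane of parameter h the last two have square sum M h *
  Y^2, where Y = (p - y) / (p (1 - p y)).\<close>

definition M :: "real \<Rightarrow> real" where
  "M h = p\<^sup>2 + k\<^sup>2 * h\<^sup>2"

lemma M_pos: "0 < M h"
  unfolding M_def using p_pos by (simp add: add_pos_nonneg)

text \<open>The slanted faces all contain the line through P0 and P1, so the swept region is a fan of
  half-planes about that line. The coordinate s is the Klein coordinate along this line seen from P1.\<close>

definition fan_height :: "real \<Rightarrow> real \<Rightarrow> real" where
  "fan_height h s = min (1 / M h) (1 - s / e)"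

text \<open>The density integrated along a fibre from Y = 0, the line P0 P1, to Y =
  \<open>fan_height h s\<close>. Of the two bounds there, 1 / M h is the polar plane z = 1/h and 1 -
  s/e is the plane through P0, P2, P3. The condition e * s < 1 is the truncation at P0.\<close>

definition fan_density :: "real \<Rightarrow> real \<Rightarrow> real" where
  "fan_density h s = (if 0 < s \<and> s < e \<and> e * s < 1
     then k * p / 2 * (fan_height h s)\<^sup>2 / ((1 - s\<^sup>2) * (1 - s\<^sup>2 - M h * (fan_height h s)\<^sup>2)) else 0)"

definition gain :: "real \<Rightarrow> ennreal" where
  "gain h = (\<integral>\<^sup>+s. ennreal (fan_density h s) \<partial>lborel)"

text \<open>In M h * Y^2 one factor Y is absorbed by the bound 1 / M h and the other is at most 1 -
  s/e. What remains is s^2 < s/e, the truncation at P0.\<close>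

lemma fan_height_bounds:
  assumes "0 < s" "s < e" "e * s < 1"
  shows "0 < fan_height h s" "s < 1"
    "0 < 1 - s\<^sup>2 - M h * (fan_height h s)\<^sup>2"
proof -
  show pos: "0 < fan_height h s"
    using assms M_pos[of h] by (auto simp: fan_height_def)
  show "s < 1"
    using assms by (smt (verit) mult_less_cancel_right2 mult_strict_mono)
  have "M h * (fan_height h s)\<^sup>2 = (M h * fan_height h s) * fan_height h s"
    by (simp add: power2_eq_square)
  also have "\<dots> \<le> 1 * fan_height h s"
    using pos M_pos[of h] by (intro mult_right_mono) (auto simp: fan_height_def field_simps min_def)
  also have "\<dots> \<le> 1 - s / e"
    by (simp add: fan_height_def)
  finally have *: "M h * (fan_height h s)\<^sup>2 \<le> 1 - s / e" .
  have "s * s < s * (1 / e)"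
    using assms by (intro mult_strict_left_mono) (auto simp: field_simps)
  with * show "0 < 1 - s\<^sup>2 - M h * (fan_height h s)\<^sup>2"
    by (simp add: power2_eq_square)
qed

lemma fan_fibre:
  assumes h: "0 < h" and s: "0 < s" "s < e" "e * s < 1"
  shows "(\<integral>\<^sup>+y. ennreal (if 0 < y \<and> y < p then (1 - p * y) / k * ((p - y) / p) *
             swept b (s * ((1 - p * y) / k)) y (h * ((p - y) / p)) else 0) \<partial>lborel) =
         ennreal (if h \<le> b then fan_density h s else 0)"
proof -
  \<comment> \<open>\<open>Y\<close> decreases in y, and \<open>y1\<close>, \<open>y2\<close> are
    the points where it equals the two bounds in \<open>fan_height\<close>; so the fibre is the
    interval from \<open>ym\<close> to p. On it \<open>A\<close> is k^2 (1 - |v|^2).\<close>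
  define Y where "Y y = (p - y) / (p * (1 - p * y))" for y
  define A where "A y = (1 - s\<^sup>2) * (1 - p * y)\<^sup>2 - M h / p\<^sup>2 * (p - y)\<^sup>2" for y
  define y1 where "y1 = p * (1 - 1 / h\<^sup>2)"
  define y2 where "y2 = p * s / (k\<^sup>2 * e + p\<^sup>2 * s)"
  define ym where "ym = max y1 y2"
  have s1: "s < 1" using fan_height_bounds[OF s] by simp
  then have s2: "0 < 1 - s\<^sup>2" using s by (simp add: power_less_one_iff)
  have d: "0 < k\<^sup>2 * e + p\<^sup>2 * s"
    using k_pos e_pos p_pos s by (simp add: add_pos_pos)
  have one: "0 < 1 - p * y" if "y \<le> p" for y
  proof -
    have "p * y \<le> p * p" using that p_pos by simp
    also have "\<dots> < 1" using p_pos p_less_1 mult_strict_mono[of p 1 p 1] by simp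
    finally show ?thesis by simp
  qed
  have y2: "0 < y2" "y2 < p"
  proof -
    show "0 < y2" using d p_pos s by (simp add: y2_def)
    have "s < k\<^sup>2 * e + p\<^sup>2 * s" 
    proof -
      have "k\<^sup>2 * s < k\<^sup>2 * e" using k_pos s by simp
      then show ?thesis by (simp add: k_sq algebra_simps)
    qed
    then have "p * s < p * (k\<^sup>2 * e + p\<^sup>2 * s)" using p_pos by (simp only: mult_less_cancel_left_pos)
    then show "y2 < p" using d by (simp add: y2_def pos_divide_less_eq)
  qed
  have y1: "y1 < p" using h p_pos by (simp add: y1_def field_simps)
  have c2: "y2 \<le> y \<longleftrightarrow> Y y \<le> 1 - s / e" if "y \<le> p" for y
  proof -
    have "y2 \<le> y \<longleftrightarrow> 0 \<le> y * (k\<^sup>2 * e + p\<^sup>2 * s) - p * s"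
      using d by (simp add: y2_def divide_le_eq)
    also have "y * (k\<^sup>2 * e + p\<^sup>2 * s) - p * s = p * (1 - p * y) * (e - s) - e * (p - y)"
      using pk by algebra
    also have "0 \<le> \<dots> \<longleftrightarrow> (p - y) / (p * (1 - p * y)) \<le> (e - s) / e"
      using one[OF that] p_pos e_pos by (simp add: field_simps)
    finally show ?thesis
      using e_pos by (simp add: Y_def diff_divide_distrib)
  qed
  have c1: "y1 \<le> y \<longleftrightarrow> Y y \<le> 1 / M h" if "y \<le> p" for y
  proof -
    have "y1 \<le> y \<longleftrightarrow> 0 \<le> p - h\<^sup>2 * (p - y)"
      using h by (simp add: y1_def field_simps)
    also have "\<dots> \<longleftrightarrow> 0 \<le> k\<^sup>2 * (p - h\<^sup>2 * (p - y))"
      using k_pos by (simp add: zero_le_mult_iff)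
    also have "k\<^sup>2 * (p - h\<^sup>2 * (p - y)) = p * (1 - p * y) - M h * (p - y)"
      unfolding M_def using pk by algebra
    also have "0 \<le> \<dots> \<longleftrightarrow> (p - y) / (p * (1 - p * y)) \<le> 1 / M h"
      using one[OF that] p_pos M_pos[of h] by (simp add: field_simps)
    finally show ?thesis
      by (simp add: Y_def)
  qed
  have c1': "y1 \<le> y \<longleftrightarrow> (h * ((p - y) / p))\<^sup>2 * p \<le> p - y" if "y < p" for y
  proof -
    have "(h * ((p - y) / p))\<^sup>2 * p = (p - y) * (h\<^sup>2 * (p - y)) / p"
      using p_pos by (simp add: power2_eq_square)
    then have "(h * ((p - y) / p))\<^sup>2 * p \<le> p - y \<longleftrightarrow> (p - y) * (h\<^sup>2 * (p - y)) \<le> (p - y) * p"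
      using p_pos by (simp only: pos_divide_le_eq)
    also have "\<dots> \<longleftrightarrow> h\<^sup>2 * (p - y) \<le> p"
      using that by simp
    finally show ?thesis
      using h by (simp add: y1_def field_simps)
  qed
  have c2': "y2 \<le> y \<longleftrightarrow> s * ((1 - p * y) / k) * p \<le> y * (k * e)" for y
  proof -
    have "s * ((1 - p * y) / k) * p \<le> y * (k * e) \<longleftrightarrow> s * (1 - p * y) * p \<le> y * (k\<^sup>2 * e)"
      using k_pos by (simp add: field_simps power2_eq_square)
    also have "\<dots> \<longleftrightarrow> y2 \<le> y"
      using d by (simp add: y2_def field_simps power2_eq_square)
    finally show ?thesis by simp
  qed
  have A_eq: "A y = (1 - p * y)\<^sup>2 * (1 - s\<^sup>2 - M h * (Y y)\<^sup>2)" if "y \<le> p" for y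
  proof -
    have "w\<^sup>2 * ((1 - s\<^sup>2) - M h * (x / (p * w))\<^sup>2) = (1 - s\<^sup>2) * w\<^sup>2 - M h / p\<^sup>2 * x\<^sup>2" if "w \<noteq> 0" for w x
      using that p_pos by (simp add: power2_eq_square field_simps)
    from this[of "1 - p * y" "p - y"] show ?thesis
      using one[OF that] by (simp add: A_def Y_def)
  qed
  have A_pos: "0 < A y" if "ym \<le> y" "y \<le> p" for y
  proof -
    have "0 \<le> Y y" using one[OF that(2)] p_pos that by (simp add: Y_def)
    moreover have "Y y \<le> fan_height h s"
      using that c1 c2 by (simp add: fan_height_def ym_def)
    ultimately have "(Y y)\<^sup>2 \<le> (fan_height h s)\<^sup>2" by (intro power_mono)
    then have "M h * (Y y)\<^sup>2 \<le> M h * (fan_height h s)\<^sup>2"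
      using M_pos[of h] by (intro mult_left_mono) auto
    then have "0 < 1 - s\<^sup>2 - M h * (Y y)\<^sup>2"
      using fan_height_bounds(3)[OF s, of h] by linarith
    then show ?thesis using A_eq[OF that(2)] one[OF that(2)] by simp
  qed
  have A_norm: "A y = k\<^sup>2 * (1 - ((s * ((1 - p * y) / k))\<^sup>2 + y\<^sup>2 + (h * ((p - y) / p))\<^sup>2))" for y
  proof -
    have "k\<^sup>2 * (1 - ((s * (w / k))\<^sup>2 + y\<^sup>2 + (h * (x / p))\<^sup>2)) =
        k\<^sup>2 * (1 - y\<^sup>2) - s\<^sup>2 * w\<^sup>2 - k\<^sup>2 * h\<^sup>2 * x\<^sup>2 / p\<^sup>2" for w x
      using k_pos p_pos by (simp add: power2_eq_square field_simps)
    from this[of "1 - p * y" "p - y"]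
    have "k\<^sup>2 * (1 - ((s * ((1 - p * y) / k))\<^sup>2 + y\<^sup>2 + (h * ((p - y) / p))\<^sup>2)) =
        k\<^sup>2 * (1 - y\<^sup>2) - s\<^sup>2 * (1 - p * y)\<^sup>2 - k\<^sup>2 * h\<^sup>2 * (p - y)\<^sup>2 / p\<^sup>2" .
    also have "k\<^sup>2 * (1 - y\<^sup>2) = (1 - p * y)\<^sup>2 - (p - y)\<^sup>2"
      using pk by algebra
    also have "(1 - p * y)\<^sup>2 - (p - y)\<^sup>2 - s\<^sup>2 * (1 - p * y)\<^sup>2 - k\<^sup>2 * h\<^sup>2 * (p - y)\<^sup>2 / p\<^sup>2 = A y"
      using p_pos by (simp add: A_def M_def field_simps)
    finally show ?thesis by simp
  qed
  define I where "I y = k ^ 3 * (1 - p * y) * (p - y) / (p * (A y)\<^sup>2)" for y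
  \<comment> \<open>In the variable Y the integrand is a multiple of Y / (1 - s^2 - M h * Y^2)^2,
    which suggests this antiderivative. It vanishes at y = p.\<close>
  define F where "F y = - (k / (2 * p * (1 - s\<^sup>2))) * ((p - y)\<^sup>2 / A y)" for y
  have deriv: "(F has_vector_derivative I y) (at y within {ym..p})" if "y \<in> {ym..p}" for y
  proof -
    have Ay: "A y \<noteq> 0" using A_pos[of y] that by auto
    define A' where "A' = (1 - s\<^sup>2) * (2 * (1 - p * y) * (- p)) - M h / p\<^sup>2 * (2 * (p - y) * (- 1))"
    have dA: "(A has_real_derivative A') (at y within {ym..p})"
    proof -
      have "((\<lambda>y. c * (1 - p * y)\<^sup>2 - d * (p - y)\<^sup>2) has_real_derivative
          c * (2 * (1 - p * y) * (- p)) - d * (2 * (p - y) * (- 1))) (at y within {ym..p})" for c d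
        by (auto intro!: derivative_eq_intros simp: algebra_simps)
      then show ?thesis
        unfolding A_def A'_def .
    qed
    have dB: "((\<lambda>y. (p - y)\<^sup>2) has_real_derivative 2 * (p - y) * (- 1)) (at y within {ym..p})"
      by (auto intro!: derivative_eq_intros)
    have "(F has_real_derivative - (k / (2 * p * (1 - s\<^sup>2))) *
        ((2 * (p - y) * (- 1) * A y - (p - y)\<^sup>2 * A') / (A y * A y))) (at y within {ym..p})"
      unfolding F_def by (rule DERIV_cmult[OF DERIV_divide[OF dB dA Ay]])
    also have "2 * (p - y) * (- 1) * A y - (p - y)\<^sup>2 * A' = - 2 * (1 - s\<^sup>2) * (p - y) * (1 - p * y) * k\<^sup>2"
      unfolding A_def A'_def k_sq by (simp add: power2_eq_square) algebra
    also have "- (k / (2 * p * (1 - s\<^sup>2))) * (- 2 * (1 - s\<^sup>2) * (p - y) * (1 - p * y) * k\<^sup>2 / (A y * A y)) = I y"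
      using s2 p_pos Ay by (simp add: I_def field_simps power2_eq_square power3_eq_cube)
    finally show ?thesis
      by (simp add: has_real_derivative_iff_has_vector_derivative)
  qed
  have "(I has_integral (F p - F ym)) {ym..p}"
    using y1 y2 deriv by (intro fundamental_theorem_of_calculus) (auto simp: ym_def)
  moreover have Inn: "0 \<le> I y" if "y \<in> {ym..p}" for y
    using that one[of y] k_pos p_pos A_pos[of y] by (auto simp: I_def)
  ultimately have int: "(\<integral>\<^sup>+y. ennreal (I y) * indicator {ym..p} y \<partial>lborel) = ennreal (F p - F ym)"
    by (intro nn_integral_has_integral_lebesgue')
  have val: "F p - F ym = fan_density h s"
  proof -
    have "Y y1 = 1 / M h"
    proof -
      have 1: "p - y1 = p / h\<^sup>2"
        by (simp add: y1_def right_diff_distrib)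
      have "1 - p * y1 = (1 - p\<^sup>2) + p\<^sup>2 / h\<^sup>2"
        by (simp add: y1_def right_diff_distrib power2_eq_square)
      also have "\<dots> = M h / h\<^sup>2"
        using h by (simp add: M_def k_sq [symmetric] add_divide_distrib)
      finally have 2: "1 - p * y1 = M h / h\<^sup>2" .
      show ?thesis
        unfolding Y_def 1 2 using h p_pos by simp
    qed
    moreover have "Y y2 = 1 - s / e"
    proof -
      have "p - y2 = p * k\<^sup>2 * (e - s) / (k\<^sup>2 * e + p\<^sup>2 * s)"
        using d by (simp add: y2_def divide_simps) (simp add: k_sq algebra_simps)
      moreover have "1 - p * y2 = k\<^sup>2 * e / (k\<^sup>2 * e + p\<^sup>2 * s)"
        using d by (simp add: y2_def divide_simps power2_eq_square)
      moreover have "p * k\<^sup>2 * (e - s) / D / (p * (k\<^sup>2 * e / D)) = 1 - s / e" if "0 < D" for D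
        using that p_pos k_pos e_pos by (simp add: diff_divide_distrib)
      ultimately show ?thesis
        using d unfolding Y_def by simp
    qed
    ultimately have Y: "Y ym = fan_height h s"
      using c1[of y2] c2[of y1] y1 y2 by (auto simp: ym_def fan_height_def max_def min_def)
    have ym: "ym \<le> p" using y1 y2 by (simp add: ym_def)
    have "(p - ym)\<^sup>2 = p\<^sup>2 * (1 - p * ym)\<^sup>2 * (fan_height h s)\<^sup>2"
      using one[OF ym] p_pos by (simp add: Y_def Y [symmetric] power_divide power_mult_distrib)
    then have "(p - ym)\<^sup>2 / A ym = p\<^sup>2 * (fan_height h s)\<^sup>2 / (1 - s\<^sup>2 - M h * (fan_height h s)\<^sup>2)"
      using one[OF ym] by (simp add: A_eq[OF ym] Y)
    then have "F p - F ym = k / (2 * p * (1 - s\<^sup>2)) *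
        (p\<^sup>2 * (fan_height h s)\<^sup>2 / (1 - s\<^sup>2 - M h * (fan_height h s)\<^sup>2))"
      by (simp add: F_def)
    also have "k / (2 * p * c) * (p\<^sup>2 * H / B) = k * p / 2 * H / (c * B)" for c H B
      using p_pos by (simp add: power2_eq_square)
    finally show ?thesis
      using s by (simp add: fan_density_def)
  qed
  have "(if 0 < y \<and> y < p then (1 - p * y) / k * ((p - y) / p) *
             swept b (s * ((1 - p * y) / k)) y (h * ((p - y) / p)) else 0) =
        (if h \<le> b then I y * indicator {ym..p} y else 0)" for y
  proof (cases "0 < y \<and> y < p")
    case True
    then have o: "0 < 1 - p * y" using one[of y] by simp
    have 1: "h * ((p - y) / p) * p \<le> b * (p - y) \<longleftrightarrow> h \<le> b"
      using True p_pos by simp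
    have 2: "k * e * (s * ((1 - p * y) / k)) + p * y \<le> 1"
    proof -
      have "k * e * (s * ((1 - p * y) / k)) = (e * s) * (1 - p * y)" using k_pos by simp
      also have "\<dots> \<le> 1 * (1 - p * y)" using s o by (intro mult_right_mono) auto
      finally show ?thesis by simp
    qed
    have 3: "prism (s * ((1 - p * y) / k)) y (h * ((p - y) / p)) \<longleftrightarrow> y2 \<le> y"
      using 2 True s o k_pos p_pos h c2'[of y] by (auto simp: prism_def)
    have 4: "ym \<le> y \<longleftrightarrow> y1 \<le> y \<and> y2 \<le> y" by (auto simp: ym_def)
    have 5: "(1 - p * y) / k * ((p - y) / p) * klein_density (s * ((1 - p * y) / k)) y (h * ((p - y) / p)) = I y"
      if "ym \<le> y"
    proof -
      let ?n = "(s * ((1 - p * y) / k))\<^sup>2 + y\<^sup>2 + (h * ((p - y) / p))\<^sup>2"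
      have An: "A y = k\<^sup>2 * (1 - ?n)" by (rule A_norm)
      have "0 < 1 - ?n"
        using A_pos[OF that] True k_pos unfolding An by (simp add: zero_less_mult_iff)
      then have "klein_density (s * ((1 - p * y) / k)) y (h * ((p - y) / p)) = 1 / (1 - ?n)\<^sup>2"
        by (simp add: klein_density_def)
      also have "\<dots> = k ^ 4 / (A y)\<^sup>2"
        unfolding An using k_pos by (simp add: power_mult_distrib)
      finally show ?thesis
        using k_pos p_pos by (simp add: I_def power2_eq_square power3_eq_cube power4_eq_xxxx)
    qed
    show ?thesis
      using True 1 3 4 5 c1'[of y] by (auto simp: swept_def)
  next
    case False
    then have "I y * indicator {ym..p} y = 0"
      using y2 by (auto simp: I_def indicator_def ym_def)
    then show ?thesis by (simp only: if_not_P[OF False] if_cancel)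
  qed
  then have "(\<integral>\<^sup>+y. ennreal (if 0 < y \<and> y < p then (1 - p * y) / k * ((p - y) / p) *
             swept b (s * ((1 - p * y) / k)) y (h * ((p - y) / p)) else 0) \<partial>lborel) =
      (\<integral>\<^sup>+y. (if h \<le> b then ennreal (I y) * indicator {ym..p} y else 0) \<partial>lborel)"
    by (intro nn_integral_cong) (auto simp: indicator_def)
  also have "\<dots> = ennreal (if h \<le> b then fan_density h s else 0)"
    using int val by simp
  finally show ?thesis .
qed

lemma fan_fibre_zero:
  assumes "0 < h" "s < 0 \<or> e \<le> s \<or> 1 < e * s" "0 < y" "y < p"
  shows "swept b (s * ((1 - p * y) / k)) y (h * ((p - y) / p)) = 0"
proof -
  have o: "0 < 1 - p * y"
    using mult_strict_mono[of p 1 y 1] assms p_less_1 p_pos by simp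
  have "\<not> prism (s * ((1 - p * y) / k)) y (h * ((p - y) / p))"
    using assms(2)
  proof (elim disjE)
    assume "s < 0"
    then have "s * ((1 - p * y) / k) < 0"
      using o k_pos by (intro mult_neg_pos) auto
    then show ?thesis by (auto simp: prism_def)
  next
    assume "e \<le> s"
    have "y * (k\<^sup>2 * e) < e * (1 - p * y) * p"
    proof -
      have "e * (1 - p * y) * p - y * (k\<^sup>2 * e) = e * (p - y)"
        using pk by algebra
      moreover have "0 < e * (p - y)" using assms e_pos by simp
      ultimately show ?thesis by linarith
    qed
    also have "\<dots> \<le> s * (1 - p * y) * p"
      using \<open>e \<le> s\<close> o p_pos by (intro mult_right_mono) auto
    finally have "y * (k * e) < s * ((1 - p * y) / k) * p"
      using k_pos by (simp add: field_simps power2_eq_square)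
    then show ?thesis by (auto simp: prism_def)
  next
    assume "1 < e * s"
    then have "1 * (1 - p * y) < (e * s) * (1 - p * y)"
      using o by (simp only: mult_less_cancel_right_pos)
    also have "\<dots> = k * e * (s * ((1 - p * y) / k))"
      using k_pos by simp
    finally show ?thesis by (auto simp: prism_def)
  qed
  then show ?thesis by (simp add: swept_def)
qed

lemma vol_swept:
  "vol (swept b) = (\<integral>\<^sup>+h. (if 0 < h \<and> h \<le> b then gain h else 0) \<partial>lborel)"
proof -
  let ?P = "\<lambda>y. 0 < y \<and> y < p"
  let ?f = "\<lambda>h s y. if ?P y then (1 - p * y) / k * ((p - y) / p) *
      swept b (s * ((1 - p * y) / k)) y (h * ((p - y) / p)) else 0"
  have "swept b x y z = (if ?P y then swept b x y z else 0)" for x y z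
    by (auto simp: swept_def prism_def)
  then have "vol (swept b) =
      (\<integral>\<^sup>+y. \<integral>\<^sup>+x. \<integral>\<^sup>+z. ennreal (if ?P y then swept b x y z else 0) \<partial>lborel \<partial>lborel \<partial>lborel)"
    unfolding vol_def by presburger
  also have "\<dots> = (\<integral>\<^sup>+h. \<integral>\<^sup>+s. \<integral>\<^sup>+y. ennreal (?f h s y) \<partial>lborel \<partial>lborel \<partial>lborel)"
  proof (rule nn_integral_fibrewise_scaling[OF measurable_swept])
    fix y assume "0 < y \<and> y < p"
    then show "0 < (1 - p * y) / k" "0 < (p - y) / p"
      using mult_strict_mono[of p 1 y 1] p_less_1 p_pos k_pos by simp_all
  qed auto
  also have "\<dots> = (\<integral>\<^sup>+h. (if 0 < h \<and> h \<le> b then gain h else 0) \<partial>lborel)"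
  proof (rule nn_integral_cong)
    fix h :: real
    show "(\<integral>\<^sup>+s. \<integral>\<^sup>+y. ennreal (?f h s y) \<partial>lborel \<partial>lborel) = (if 0 < h \<and> h \<le> b then gain h else 0)"
    proof (cases "0 < h")
      case h: True
      \<comment> \<open>For these two values the closed inequalities of \<open>prism\<close> may
        leave a nonzero fibre, while \<open>fan_density\<close> is 0 there.\<close>
      have "AE s in lborel. s \<noteq> 0 \<and> s \<noteq> 1 / e"
        using AE_lborel_singleton[of "0::real"] AE_lborel_singleton[of "1 / e"] by eventually_elim simp
      then have "AE s in lborel. (\<integral>\<^sup>+y. ennreal (?f h s y) \<partial>lborel) = ennreal (if h \<le> b then fan_density h s else 0)"
      proof eventually_elim
        case (elim s)
        show ?case
        proof (cases "0 < s \<and> s < e \<and> e * s < 1")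
          case True
          then show ?thesis using fan_fibre[OF h, of s b] by simp
        next
          case False
          have "e * s \<noteq> 1" using elim e_pos by (simp add: field_simps)
          then have "s < 0 \<or> e \<le> s \<or> 1 < e * s" using False elim by linarith
          then have "?f h s y = 0" for y using fan_fibre_zero[OF h] by simp
          then have "(\<integral>\<^sup>+y. ennreal (?f h s y) \<partial>lborel) = 0" by (simp only: ennreal_0 nn_integral_const mult_zero_left)
          moreover have "fan_density h s = 0" unfolding fan_density_def using False by (rule if_not_P)
          ultimately show ?thesis by (simp only: if_cancel ennreal_0)
        qed
      qed
      then have "(\<integral>\<^sup>+s. \<integral>\<^sup>+y. ennreal (?f h s y) \<partial>lborel \<partial>lborel) =
          (\<integral>\<^sup>+s. ennreal (if h \<le> b then fan_density h s else 0) \<partial>lborel)"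
        by (rule nn_integral_cong_AE)
      also have "\<dots> = (if 0 < h \<and> h \<le> b then gain h else 0)"
        using h by (simp add: gain_def)
      finally show ?thesis .
    next
      case False
      have "?f h s y = 0" for s y
      proof (cases "?P y")
        case True
        then have "h * ((p - y) / p) \<le> 0"
          using False p_pos by (intro mult_nonpos_nonneg) auto
        then show ?thesis by (auto simp: swept_def prism_def)
      qed (simp only: if_False)
      then show ?thesis
        using False by (simp only: ennreal_0 nn_integral_const mult_zero_left simp_thms if_False)
    qed
  qed
  finally show ?thesis .
qed

text \<open>The removed region is a fan of half-planes about the third coordinate axis, with t the slope.\<close>

definition slice_radius :: "real \<Rightarrow> real \<Rightarrow> real" where
  "slice_radius z t = min (p * (1 - z\<^sup>2)) (1 / (k * e * t + p))"

text \<open>The density integrated along the ray of slope t at height z, from the axis P2 P3 out to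
  y = \<open>slice_radius z t\<close>. The first bound there is \<sigma> = 1/z, the second the polar
  plane of P0; t * p < k * e is the plane through P0, P2, P3.\<close>

definition slice_density :: "real \<Rightarrow> real \<Rightarrow> real" where
  "slice_density z t = (if 0 < z \<and> z < 1 \<and> 0 < t \<and> t * p < k * e
     then (slice_radius z t)\<^sup>2 / (2 * (1 - z\<^sup>2) * (1 - z\<^sup>2 - (1 + t\<^sup>2) * (slice_radius z t)\<^sup>2)) else 0)"

text \<open>The polar plane of P3 is z = 1/h, and 1/h^2 is the speed at which it moves.\<close>

definition loss :: "real \<Rightarrow> ennreal" where
  "loss h = (\<integral>\<^sup>+t. ennreal (slice_density (1 / h) t / h\<^sup>2) \<partial>lborel)"

text \<open>The square of a minimum is at most the product of its two terms. After that the claim is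
  p + t^2 p < k e t + p, which is t * p < k * e.\<close>

lemma slice_radius_bounds:
  assumes "0 < z" "z < 1" "0 < t" "t * p < k * e"
  shows "0 < slice_radius z t" "0 < 1 - z\<^sup>2" "(1 + t\<^sup>2) * (slice_radius z t)\<^sup>2 < 1 - z\<^sup>2"
proof -
  have d: "0 < k * e * t + p" using assms p_pos k_pos e_pos by (simp add: add_pos_pos)
  show w: "0 < 1 - z\<^sup>2" using assms by (simp add: power_less_one_iff)
  show pos: "0 < slice_radius z t" using d w p_pos by (simp add: slice_radius_def)
  have "(slice_radius z t)\<^sup>2 \<le> p * (1 - z\<^sup>2) * (1 / (k * e * t + p))"
    unfolding power2_eq_square[of "slice_radius z t"] using pos d w p_pos
    by (intro mult_mono) (auto simp: slice_radius_def)
  then have "(1 + t\<^sup>2) * (slice_radius z t)\<^sup>2 \<le> (1 + t\<^sup>2) * (p * (1 - z\<^sup>2) * (1 / (k * e * t + p)))"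
    by (intro mult_left_mono) auto
  also have "\<dots> = (1 - z\<^sup>2) * ((p + t * (t * p)) / (k * e * t + p))"
    by (simp add: power2_eq_square algebra_simps)
  also have "\<dots> < (1 - z\<^sup>2) * 1"
  proof -
    have "p + t * (t * p) < k * e * t + p"
      using mult_strict_left_mono[OF assms(4,3)] by (simp add: algebra_simps)
    then show ?thesis
      using d w by (intro mult_strict_left_mono) auto
  qed
  finally show "(1 + t\<^sup>2) * (slice_radius z t)\<^sup>2 < 1 - z\<^sup>2" by simp
qed

lemma slice_density_nonneg: "0 \<le> slice_density z t"
  using slice_radius_bounds[of z t] by (auto simp: slice_density_def intro!: divide_nonneg_nonneg mult_nonneg_nonneg)

lemma slice_fibre:
  assumes z: "0 < z" "z < 1" and t: "0 < t" "t * p < k * e"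
  shows "(\<integral>\<^sup>+y. ennreal (if 0 < y \<and> y < p then y * 1 * removed b (t * y) y (z * 1) else 0) \<partial>lborel) =
         ennreal (if 1 < z * b then slice_density z t else 0)"
proof -
  define Y where "Y = slice_radius z t"
  define w where "w = 1 - z\<^sup>2"
  define B where "B y = w - (1 + t\<^sup>2) * y\<^sup>2" for y
  note bnd = slice_radius_bounds[OF z t, folded Y_def w_def]
  have d: "0 < k * e * t + p" using t p_pos k_pos e_pos by (simp add: add_pos_pos)
  have Yp: "Y < p"
  proof -
    have "Y \<le> p * w" by (simp add: Y_def w_def slice_radius_def)
    also have "\<dots> < p * 1" using z p_pos by (simp add: w_def)
    finally show ?thesis by simp
  qed
  have B_pos: "0 < B y" if "0 \<le> y" "y \<le> Y" for y
  proof -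
    have "(1 + t\<^sup>2) * y\<^sup>2 \<le> (1 + t\<^sup>2) * Y\<^sup>2"
      using that by (intro mult_left_mono power_mono) auto
    then show ?thesis using bnd by (simp add: B_def)
  qed
  define I where "I y = y / (B y)\<^sup>2" for y
  define F where "F y = 1 / (2 * w) * (y\<^sup>2 / B y)" for y
  have deriv: "(F has_vector_derivative I y) (at y within {0..Y})" if "y \<in> {0..Y}" for y
  proof -
    have By: "B y \<noteq> 0" using B_pos[of y] that by auto
    have dB: "(B has_real_derivative - ((1 + t\<^sup>2) * (2 * y))) (at y within {0..Y})"
      unfolding B_def by (auto intro!: derivative_eq_intros)
    have dy: "((\<lambda>y. y\<^sup>2) has_real_derivative 2 * y) (at y within {0..Y})"
      by (auto intro!: derivative_eq_intros)
    have "(F has_real_derivative 1 / (2 * w) * ((2 * y * B y - y\<^sup>2 * - ((1 + t\<^sup>2) * (2 * y))) / (B y * B y)))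
        (at y within {0..Y})"
      unfolding F_def by (rule DERIV_cmult[OF DERIV_divide[OF dy dB By]])
    also have "2 * y * B y - y\<^sup>2 * - ((1 + t\<^sup>2) * (2 * y)) = 2 * w * y"
      unfolding B_def by algebra
    also have "1 / (2 * w) * (2 * w * y / (B y * B y)) = I y"
      using bnd by (simp add: I_def power2_eq_square)
    finally show ?thesis
      by (simp add: has_real_derivative_iff_has_vector_derivative)
  qed
  have "(I has_integral (F Y - F 0)) {0..Y}"
    using bnd deriv by (intro fundamental_theorem_of_calculus) auto
  moreover have "0 \<le> I y" if "y \<in> {0..Y}" for y
    using that by (auto simp: I_def)
  ultimately have int: "(\<integral>\<^sup>+y. ennreal (I y) * indicator {0..Y} y \<partial>lborel) = ennreal (F Y - F 0)"
    by (intro nn_integral_has_integral_lebesgue')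
  have val: "F Y - F 0 = slice_density z t"
    using z t by (simp add: F_def B_def slice_density_def Y_def w_def)
  have "(if 0 < y \<and> y < p then y * 1 * removed b (t * y) y (z * 1) else 0) =
        (if 1 < z * b then I y * indicator {0..Y} y else 0)" for y
  proof (cases "0 < y \<and> y < p")
    case True
    have 1: "t * y * p \<le> y * (k * e)"
      using mult_left_mono[of "t * p" "k * e" y] t True by (simp add: mult_ac)
    have 2: "k * e * (t * y) + p * y \<le> 1 \<longleftrightarrow> y \<le> 1 / (k * e * t + p)"
      using d by (simp add: field_simps)
    have 3: "z\<^sup>2 * p \<le> p - y \<longleftrightarrow> y \<le> p * (1 - z\<^sup>2)"
      by (auto simp: algebra_simps)
    have 4: "y \<le> Y \<longleftrightarrow> prism (t * y) y z \<and> z\<^sup>2 * p \<le> p - y"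
      unfolding 3 prism_def 2 using 1 True t z by (auto simp: Y_def slice_radius_def)
    have 5: "klein_density (t * y) y z = 1 / (B y)\<^sup>2" if "y \<le> Y"
    proof -
      have "1 - ((t * y)\<^sup>2 + y\<^sup>2 + z\<^sup>2) = B y"
        by (simp add: B_def w_def algebra_simps power2_eq_square)
      then show ?thesis
        using B_pos[OF _ that] True by (simp add: klein_density_def)
    qed
    show ?thesis
    proof (cases "1 < z * b \<and> y \<le> Y")
      case c: True
      then show ?thesis
        using True 4 5 by (simp add: removed_def I_def)
    next
      case c: False
      then have "removed b (t * y) y (z * 1) = 0"
        using 4 by (auto simp: removed_def)
      then show ?thesis
        using True c by auto
    qed
  next
    case False
    then have "I y * indicator {0..Y} y = 0"
      using Yp by (auto simp: I_def indicator_def)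
    then show ?thesis by (simp only: if_not_P[OF False] if_cancel)
  qed
  then have "(\<integral>\<^sup>+y. ennreal (if 0 < y \<and> y < p then y * 1 * removed b (t * y) y (z * 1) else 0) \<partial>lborel) =
      (\<integral>\<^sup>+y. (if 1 < z * b then ennreal (I y) * indicator {0..Y} y else 0) \<partial>lborel)"
    by (intro nn_integral_cong) (auto simp: indicator_def)
  also have "\<dots> = ennreal (if 1 < z * b then slice_density z t else 0)"
    using int val by simp
  finally show ?thesis .
qed

lemma slice_fibre_zero:
  assumes "z \<le> 0 \<or> 1 \<le> z \<or> t < 0 \<or> k * e < t * p" "0 < y"
  shows "removed b (t * y) y z = 0"
proof (cases "1 \<le> z")
  case True
  then have "1 \<le> z\<^sup>2" by (simp add: one_le_power)
  then have "\<not> (t * y)\<^sup>2 + y\<^sup>2 + z\<^sup>2 < 1"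
    by (smt (verit) zero_le_power2)
  then show ?thesis by (simp add: removed_def klein_density_def)
next
  case False
  have "y * (k * e) < t * y * p" if "k * e < t * p"
    using mult_strict_left_mono[OF that \<open>0 < y\<close>] by (simp add: mult_ac)
  moreover have "t * y < 0" if "t < 0"
    using that assms by (simp add: mult_neg_pos)
  ultimately have "\<not> prism (t * y) y z"
    using assms False by (auto simp: prism_def)
  then show ?thesis by (simp add: removed_def)
qed

lemma measurable_slice_density [measurable]:
  "(\<lambda>w. slice_density (f w) (g w)) \<in> borel_measurable N"
  if [measurable]: "f \<in> borel_measurable N" "g \<in> borel_measurable N"
  unfolding slice_density_def slice_radius_def by measurable

lemma vol_removed:
  assumes "0 < b"
  shows "vol (removed b) = (\<integral>\<^sup>+h. (if 0 < h \<and> h \<le> b then loss h else 0) \<partial>lborel)"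
proof -
  let ?P = "\<lambda>y. 0 < y \<and> y < p"
  let ?f = "\<lambda>z t y. if ?P y then y * 1 * removed b (t * y) y (z * 1) else 0"
  have "removed b x y z = (if ?P y then removed b x y z else 0)" for x y z
    by (auto simp: removed_def prism_def)
  then have "vol (removed b) =
      (\<integral>\<^sup>+y. \<integral>\<^sup>+x. \<integral>\<^sup>+z. ennreal (if ?P y then removed b x y z else 0) \<partial>lborel \<partial>lborel \<partial>lborel)"
    unfolding vol_def by presburger
  also have "\<dots> = (\<integral>\<^sup>+z. \<integral>\<^sup>+t. \<integral>\<^sup>+y. ennreal (?f z t y) \<partial>lborel \<partial>lborel \<partial>lborel)"
    by (rule nn_integral_fibrewise_scaling[OF measurable_removed]) auto
  also have "\<dots> = (\<integral>\<^sup>+z. \<integral>\<^sup>+t. ennreal (if 1 < z * b then slice_density z t else 0) \<partial>lborel \<partial>lborel)"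
  proof (rule nn_integral_cong, rule nn_integral_cong_AE)
    fix z :: real
    have "AE t in lborel. t \<noteq> 0 \<and> t \<noteq> k * e / p"
      using AE_lborel_singleton[of "0::real"] AE_lborel_singleton[of "k * e / p"] by eventually_elim simp
    then show "AE t in lborel. (\<integral>\<^sup>+y. ennreal (?f z t y) \<partial>lborel) = ennreal (if 1 < z * b then slice_density z t else 0)"
    proof eventually_elim
      case (elim t)
      show ?case
      proof (cases "0 < z \<and> z < 1 \<and> 0 < t \<and> t * p < k * e")
        case True
        then show ?thesis using slice_fibre[of z t b] by simp
      next
        case False
        have "t * p \<noteq> k * e" using elim p_pos by (simp add: field_simps)
        then have "z \<le> 0 \<or> 1 \<le> z \<or> t < 0 \<or> k * e < t * p" using False elim by linarith
        then have "?f z t y = 0" for y using slice_fibre_zero[of z t] by simp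
        then have "(\<integral>\<^sup>+y. ennreal (?f z t y) \<partial>lborel) = 0" by (simp only: ennreal_0 nn_integral_const mult_zero_left)
        moreover have "slice_density z t = 0" unfolding slice_density_def using False by (rule if_not_P)
        ultimately show ?thesis by (simp only: if_cancel ennreal_0)
      qed
    qed
  qed
  also have "\<dots> = (\<integral>\<^sup>+h. (if 0 < h \<and> h \<le> b then loss h else 0) \<partial>lborel)"
  proof (cases "1 \<le> b")
    case True
    have "(\<integral>\<^sup>+z. \<integral>\<^sup>+t. ennreal (if 1 < z * b then slice_density z t else 0) \<partial>lborel \<partial>lborel) =
        (\<integral>\<^sup>+t. \<integral>\<^sup>+z. ennreal (if 1 < z * b then slice_density z t else 0) \<partial>lborel \<partial>lborel)"
      by (rule lborel_pair.Fubini') measurable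
    also have "\<dots> = (\<integral>\<^sup>+t. \<integral>\<^sup>+z. ennreal (slice_density z t * indicator {1 / b..1} z) \<partial>lborel \<partial>lborel)"
    proof (rule nn_integral_cong, rule nn_integral_cong_AE)
      fix t :: real
      show "AE z in lborel. ennreal (if 1 < z * b then slice_density z t else 0) =
          ennreal (slice_density z t * indicator {1 / b..1} z)"
        using AE_lborel_singleton[of "1 / b"]
      proof eventually_elim
        case (elim z)
        then have "1 < z * b \<longleftrightarrow> 1 / b \<le> z" using assms by (auto simp: field_simps)
        then show ?case by (auto simp: indicator_def slice_density_def)
      qed
    qed
    also have "\<dots> = (\<integral>\<^sup>+t. \<integral>\<^sup>+h. ennreal (slice_density (1 / h) t * (1 / h\<^sup>2) * indicator {1..b} h) \<partial>lborel \<partial>lborel)"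
      using True by (intro nn_integral_cong nn_integral_reciprocal) auto
    also have "\<dots> = (\<integral>\<^sup>+h. \<integral>\<^sup>+t. ennreal (slice_density (1 / h) t * (1 / h\<^sup>2) * indicator {1..b} h) \<partial>lborel \<partial>lborel)"
      by (rule lborel_pair.Fubini') measurable
    also have "\<dots> = (\<integral>\<^sup>+h. (if 0 < h \<and> h \<le> b then loss h else 0) \<partial>lborel)"
      by (intro nn_integral_cong) (auto simp: loss_def indicator_def slice_density_def field_simps)
    finally show ?thesis .
  next
    case False
    have "(if 1 < z * b then slice_density z t else 0) = 0" for z t
    proof (cases "0 < z \<and> z < 1")
      case True
      then have "z * b \<le> 1" using False assms mult_mono[of z 1 b 1] by simp
      then show ?thesis by simp
    qed (auto simp: slice_density_def)
    moreover have "(if 0 < h \<and> h \<le> b then loss h else 0) = 0" for h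
      using False by (auto simp: loss_def slice_density_def)
    ultimately show ?thesis by (simp only: ennreal_0 nn_integral_const mult_zero_left)
  qed
  finally show ?thesis .
qed

end

section \<open>Closed forms of gain and loss\<close>

lemma artanh_add:
  fixes a b :: real
  assumes "\<bar>a\<bar> < 1" "\<bar>b\<bar> < 1"
  shows "artanh a + artanh b = artanh ((a + b) / (1 + a * b))"
proof -
  have "\<bar>a * b\<bar> < 1"
    using mult_strict_mono[of "\<bar>a\<bar>" 1 "\<bar>b\<bar>" 1] assms by (simp add: abs_mult)
  then have ab: "0 < 1 + a * b" by linarith
  have pos: "0 < 1 + a" "0 < 1 - a" "0 < 1 + b" "0 < 1 - b" using assms by auto
  have "(1 + (a + b) / (1 + a * b)) / (1 - (a + b) / (1 + a * b)) =
      ((1 + a * b + (a + b)) / (1 + a * b)) / ((1 + a * b - (a + b)) / (1 + a * b))"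
    using ab by (simp add: add_divide_distrib diff_divide_distrib)
  also have "\<dots> = (1 + a * b + (a + b)) / (1 + a * b - (a + b))"
    using ab by simp
  also have "\<dots> = ((1 + a) / (1 - a)) * ((1 + b) / (1 - b))"
    by (simp add: algebra_simps)
  finally have eq: "(1 + (a + b) / (1 + a * b)) / (1 - (a + b) / (1 + a * b)) = ((1 + a) / (1 - a)) * ((1 + b) / (1 - b))" .
  have "ln (((1 + a) / (1 - a)) * ((1 + b) / (1 - b))) = ln ((1 + a) / (1 - a)) + ln ((1 + b) / (1 - b))"
    using pos by (intro ln_mult_pos divide_pos_pos)
  then show ?thesis
    unfolding artanh_def eq by simp
qed

lemma artanh_has_integral:
  fixes w b :: real
  assumes "0 < w" "0 \<le> b" "b < w"
  shows "((\<lambda>s. 1 / (w\<^sup>2 - s\<^sup>2)) has_integral artanh (b / w) / w) {0..b}"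
proof -
  have "((\<lambda>s. artanh (s / w) / w) has_vector_derivative 1 / (w\<^sup>2 - s\<^sup>2)) (at s within {0..b})"
    if "s \<in> {0..b}" for s
  proof -
    have s: "\<bar>s / w\<bar> < 1" using that assms by auto
    have sw: "s\<^sup>2 < w\<^sup>2" using that assms by (intro power_strict_mono) auto
    have "((\<lambda>s. artanh (s / w) / w) has_real_derivative (1 / (1 - (s / w)\<^sup>2) * (1 / w)) / w) (at s within {0..b})"
      by (rule DERIV_cdivide, rule DERIV_chain'[where f = "\<lambda>s. s / w"])
        (use s assms in \<open>auto intro!: derivative_eq_intros\<close>)
    also have "(1 / (1 - (s / w)\<^sup>2) * (1 / w)) / w = 1 / (w\<^sup>2 - s\<^sup>2)"
      using assms sw by (simp add: field_simps power2_eq_square)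
    finally show ?thesis
      by (simp add: has_real_derivative_iff_has_vector_derivative)
  qed
  then have "((\<lambda>s. 1 / (w\<^sup>2 - s\<^sup>2)) has_integral (artanh (b / w) / w - artanh (0 / w) / w)) {0..b}"
    using assms by (intro fundamental_theorem_of_calculus)
  then show ?thesis by simp
qed

text \<open>Up to elementary factors this is the length of the edge from P0 to P3 after truncation.\<close>

definition edge_term :: "real \<Rightarrow> real" where
  "edge_term S = (if S < 1 then artanh (sqrt S) else artanh (1 / sqrt S)) / sqrt S"

text \<open>For m = M h, discr e m = r^2 + h^2 - r^2 h^2, which is negative exactly when the
  polar planes of P0 and P3 meet.\<close>

definition discr :: "real \<Rightarrow> real \<Rightarrow> real" where
  "discr e m = m * (1 - e\<^sup>2) + e\<^sup>2"

text \<open>Let l be the length of the truncated edge P0 P3. If both ends are ultraideal, cosh^2 l =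
  1 / ((r^2 - 1)(h^2 - 1)), so tanh^2 l is the discriminant. If only one is, sinh^2 l = 1 / ((1 -
  r^2)(h^2 - 1)) and tanh^2 l is its reciprocal. At e = 1 the two logarithms diverge separately, and
  the value is the limit of their difference.\<close>

definition balance :: "real \<Rightarrow> real \<Rightarrow> real" where
  "balance e m = (if e = 1 then - ln \<bar>m - 1\<bar> / 2 else e * edge_term (discr e m) - artanh (min e (1 / e)))"

lemma discr_minus_1: "discr e m - 1 = (m - 1) * (1 - e\<^sup>2)"
  by (simp add: discr_def algebra_simps)

text \<open>To the right of e (1 - 1/m) one has m (1 - s/e) \<le> 1, so the last term is at most 1 -
  s/e, and s^2 < s/e for 0 < s < 1/e. At s = 0 strictness comes from m < 1. At s = 1/e the value is
  (e^2 - 1) * discr e m / e^4, which is where the sign of the discriminant enters.\<close>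

lemma quadratic_pos:
  fixes e m s :: real
  assumes e: "0 < e" and m: "0 < m" "m \<noteq> 1" and S: "0 < discr e m"
    and s: "max 0 (e * (1 - 1 / m)) \<le> s" "s \<le> min e (1 / e)" "e = 1 \<Longrightarrow> s < 1"
  shows "0 < 1 - s\<^sup>2 - m * (1 - s / e)\<^sup>2"
proof -
  have s': "0 \<le> s" "s \<le> e" "s \<le> 1 / e" "e * (1 - 1 / m) \<le> s" using s by auto
  have y: "0 \<le> 1 - s / e" using s' e by simp
  show ?thesis
  proof (cases "s = 1 / e")
    case False
    have my: "m * (1 - s / e)\<^sup>2 \<le> 1 - s / e"
    proof -
      have "e * (1 - s / e) \<le> e * (1 / m)" using s' e by (simp add: right_diff_distrib)
      then have "1 - s / e \<le> 1 / m" using e by (simp only: mult_le_cancel_left_pos)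
      then have "m * (1 - s / e) \<le> m * (1 / m)" using m by (simp only: mult_le_cancel_left_pos)
      then have "m * (1 - s / e) \<le> 1" using m by simp
      then have "(m * (1 - s / e)) * (1 - s / e) \<le> 1 * (1 - s / e)" using y by (intro mult_right_mono)
      then show ?thesis by (simp add: power2_eq_square mult.assoc)
    qed
    show ?thesis
    proof (cases "s = 0")
      case True
      then have "1 - 1 / m \<le> 0" using s' e by (simp add: mult_le_0_iff)
      then show ?thesis using True m by (simp add: field_simps)
    next
      case False
      then have "s * s < s * (1 / e)" using s' \<open>s \<noteq> 1 / e\<close> by (intro mult_strict_left_mono) auto
      then show ?thesis using my by (simp add: power2_eq_square)
    qed
  next
    case True
    have e1: "e > 1"
    proof (rule ccontr)
      assume "\<not> 1 < e"
      moreover have "1 / e \<le> e" using True s' by simp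
      ultimately have "e = 1" using e by (smt (verit) divide_le_eq mult_left_le)
      then show False using s True by simp
    qed
    have "1 - s\<^sup>2 - m * (1 - s / e)\<^sup>2 = (e\<^sup>2 - 1) * discr e m / e ^ 4"
      using e unfolding True discr_def by (simp add: field_simps power2_eq_square power4_eq_xxxx)
    moreover have "0 < e\<^sup>2 - 1" using e1 by (simp add: one_less_power)
    ultimately show ?thesis using S e by simp
  qed
qed

text \<open>\<open>A\<close> and -\<open>B\<close> are the end values of the linear function whose
  artanh is the antiderivative in \<open>balance_has_integral\<close>. With S the discriminant and q
  its root, the addition theorem gives artanh of (A + B) q / (S + A B). The identity S + e^2 m = m +
  e^2 reduces this to q if e and m lie on the same side of 1, and to 1/q otherwise.\<close>

lemma edge_term_as_sum:
  fixes e m :: real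
  assumes e: "0 < e" "e \<noteq> 1" and m: "0 < m" "m \<noteq> 1" and S: "0 < discr e m"
    and A: "A = (if e < 1 then e\<^sup>2 else discr e m / e\<^sup>2)"
    and B: "B = (if m < 1 then m else discr e m / m)"
    and "\<bar>A / sqrt (discr e m)\<bar> < 1" "\<bar>B / sqrt (discr e m)\<bar> < 1"
  shows "artanh (A / sqrt (discr e m)) + artanh (B / sqrt (discr e m)) =
         edge_term (discr e m) * sqrt (discr e m)"
proof -
  define S where "S = discr e m"
  define q where "q = sqrt S"
  have q: "0 < q" "q * q = S" using S by (auto simp: S_def q_def)
  have S0: "0 < S" using S by (simp add: S_def)
  have key: "S + e\<^sup>2 * m = m + e\<^sup>2" by (simp add: S_def discr_def algebra_simps)
  have em: "0 < m + e\<^sup>2" using m e by (simp add: add_pos_pos)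
  have "artanh (A / q) + artanh (B / q) = artanh ((A / q + B / q) / (1 + A / q * (B / q)))"
    using assms(8,9) unfolding S_def q_def by (intro artanh_add)
  also have "(A / q + B / q) / (1 + A / q * (B / q)) = ((A + B) / q) / ((S + A * B) / S)"
    using q S0 by (simp add: add_divide_distrib)
  also have "\<dots> = (A + B) * q / (S + A * B)"
  proof -
    have "S / q = q" using q by (auto simp: field_simps)
    moreover have "((A + B) / q) / ((S + A * B) / S) = (A + B) * (S / q) / (S + A * B)" by simp
    ultimately show ?thesis by (simp only:)
  qed
  also have "\<dots> = (if S < 1 then q else 1 / q)"
  proof -
    have sg: "S < 1 \<longleftrightarrow> (m < 1 \<longleftrightarrow> e < 1)"
    proof -
      have "S < 1 \<longleftrightarrow> (m - 1) * (1 - e\<^sup>2) < 0" using discr_minus_1[of e m] by (auto simp: S_def)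
      also have "\<dots> \<longleftrightarrow> (m < 1 \<longleftrightarrow> e < 1)"
      proof (cases "e < 1")
        case True
        then have "e\<^sup>2 < 1" using e power_strict_mono[of e 1 2] by simp
        then show ?thesis using True by (auto simp: mult_less_0_iff)
      next
        case False
        then have "1 < e\<^sup>2" using e power_strict_mono[of 1 e 2] by simp
        then show ?thesis using False m by (auto simp: mult_less_0_iff)
      qed
      finally show ?thesis .
    qed
    consider "e < 1" "m < 1" | "e < 1" "1 < m" | "1 < e" "m < 1" | "1 < e" "1 < m"
      using e m by linarith
    then show ?thesis
    proof cases
      case 1
      then show ?thesis using sg A B key em by (simp add: S_def add.commute)
    next
      case 2
      have "(e\<^sup>2 + S / m) * q / (S + e\<^sup>2 * (S / m)) = ((S + e\<^sup>2 * m) / m) * q / (S * ((m + e\<^sup>2) / m))"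
        using m by (simp add: field_simps)
      also have "\<dots> = q / S" using key em m by simp
      also have "\<dots> = 1 / q" using q by (auto simp: field_simps)
      finally show ?thesis using sg 2 A B by (simp add: S_def)
    next
      case 3
      have "(S / e\<^sup>2 + m) * q / (S + S / e\<^sup>2 * m) = ((S + e\<^sup>2 * m) / e\<^sup>2) * q / (S * ((m + e\<^sup>2) / e\<^sup>2))"
        using e by (simp add: field_simps)
      also have "\<dots> = q / S" using key em e by simp
      also have "\<dots> = 1 / q" using q by (auto simp: field_simps)
      finally show ?thesis using sg 3 A B by (simp add: S_def)
    next
      case 4
      have "(S / e\<^sup>2 + S / m) * q / (S + S / e\<^sup>2 * (S / m)) =
          (S * ((m + e\<^sup>2) / (e\<^sup>2 * m))) * q / (S * ((S + e\<^sup>2 * m) / (e\<^sup>2 * m)))"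
        using m e S0 by (simp add: field_simps)
      also have "\<dots> = q" using key em m e S0 by simp
      finally show ?thesis using sg 4 A B by (simp add: S_def)
    qed
  qed
  finally show ?thesis
    using q by (simp add: S_def q_def edge_term_def)
qed

text \<open>On [a, b] the fan is bounded by the plane through P0, P2, P3: from the height 1/m, or
  from s = 0, up to P0 or its polar plane, whichever comes first. The term \<open>artanh a\<close>
  is kept apart because the rest of the fan contributes its negative.\<close>

lemma balance_has_integral:
  fixes e m :: real
  assumes e: "0 < e" and m: "0 < m" "m \<noteq> 1" and S: "0 < discr e m"
  defines "a \<equiv> max 0 (e * (1 - 1 / m))" and "b \<equiv> min e (1 / e)"
  shows "((\<lambda>s. 1 / (1 - s\<^sup>2 - m * (1 - s / e)\<^sup>2) - 1 / (1 - s\<^sup>2)) has_integral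
    (balance e m + artanh a)) {a..b}"
proof -
  have x1: "e * (1 - 1 / m) < 1 / e"
  proof -
    have "e\<^sup>2 * (m - 1) < m" using S by (simp add: discr_def algebra_simps)
    then show ?thesis using e m by (simp add: field_simps power2_eq_square)
  qed
  have ab: "a < b" using x1 e m by (auto simp: a_def b_def field_simps)
  have b1: "b < 1" if "e \<noteq> 1"
  proof (cases "e < 1")
    case True
    then show ?thesis by (simp add: b_def)
  next
    case False
    then have "1 / e < 1" using that by simp
    then show ?thesis by (simp add: b_def)
  qed
  have a0: "0 \<le> a" by (simp add: a_def)
  show ?thesis
  proof (cases "e = 1")
    case True
    then have b: "b = 1" and a: "a = max 0 (1 - 1 / m)" by (auto simp: b_def a_def)
    \<comment> \<open>For e = 1 both denominators vanish at s = 1; \<open>n\<close> is what is left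
      of the first after division by 1 - s.\<close>
    define n where "n s = 1 - m + (1 + m) * s" for s
    have n_pos: "0 < n s" if "a \<le> s" for s
    proof (cases "m < 1")
      case True
      then show ?thesis using that a m unfolding n_def by (simp add: add_pos_nonneg)
    next
      case False
      have "(1 + m) * (1 - 1 / m) \<le> (1 + m) * s"
        using that a m by (intro mult_left_mono) auto
      moreover have "(1 + m) * (1 - 1 / m) = m - 1 / m" using m by (simp add: field_simps)
      moreover have "1 / m < 1" using False m by simp
      ultimately show ?thesis by (simp add: n_def)
    qed
    define F where "F s = (ln (n s) - ln (1 + s)) / 2" for s
    have "(F has_vector_derivative ((1 + m) / n s - 1 / (1 + s)) / 2) (at s within {a..1})" if "s \<in> {a..1}" for s
    proof -
      have "0 < n s" "0 < 1 + s" using that n_pos[of s] a0 by auto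
      then have "(F has_real_derivative ((1 + m) / n s - 1 / (1 + s)) / 2) (at s within {a..1})"
        unfolding F_def n_def
        by (intro DERIV_cdivide DERIV_diff) (auto intro!: derivative_eq_intros)
      then show ?thesis by (simp add: has_real_derivative_iff_has_vector_derivative)
    qed
    then have "((\<lambda>s. ((1 + m) / n s - 1 / (1 + s)) / 2) has_integral (F 1 - F a)) {a..1}"
      using ab b by (intro fundamental_theorem_of_calculus) auto
    then have "((\<lambda>s. 1 / (1 - s\<^sup>2 - m * (1 - s / e)\<^sup>2) - 1 / (1 - s\<^sup>2)) has_integral (F 1 - F a)) {a..1}"
    proof (rule has_integral_spike_finite[rotated 2])
      fix s assume "s \<in> {a..1} - {1}"
      then have s: "0 < 1 - s" "0 < 1 + s" "0 < n s" using a0 n_pos[of s] by auto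
      have "1 - s\<^sup>2 - m * (1 - s / e)\<^sup>2 = (1 - s) * n s" "1 - s\<^sup>2 = (1 - s) * (1 + s)"
        unfolding n_def True by (auto simp: power2_eq_square algebra_simps)
      \<comment> \<open>Partial fractions with d = 1 - s, once for each denominator. The singular
        terms 1 / d cancel in the difference.\<close>
      moreover have "c / u = 2 / (d * u) - 1 / d" if "u + c * d = 2" "0 < u" "0 < d" for c d u :: real
      proof -
        have "2 / (d * u) = (u + c * d) / (d * u)" using that by simp
        also have "\<dots> = 1 / d + c / u" using that(2,3) by (simp add: add_divide_distrib)
        finally show ?thesis by simp
      qed
      note this[of "n s" "1 + m" "1 - s"] this[of "1 + s" 1 "1 - s"]
      moreover have "n s + (1 + m) * (1 - s) = 2"
        by (simp add: n_def algebra_simps)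
      ultimately show "1 / (1 - s\<^sup>2 - m * (1 - s / e)\<^sup>2) - 1 / (1 - s\<^sup>2) = ((1 + m) / n s - 1 / (1 + s)) / 2"
        using s by (simp add: diff_divide_distrib)
    qed simp
    moreover have "F 1 - F a = balance e m + artanh a"
    proof -
      have F1: "F 1 = 0" by (simp add: F_def n_def)
      have n1: "n 1 = 2" by (simp add: n_def)
      have "ln (n a) = ln \<bar>m - 1\<bar> + ln (1 - a)"
      proof (cases "m < 1")
        case True
        then have "a = 0" using a m by (simp add: field_simps max_def)
        then show ?thesis using True by (simp add: n_def)
      next
        case False
        then have a': "a = 1 - 1 / m" using a m by (simp add: field_simps max_def)
        have "n a = (m - 1) * (1 - a)" unfolding n_def a' using m by (simp add: field_simps)
        moreover have "ln ((m - 1) * (1 - a)) = ln (m - 1) + ln (1 - a)"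
          using False m a' by (intro ln_mult_pos) auto
        ultimately show ?thesis using False by simp
      qed
      moreover have "ln ((1 + a) / (1 - a)) = ln (1 + a) - ln (1 - a)"
        using ab a0 b by (simp add: ln_div)
      ultimately show ?thesis
        by (simp add: n1 balance_def True artanh_def F_def field_simps)
    qed
    ultimately show ?thesis using b by simp
  next
    case False
    define q where "q = sqrt (discr e m)"
    have q: "0 < q" "q\<^sup>2 = discr e m" using S by (auto simp: q_def)
    \<comment> \<open>Completing the square: (e^2 + m) * Q s = q^2 - (v s)^2, so 1 / Q integrates to
      an artanh of v / q.\<close>
    define v where "v s = (e + m / e) * s - m" for s
    define Q where "Q s = 1 - s\<^sup>2 - m * (1 - s / e)\<^sup>2" for s
    have Q_pos: "0 < Q s" if "s \<in> {a..b}" for s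
      unfolding Q_def using that False by (intro quadratic_pos[OF e m S]) (auto simp: a_def b_def)
    have vQ: "q\<^sup>2 - (v s)\<^sup>2 = Q s * (e\<^sup>2 + m)" for s
    proof -
      have "(e * q)\<^sup>2 - (e * v s)\<^sup>2 = (e\<^sup>2 * Q s) * (e\<^sup>2 + m)"
      proof -
        have "e * v s = (e\<^sup>2 + m) * s - e * m" using e by (simp add: v_def field_simps power2_eq_square)
        moreover have "e\<^sup>2 * Q s = e\<^sup>2 - e\<^sup>2 * s\<^sup>2 - m * (e - s)\<^sup>2"
          using e by (simp add: Q_def field_simps power2_eq_square)
        moreover have "(e * q)\<^sup>2 = e\<^sup>2 * discr e m" using q by (simp add: power_mult_distrib)
        ultimately show ?thesis unfolding discr_def by algebra
      qed
      then have "e\<^sup>2 * (q\<^sup>2 - (v s)\<^sup>2) = e\<^sup>2 * (Q s * (e\<^sup>2 + m))"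
        by (simp add: power_mult_distrib algebra_simps)
      then show ?thesis using e by simp
    qed
    have em: "0 < e\<^sup>2 + m" using e m by (simp add: add_pos_pos)
    have vq: "\<bar>v s / q\<bar> < 1" if "s \<in> {a..b}" for s
    proof -
      have "0 < Q s * (e\<^sup>2 + m)" using Q_pos[OF that] em by simp
      then have "(v s)\<^sup>2 < q\<^sup>2" using vQ[of s] by linarith
      then have "\<bar>v s\<bar> < q" using q power2_less_imp_less[of "\<bar>v s\<bar>" q] by simp
      then show ?thesis using q by (simp add: abs_divide)
    qed
    define F where "F s = e / q * artanh (v s / q) - artanh s" for s
    have "(F has_vector_derivative 1 / Q s - 1 / (1 - s\<^sup>2)) (at s within {a..b})" if "s \<in> {a..b}" for s
    proof -
      have s1: "\<bar>s\<bar> < 1" using that a0 b1 False by auto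
      have "((\<lambda>s. artanh (v s / q)) has_real_derivative 1 / (1 - (v s / q)\<^sup>2) * ((e + m / e) / q)) (at s within {a..b})"
        by (rule DERIV_chain'[where f = "\<lambda>s. v s / q"], unfold v_def, rule DERIV_cdivide)
          (use vq[OF that] in \<open>auto intro!: derivative_eq_intros simp: v_def\<close>)
      then have "(F has_real_derivative e / q * (1 / (1 - (v s / q)\<^sup>2) * ((e + m / e) / q)) - 1 / (1 - s\<^sup>2)) (at s within {a..b})"
        unfolding F_def using s1 by (intro DERIV_diff DERIV_cmult artanh_real_has_field_derivative) auto
      moreover have "e / q * (1 / (1 - (v s / q)\<^sup>2) * ((e + m / e) / q)) = 1 / Q s"
      proof -
        have "1 - (v s / q)\<^sup>2 = (q\<^sup>2 - (v s)\<^sup>2) / q\<^sup>2" using q S by (simp add: diff_divide_distrib power_divide)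
        also have "\<dots> = Q s * (e\<^sup>2 + m) / q\<^sup>2" by (simp add: vQ)
        finally have 1: "1 - (v s / q)\<^sup>2 = Q s * (e\<^sup>2 + m) / q\<^sup>2" .
        have 2: "e * (e + m / e) = e\<^sup>2 + m" using e by (simp add: field_simps power2_eq_square)
        have "e / q * (1 / (1 - (v s / q)\<^sup>2) * ((e + m / e) / q)) = (e * (e + m / e)) / (q\<^sup>2 * (1 - (v s / q)\<^sup>2))"
          by (simp add: power2_eq_square)
        also have "\<dots> = 1 / Q s"
          unfolding 1 2 using q em S by simp
        finally show ?thesis .
      qed
      ultimately show ?thesis
        by (simp add: has_real_derivative_iff_has_vector_derivative)
    qed
    then have "((\<lambda>s. 1 / Q s - 1 / (1 - s\<^sup>2)) has_integral (F b - F a)) {a..b}"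
      using ab by (intro fundamental_theorem_of_calculus) auto
    moreover have "F b - F a = balance e m + artanh a"
    proof -
      define A where "A = (if e < 1 then e\<^sup>2 else discr e m / e\<^sup>2)"
      define B where "B = (if m < 1 then m else discr e m / m)"
      have vb: "v b = A"
      proof (cases "e < 1")
        case True
        then have "1 < 1 / e" using e by simp
        then have "b = e" using True by (simp add: b_def)
        then show ?thesis using True e by (simp add: v_def A_def field_simps power2_eq_square)
      next
        case 1: False
        then have "1 / e \<le> e" using mult_mono[of 1 e 1 e] by (simp add: field_simps)
        then have "b = 1 / e" by (simp add: b_def)
        moreover have "v (1 / e) = discr e m / e\<^sup>2"
          using e by (simp add: v_def discr_def field_simps power2_eq_square)
        ultimately show ?thesis using 1 by (simp add: A_def)
      qed
      have va: "v a = - B"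
      proof (cases "m < 1")
        case True
        then have "a = 0" using m e by (simp add: a_def max_def field_simps)
        then show ?thesis using True by (simp add: v_def B_def)
      next
        case 1: False
        then have "a = e * (1 - 1 / m)" using m e by (simp add: a_def max_def field_simps)
        moreover have "v (e * (1 - 1 / m)) = - (discr e m / m)"
          using e m by (simp add: v_def discr_def field_simps power2_eq_square)
        ultimately show ?thesis using 1 by (simp add: B_def)
      qed
      have "artanh (v b / q) + artanh (B / q) = edge_term (discr e m) * q"
        unfolding q_def vb
        by (rule edge_term_as_sum[OF e False m S A_def B_def])
          (use vq[of a] vq[of b] ab va vb in \<open>auto simp: q_def\<close>)
      moreover have "artanh (v a / q) = - artanh (B / q)"
        using vq[of a] ab unfolding va by (simp add: artanh_minus_real)
      ultimately have "e / q * artanh (v b / q) - e / q * artanh (v a / q) = e / q * (edge_term (discr e m) * q)"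
        by (metis diff_minus_eq_add distrib_left minus_mult_right)
      then show ?thesis
        using q False by (simp add: F_def balance_def b_def)
    qed
    ultimately show ?thesis by (simp add: Q_def)
  qed
qed

context orthoscheme
begin

section \<open>Closed form of the gain below, between and beyond the thresholds\<close>

lemma M_minus_1: "M h - 1 = k\<^sup>2 * (h\<^sup>2 - 1)"
  using pk unfolding M_def by algebra

lemma M_less_1_iff: "0 < h \<Longrightarrow> M h < 1 \<longleftrightarrow> h < 1"
proof -
  assume h: "0 < h"
  have "M h < 1 \<longleftrightarrow> k\<^sup>2 * (h\<^sup>2 - 1) < 0" using M_minus_1[of h] by auto
  also have "\<dots> \<longleftrightarrow> h\<^sup>2 < 1" using k_pos by (simp add: mult_less_0_iff)
  also have "\<dots> \<longleftrightarrow> h < 1" using h by (simp add: abs_square_less_1)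
  finally show ?thesis .
qed

lemma M_greater_1: "1 < h \<Longrightarrow> 1 < M h"
  using M_minus_1[of h] k_pos by (smt (verit) mult_pos_pos one_less_power pos2 zero_less_power)

definition weight :: "real \<Rightarrow> real" where
  "weight h = k * p / (2 * M h)"

text \<open>On the common edge of the slanted and the polar face Y = 1 / M h, so 1 - s^2 - M h * Y^2
  = (omega h)^2 - s^2. Thus the line carrying that edge meets the sphere at s = omega h.\<close>

definition omega :: "real \<Rightarrow> real" where
  "omega h = sqrt (1 - 1 / M h)"

lemma weight_pos: "0 < weight h"
  using k_pos p_pos M_pos[of h] by (simp add: weight_def)

lemma omega_props:
  assumes "1 < h"
  shows "0 < omega h" "omega h < 1" "(omega h)\<^sup>2 = 1 - 1 / M h"
  using M_greater_1[OF assms] by (auto simp: omega_def)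

lemma discr_omega: 
  assumes "1 < h"
  shows "1 - (e * omega h)\<^sup>2 = discr e (M h) / M h"
  unfolding power_mult_distrib omega_props(3)[OF assms] discr_def
  using M_greater_1[OF assms] by (simp add: field_simps)

lemma fan_density_eq:
  assumes "0 < s" "s < e" "e * s < 1"
  shows "fan_density h s =
    weight h * (1 / (1 - s\<^sup>2 - M h * (fan_height h s)\<^sup>2) - 1 / (1 - s\<^sup>2))"
proof -
  have pos: "0 < 1 - s\<^sup>2 - M h * (fan_height h s)\<^sup>2" "0 < 1 - s\<^sup>2"
    using fan_height_bounds(2)[OF assms] fan_height_bounds(3)[OF assms, of h] assms by (auto simp: power_less_one_iff)
  have "1 / (A - m * Y) - 1 / A = m * Y / (A * (A - m * Y))" if "0 < A - m * Y" "0 < A" for A m Y :: real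
    using that by (simp add: field_simps)
  from this[OF pos] show ?thesis
    using assms M_pos[of h] by (simp add: fan_density_def weight_def)
qed

lemma integral_slanted:
  assumes h: "0 < h" "h \<noteq> 1" and S: "0 < discr e (M h)"
  defines "a \<equiv> max 0 (e * (1 - 1 / M h))" and "b \<equiv> min e (1 / e)"
  shows "(\<integral>\<^sup>+s. ennreal (weight h * (1 / (1 - s\<^sup>2 - M h * (1 - s / e)\<^sup>2) - 1 / (1 - s\<^sup>2))) * indicator {a..b} s \<partial>lborel) =
      ennreal (weight h * (balance e (M h) + artanh a))" (is ?A)
    and "0 \<le> weight h * (balance e (M h) + artanh a)" (is ?B)
proof -
  have m: "0 < M h" "M h \<noteq> 1" using M_pos M_less_1_iff[of h] M_greater_1[of h] h by force+
  have i: "((\<lambda>s. weight h * (1 / (1 - s\<^sup>2 - M h * (1 - s / e)\<^sup>2) - 1 / (1 - s\<^sup>2))) has_integral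
      weight h * (balance e (M h) + artanh a)) {a..b}"
    unfolding a_def b_def by (intro has_integral_mult_right balance_has_integral e_pos m S)
  have n: "0 \<le> weight h * (1 / (1 - s\<^sup>2 - M h * (1 - s / e)\<^sup>2) - 1 / (1 - s\<^sup>2))" if "s \<in> {a..b}" for s
  \<comment> \<open>Here both denominators are 0, so both quotients are 0 by convention.\<close>
  proof (cases "e = 1 \<and> s = 1")
    case True
    then show ?thesis by simp
  next
    case False
    have "0 < 1 - s\<^sup>2 - M h * (1 - s / e)\<^sup>2"
      using that False by (intro quadratic_pos[OF e_pos m S]) (auto simp: a_def b_def)
    moreover have "1 - s\<^sup>2 - M h * (1 - s / e)\<^sup>2 \<le> 1 - s\<^sup>2"
      using m by simp
    ultimately have "1 / (1 - s\<^sup>2) \<le> 1 / (1 - s\<^sup>2 - M h * (1 - s / e)\<^sup>2)"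
      by (intro divide_left_mono mult_pos_pos) auto
    then show ?thesis using weight_pos[of h] by simp
  qed
  show ?A ?B by (rule nn_integral_interval[OF i n]; assumption)+
qed

lemma fan_density_zero: "\<not> (0 < s \<and> s < e \<and> e * s < 1) \<Longrightarrow> fan_density h s = 0"
  unfolding fan_density_def by (rule if_not_P)

lemma in_range_iff: "s < e \<and> e * s < 1 \<longleftrightarrow> s < min e (1 / e)"
  using e_pos by (auto simp: field_simps)

text \<open>For h < 1 the bound 1 / M h exceeds 1, so the polar plane of P3 never limits the
  fan.\<close>

lemma gain_low:
  assumes "0 < h" "h < 1"
  shows "gain h = ennreal (weight h * balance e (M h))"
proof -
  have m: "0 < M h" "M h < 1" using M_pos M_less_1_iff assms by auto
  have S: "0 < discr e (M h)"
  proof -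
    have "discr e (M h) = M h + e\<^sup>2 * (1 - M h)" by (simp add: discr_def algebra_simps)
    then show ?thesis using m by (simp add: add_pos_nonneg)
  qed
  have "1 - 1 / M h \<le> 0" using m by simp
  then have a: "max 0 (e * (1 - 1 / M h)) = 0"
    using mult_nonneg_nonpos[of e "1 - 1 / M h"] e_pos by (simp only: max_absorb1 less_imp_le)
  have "AE s in lborel. ennreal (fan_density h s) =
      ennreal (weight h * (1 / (1 - s\<^sup>2 - M h * (1 - s / e)\<^sup>2) - 1 / (1 - s\<^sup>2))) * indicator {0..min e (1 / e)} s"
    using AE_lborel_singleton[of "0::real"] AE_lborel_singleton[of "min e (1 / e)"]
  proof eventually_elim
    case (elim s)
    show ?case
    proof (cases "0 < s \<and> s < e \<and> e * s < 1")
      case True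
      have "1 - s / e < 1 / M h"
      proof -
        have "1 - s / e < 1" using True e_pos by simp
        also have "1 < 1 / M h" using m by simp
        finally show ?thesis .
      qed
      then have "fan_height h s = 1 - s / e" by (simp add: fan_height_def)
      then show ?thesis using True in_range_iff[of s] by (simp add: fan_density_eq)
    next
      case False
      then have "s \<notin> {0..min e (1 / e)}" using in_range_iff[of s] elim by force
      then show ?thesis by (simp add: fan_density_zero[OF False])
    qed
  qed
  then show ?thesis
    unfolding gain_def using integral_slanted(1)[of h] assms S
    by (subst nn_integral_cong_AE) (auto simp: a)
qed

lemma integral_level:
  assumes h: "1 < h" and b: "0 \<le> b" "b < omega h"
  shows "(\<integral>\<^sup>+s. ennreal (weight h * (1 / ((omega h)\<^sup>2 - s\<^sup>2) - 1 / (1 - s\<^sup>2))) * indicator {0..b} s \<partial>lborel) =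
      ennreal (weight h * (artanh (b / omega h) / omega h - artanh b))" (is ?A)
    and "0 \<le> weight h * (artanh (b / omega h) / omega h - artanh b)" (is ?B)
    and "(\<integral>\<^sup>+s. ennreal (weight h / ((omega h)\<^sup>2 - s\<^sup>2)) * indicator {0..b} s \<partial>lborel) =
      ennreal (weight h * (artanh (b / omega h) / omega h))" (is ?C)
proof -
  note w = omega_props[OF h]
  have i1: "((\<lambda>s. 1 / ((omega h)\<^sup>2 - s\<^sup>2)) has_integral artanh (b / omega h) / omega h) {0..b}"
    using w b by (intro artanh_has_integral)
  have i2: "((\<lambda>s. 1 / (1\<^sup>2 - s\<^sup>2)) has_integral artanh (b / 1) / 1) {0..b}"
    using w b by (intro artanh_has_integral) auto
  have i: "((\<lambda>s. weight h * (1 / ((omega h)\<^sup>2 - s\<^sup>2) - 1 / (1 - s\<^sup>2))) has_integral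
      weight h * (artanh (b / omega h) / omega h - artanh b)) {0..b}"
    using has_integral_mult_right[OF has_integral_diff[OF i1 i2], of "weight h"] by simp
  have i': "((\<lambda>s. weight h / ((omega h)\<^sup>2 - s\<^sup>2)) has_integral
      weight h * (artanh (b / omega h) / omega h)) {0..b}"
    using has_integral_mult_right[OF i1, of "weight h"] by simp
  have pos: "0 < (omega h)\<^sup>2 - s\<^sup>2" "(omega h)\<^sup>2 < 1" if "s \<in> {0..b}" for s
    using that b w power_strict_mono[of s "omega h" 2] M_greater_1[OF h] by (auto simp: power_less_one_iff)
  have n: "0 \<le> weight h * (1 / ((omega h)\<^sup>2 - s\<^sup>2) - 1 / (1 - s\<^sup>2))" if "s \<in> {0..b}" for s
  proof -
    have "1 / (1 - s\<^sup>2) \<le> 1 / ((omega h)\<^sup>2 - s\<^sup>2)"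
      using pos[OF that] by (intro divide_left_mono mult_pos_pos) auto
    then show ?thesis using weight_pos[of h] by simp
  qed
  have n': "0 \<le> weight h / ((omega h)\<^sup>2 - s\<^sup>2)" if "s \<in> {0..b}" for s
    using pos[OF that] weight_pos[of h] by simp
  show ?A ?B by (rule nn_integral_interval[OF i n]; assumption)+
  show ?C by (rule nn_integral_interval(1)[OF i' n'])
qed

lemma fan_density_level:
  assumes "1 < h" "0 < s" "s < e" "e * s < 1" "s \<le> e * (1 - 1 / M h)"
  shows "fan_density h s = weight h * (1 / ((omega h)\<^sup>2 - s\<^sup>2) - 1 / (1 - s\<^sup>2))"
proof -
  have "e * (1 / M h) \<le> e * (1 - s / e)"
    using assms e_pos by (simp add: algebra_simps)
  then have "1 / M h \<le> 1 - s / e" using e_pos by (simp only: mult_le_cancel_left_pos)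
  then have f: "fan_height h s = 1 / M h" by (simp add: fan_height_def)
  have "M h * (fan_height h s)\<^sup>2 = 1 / M h"
    unfolding f using M_pos[of h] by (simp add: power2_eq_square)
  then have "1 - s\<^sup>2 - M h * (fan_height h s)\<^sup>2 = (omega h)\<^sup>2 - s\<^sup>2"
    using omega_props[OF assms(1)] by simp
  then show ?thesis using assms by (simp add: fan_density_eq)
qed

lemma level_end_eq: "1 < h \<Longrightarrow> e * (1 - 1 / M h) = e * omega h * omega h"
  using omega_props[of h] by (simp add: power2_eq_square)

text \<open>By \<open>discr_omega\<close> the sign of the discriminant decides whether e * omega h <
  1. The fan leaves the common edge at s = e * (omega h)^2, here before P0, before the polar plane
  of P0 and before the sphere.\<close>

lemma e_omega_less_1:
  assumes "1 < h" "0 < discr e (M h)"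
  shows "e * omega h < 1" "0 < e * omega h" "e * (1 - 1 / M h) < min e (1 / e)" "e * (1 - 1 / M h) < omega h"
    "0 < e * (1 - 1 / M h)"
proof -
  note w = omega_props[OF assms(1)]
  have "0 < 1 - (e * omega h)\<^sup>2"
    unfolding discr_omega[OF assms(1)] using assms M_pos[of h] by simp
  then show u: "e * omega h < 1" using w e_pos by (simp add: abs_square_less_1)
  show "0 < e * omega h" using w e_pos by simp
  have 1: "e * (1 - 1 / M h) = e * omega h * omega h" by (rule level_end_eq[OF assms(1)])
  show 2: "e * (1 - 1 / M h) < omega h"
    unfolding 1 using u w by simp
  have "omega h < 1 / e" using u e_pos by (simp add: field_simps)
  moreover have "e * (1 - 1 / M h) < e" using e_pos M_pos[of h] by simp
  ultimately show "e * (1 - 1 / M h) < min e (1 / e)" using 2 by simp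
  show "0 < e * (1 - 1 / M h)" unfolding 1 using w e_pos by simp
qed

text \<open>Up to \<open>x1\<close> the fan ends on the common edge with the polar face, from there
  on the plane through P0, P2, P3. The two occurrences of \<open>artanh x1\<close> cancel, and the
  other artanh term is exactly the loss of \<open>loss_mid\<close>.\<close>

lemma gain_mid:
  assumes h: "1 < h" and S: "0 < discr e (M h)"
  shows "gain h = ennreal (weight h * (artanh (e * omega h) / omega h + balance e (M h)))"
proof -
  define x1 where "x1 = e * (1 - 1 / M h)"
  define xm where "xm = min e (1 / e)"
  define f1 where "f1 s = weight h * (1 / ((omega h)\<^sup>2 - s\<^sup>2) - 1 / (1 - s\<^sup>2))" for s
  define f2 where "f2 s = weight h * (1 / (1 - s\<^sup>2 - M h * (1 - s / e)\<^sup>2) - 1 / (1 - s\<^sup>2))" for s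
  have x: "x1 < xm" "x1 < omega h" "0 < x1"
    using e_omega_less_1[OF assms] by (auto simp: x1_def xm_def)
  have a: "max 0 (e * (1 - 1 / M h)) = x1" using x by (simp add: x1_def)
  have "AE s in lborel. ennreal (fan_density h s) =
      ennreal (f1 s) * indicator {0..x1} s + ennreal (f2 s) * indicator {x1..xm} s"
    using AE_lborel_singleton[of "0::real"] AE_lborel_singleton[of x1] AE_lborel_singleton[of xm]
  proof eventually_elim
    case (elim s)
    show ?case
    proof (cases "0 < s \<and> s < e \<and> e * s < 1")
      case True
      then have sm: "s < xm" using in_range_iff[of s] by (simp add: xm_def)
      show ?thesis
      proof (cases "s < x1")
        case less: True
        then have "fan_density h s = f1 s"
          unfolding f1_def using True h by (intro fan_density_level) (auto simp: x1_def)
        then show ?thesis using less True by simp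
      next
        case False
        have "e * (1 - s / e) \<le> e * (1 / M h)"
          using False e_pos by (simp add: x1_def algebra_simps)
        then have "1 - s / e \<le> 1 / M h" using e_pos by (simp only: mult_le_cancel_left_pos)
        then have "fan_height h s = 1 - s / e" by (simp add: fan_height_def)
        then have "fan_density h s = f2 s" using True by (simp add: fan_density_eq f2_def)
        then show ?thesis using False elim sm by simp
      qed
    next
      case False
      then have "s < 0 \<or> xm < s" using in_range_iff[of s] elim by (auto simp: xm_def)
      then have "s \<notin> {0..x1}" "s \<notin> {x1..xm}" using x by auto
      then show ?thesis by (simp add: fan_density_zero[OF False])
    qed
  qed
  then have "gain h = (\<integral>\<^sup>+s. ennreal (f1 s) * indicator {0..x1} s + ennreal (f2 s) * indicator {x1..xm} s \<partial>lborel)"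
    unfolding gain_def by (rule nn_integral_cong_AE)
  also have "\<dots> = (\<integral>\<^sup>+s. ennreal (f1 s) * indicator {0..x1} s \<partial>lborel) + (\<integral>\<^sup>+s. ennreal (f2 s) * indicator {x1..xm} s \<partial>lborel)"
    by (rule nn_integral_add) (auto simp: f1_def f2_def)
  also have "\<dots> = ennreal (weight h * (artanh (x1 / omega h) / omega h - artanh x1)) +
      ennreal (weight h * (balance e (M h) + artanh x1))"
    using integral_level(1)[OF h, of x1] integral_slanted(1)[of h] x a h S
    by (simp add: f1_def f2_def xm_def)
  also have "\<dots> = ennreal (weight h * (artanh (x1 / omega h) / omega h - artanh x1) + weight h * (balance e (M h) + artanh x1))"
    using integral_level(2)[OF h, of x1] integral_slanted(2)[of h] x a h S
    by (intro ennreal_plus [symmetric]) auto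
  also have "x1 / omega h = e * omega h"
    using omega_props[OF h] by (simp add: x1_def level_end_eq[OF h])
  finally show ?thesis by (simp only: distrib_left right_diff_distrib) simp
qed

text \<open>Now the polar plane of P0, at s = 1/e, cuts the fan while it still ends on the common
  edge with the polar face. No part bounded by the plane through P0, P2, P3 is left, since the edge
  P0 P3 has been cut away.\<close>

lemma one_less_e_omega:
  assumes "1 < h" "discr e (M h) < 0"
  shows "1 < e * omega h" "1 / e < omega h" "1 < e" "1 / e \<le> e * (1 - 1 / M h)"
proof -
  note w = omega_props[OF assms(1)]
  have "1 - (e * omega h)\<^sup>2 < 0"
    unfolding discr_omega[OF assms(1)] using assms M_pos[of h] by (simp add: divide_neg_pos)
  then have "1\<^sup>2 < (e * omega h)\<^sup>2" by simp
  moreover have "0 \<le> e * omega h" using w e_pos by simp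
  ultimately show u: "1 < e * omega h" by (rule power2_less_imp_less)
  then show o: "1 / e < omega h" using e_pos by (simp add: field_simps)
  have "e * omega h < e * 1" using w e_pos by (intro mult_strict_left_mono) auto
  then show "1 < e" using u by simp
  have "1 / e \<le> 1 * omega h" using o by simp
  also have "\<dots> \<le> e * omega h * omega h" using u w by (intro mult_right_mono) auto
  finally show "1 / e \<le> e * (1 - 1 / M h)" by (simp add: level_end_eq[OF assms(1)])
qed

lemma gain_high:
  assumes h: "1 < h" and S: "discr e (M h) < 0"
  shows "gain h = ennreal (weight h * (artanh (1 / e / omega h) / omega h - artanh (1 / e)))"
proof -
  note u = one_less_e_omega[OF assms]
  have "1 / e < 1" using u by simp
  then have "1 / e \<le> e" using u by linarith
  then have xm: "min e (1 / e) = 1 / e" by simp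
  have "AE s in lborel. ennreal (fan_density h s) =
      ennreal (weight h * (1 / ((omega h)\<^sup>2 - s\<^sup>2) - 1 / (1 - s\<^sup>2))) * indicator {0..1 / e} s"
    using AE_lborel_singleton[of "0::real"] AE_lborel_singleton[of "1 / e"]
  proof eventually_elim
    case (elim s)
    show ?case
    proof (cases "0 < s \<and> s < e \<and> e * s < 1")
      case True
      then have "s < 1 / e" using in_range_iff[of s] by (simp add: xm)
      then show ?thesis using True u(4) by (simp add: fan_density_level[OF h])
    next
      case False
      then have "s \<notin> {0..1 / e}" using in_range_iff[of s] elim unfolding xm by force
      then show ?thesis by (simp add: fan_density_zero[OF False])
    qed
  qed
  then show ?thesis
    unfolding gain_def using integral_level(1)[OF h, of "1 / e"] u e_pos
    by (subst nn_integral_cong_AE) auto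
qed

section \<open>Closed form of the loss, in the variable used for the gain\<close>

definition slope_scale :: "real \<Rightarrow> real" where
  "slope_scale h = M h * k / (p * (M h - 1))"

lemma slope_scale_pos: "1 < h \<Longrightarrow> 0 < slope_scale h"
  using M_greater_1[of h] p_pos k_pos by (simp add: slope_scale_def)

text \<open>The point of the common edge with coordinate s has slope x / y =
  \<open>slope_scale h * s\<close>: there y = p (1 - 1/h^2) and x = s * M h / (k h^2). With this
  variable gain and loss are integrals along the same edge.\<close>

lemma loss_rescaled:
  assumes h: "1 < h"
  shows "loss h = (\<integral>\<^sup>+s. ennreal (slope_scale h * (slice_density (1 / h) (slope_scale h * s) / h\<^sup>2)) \<partial>lborel)"
proof -
  have "loss h = ennreal \<bar>slope_scale h\<bar> * (\<integral>\<^sup>+s. ennreal (slice_density (1 / h) (0 + slope_scale h * s) / h\<^sup>2) \<partial>lborel)"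
    unfolding loss_def using slope_scale_pos[OF h] by (intro nn_integral_real_affine) auto
  also have "\<dots> = (\<integral>\<^sup>+s. ennreal (slope_scale h) * ennreal (slice_density (1 / h) (slope_scale h * s) / h\<^sup>2) \<partial>lborel)"
    using slope_scale_pos[OF h] by (subst nn_integral_cmult) auto
  finally show ?thesis
    using slope_scale_pos[OF h] slice_density_nonneg by (simp add: ennreal_mult [symmetric])
qed

lemma slope_range_iff:
  assumes "1 < h"
  shows "slope_scale h * s * p < k * e \<longleftrightarrow> s < e * (1 - 1 / M h)"
proof -
  have m: "1 < M h" by (rule M_greater_1[OF assms])
  have "slope_scale h * s * p = k * (M h * s / (M h - 1))"
    using p_pos by (simp add: slope_scale_def)
  then have "slope_scale h * s * p < k * e \<longleftrightarrow> M h * s / (M h - 1) < e"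
    using k_pos by (simp only: mult_less_cancel_left_pos)
  also have "\<dots> \<longleftrightarrow> s < e * (1 - 1 / M h)"
    using m by (simp add: field_simps)
  finally show ?thesis .
qed

text \<open>As e * s \<le> 1, the polar plane of P0 does not shorten the ray, which therefore ends
  on the common edge. Hence the singularity at s = omega h is the one of the gain.\<close>

lemma slice_density_level:
  assumes h: "1 < h" and s: "0 < s" "s < e * (1 - 1 / M h)" "e * s \<le> 1"
  shows "slope_scale h * (slice_density (1 / h) (slope_scale h * s) / h\<^sup>2) = weight h / ((omega h)\<^sup>2 - s\<^sup>2)"
proof -
  define m where "m = M h"
  define t where "t = slope_scale h * s"
  define w where "w = 1 - (1 / h)\<^sup>2"
  have m: "1 < m" unfolding m_def by (rule M_greater_1[OF h])
  have t: "0 < t" "t * p < k * e"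
    using slope_scale_pos[OF h] s slope_range_iff[OF h, of s] by (auto simp: t_def)
  have z: "0 < 1 / h" "1 / h < 1" using h by auto
  note b = slice_radius_bounds[OF z t]
  have hw: "h\<^sup>2 * w = h\<^sup>2 - 1" using h by (simp add: w_def field_simps)
  have mw: "m - 1 = k\<^sup>2 * (h\<^sup>2 * w)" unfolding m_def hw by (rule M_minus_1)
  have mp: "m = h\<^sup>2 - p\<^sup>2 * (h\<^sup>2 * w)" unfolding hw m_def M_def using pk by algebra
  have tm: "t * (p * (m - 1)) = m * k * s"
    using m p_pos by (simp add: t_def slope_scale_def m_def)
  then have tw: "t * p * k * (h\<^sup>2 * w) = m * s"
    unfolding mw using k_pos by (simp add: power2_eq_square)
  have d: "0 < k * e * t + p" using t p_pos k_pos e_pos by (simp add: add_pos_pos)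
  have "h\<^sup>2 * (p * w * (k * e * t + p)) = e * (t * p * k * (h\<^sup>2 * w)) + p\<^sup>2 * (h\<^sup>2 * w)"
    by (simp add: algebra_simps power2_eq_square)
  also have "\<dots> = (e * s) * m + (h\<^sup>2 - m)" unfolding tw using mp by simp
  also have "\<dots> \<le> 1 * m + (h\<^sup>2 - m)" using s m by (intro add_right_mono mult_right_mono) auto
  finally have "h\<^sup>2 * (p * w * (k * e * t + p)) \<le> h\<^sup>2 * 1" by simp
  then have "p * w * (k * e * t + p) \<le> 1" using h by (simp only: mult_le_cancel_left_pos zero_less_power)
  then have r: "slice_radius (1 / h) t = p * w"
    using d by (simp add: slice_radius_def w_def pos_le_divide_eq)
  have wpos: "0 < w" using b by (simp add: w_def)
  have Z: "0 < w - (1 + t\<^sup>2) * (p * w)\<^sup>2" using b unfolding r w_def by simp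
  have sd: "slice_density (1 / h) t = (p * w)\<^sup>2 / (2 * w * (w - (1 + t\<^sup>2) * (p * w)\<^sup>2))"
    unfolding slice_density_def r using z t by (simp add: w_def)
  have o: "(omega h)\<^sup>2 = (m - 1) / m" using omega_props[OF h] m by (simp add: m_def field_simps)
  have e1: "h\<^sup>2 * (w - (1 + t\<^sup>2) * (p * w)\<^sup>2) = w * (m - t\<^sup>2 * p\<^sup>2 * (h\<^sup>2 * w))"
    by (subst mp) (simp add: algebra_simps power2_eq_square)
  \<comment> \<open>Since m - 1 = k^2 h^2 w, the subtracted term becomes the square of t p k h^2 w =
    m s.\<close>
  have e2: "(m - t\<^sup>2 * p\<^sup>2 * (h\<^sup>2 * w)) * (m - 1) = m\<^sup>2 * ((omega h)\<^sup>2 - s\<^sup>2)"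
  proof -
    have "(m - t\<^sup>2 * p\<^sup>2 * (h\<^sup>2 * w)) * (m - 1) = m * (m - 1) - (t * p * k * (h\<^sup>2 * w))\<^sup>2"
    proof -
      have "t\<^sup>2 * p\<^sup>2 * (h\<^sup>2 * w) * (m - 1) = (t * p * k * (h\<^sup>2 * w))\<^sup>2"
        unfolding mw by (simp add: power2_eq_square)
      then show ?thesis by (simp only: left_diff_distrib)
    qed
    also have "\<dots> = m\<^sup>2 * ((omega h)\<^sup>2 - s\<^sup>2)"
      unfolding tw o using m by (simp add: field_simps power2_eq_square)
    finally show ?thesis .
  qed
  have P: "0 < m - t\<^sup>2 * p\<^sup>2 * (h\<^sup>2 * w)"
  proof -
    have "0 < w * (m - t\<^sup>2 * p\<^sup>2 * (h\<^sup>2 * w))" unfolding e1 [symmetric] using Z h by simp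
    then show ?thesis using wpos by (simp add: zero_less_mult_iff)
  qed
  have "slope_scale h * (slice_density (1 / h) t / h\<^sup>2) =
      slope_scale h * ((p * w)\<^sup>2 / (2 * w * (h\<^sup>2 * (w - (1 + t\<^sup>2) * (p * w)\<^sup>2))))"
    unfolding sd by simp
  also have "\<dots> = slope_scale h * (p\<^sup>2 / (2 * (m - t\<^sup>2 * p\<^sup>2 * (h\<^sup>2 * w))))"
    unfolding e1 using wpos by (simp add: power2_eq_square)
  also have "\<dots> = m * k * p / (2 * ((m - t\<^sup>2 * p\<^sup>2 * (h\<^sup>2 * w)) * (m - 1)))"
  proof -
    have "m * k / (p * n) * (p\<^sup>2 / (2 * D)) = m * k * p / (2 * (D * n))" for D n
      using p_pos by (simp add: power2_eq_square mult_ac)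
    then show ?thesis by (simp only: slope_scale_def m_def)
  qed
  also have "\<dots> = m * k * p / (2 * (m\<^sup>2 * ((omega h)\<^sup>2 - s\<^sup>2)))"
    by (simp only: e2)
  also have "\<dots> = weight h / ((omega h)\<^sup>2 - s\<^sup>2)"
    using m by (simp add: weight_def m_def [symmetric] power2_eq_square)
  finally show ?thesis by (simp add: t_def)
qed

lemma loss_mid:
  assumes h: "1 < h" and S: "0 < discr e (M h)"
  shows "loss h = ennreal (weight h * (artanh (e * omega h) / omega h))"
proof -
  define x1 where "x1 = e * (1 - 1 / M h)"
  note x = e_omega_less_1[OF assms, folded x1_def]
  have "AE s in lborel. ennreal (slope_scale h * (slice_density (1 / h) (slope_scale h * s) / h\<^sup>2)) =
      ennreal (weight h / ((omega h)\<^sup>2 - s\<^sup>2)) * indicator {0..x1} s"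
    using AE_lborel_singleton[of "0::real"] AE_lborel_singleton[of x1]
  proof eventually_elim
    case (elim s)
    show ?case
    proof (cases "0 < s \<and> s < x1")
      case True
      then have "s < 1 / e" using x by simp
      then have "e * s \<le> 1" using e_pos by (simp add: field_simps)
      then show ?thesis using True slice_density_level[OF h, of s] by (simp add: x1_def)
    next
      case False
      then have "\<not> (0 < slope_scale h * s \<and> slope_scale h * s * p < k * e)"
        using slope_range_iff[OF h, of s] slope_scale_pos[OF h] by (simp add: x1_def zero_less_mult_iff)
      then have "slice_density (1 / h) (slope_scale h * s) = 0"
        unfolding slice_density_def by (intro if_not_P) blast
      moreover have "s \<notin> {0..x1}" using False elim by auto
      ultimately show ?thesis by simp
    qed
  qed
  then have "loss h = (\<integral>\<^sup>+s. ennreal (weight h / ((omega h)\<^sup>2 - s\<^sup>2)) * indicator {0..x1} s \<partial>lborel)"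
    unfolding loss_rescaled[OF h] by (rule nn_integral_cong_AE)
  also have "\<dots> = ennreal (weight h * (artanh (x1 / omega h) / omega h))"
    using x by (intro integral_level(3)[OF h]) auto
  also have "x1 / omega h = e * omega h"
    using omega_props[OF h] by (simp add: x1_def level_end_eq[OF h])
  finally show ?thesis .
qed

text \<open>The rays beyond s = 1/e, which are shortened by the polar plane of P0, are dropped. The
  remaining part already exceeds the gain of \<open>gain_high\<close> by weight h * artanh
  (1/e).\<close>

lemma loss_high:
  assumes h: "1 < h" and S: "discr e (M h) < 0"
  shows "ennreal (weight h * (artanh (1 / e / omega h) / omega h)) \<le> loss h"
proof -
  note u = one_less_e_omega[OF assms]
  have "AE s in lborel. ennreal (weight h / ((omega h)\<^sup>2 - s\<^sup>2)) * indicator {0..1 / e} s \<le>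
      ennreal (slope_scale h * (slice_density (1 / h) (slope_scale h * s) / h\<^sup>2))"
    using AE_lborel_singleton[of "0::real"] AE_lborel_singleton[of "1 / e"]
  proof eventually_elim
    case (elim s)
    show ?case
    proof (cases "s \<in> {0..1 / e}")
      case True
      then have "0 < s" "s < 1 / e" using elim by auto
      moreover have "e * s \<le> 1" using True e_pos by (simp add: field_simps)
      ultimately show ?thesis using True u slice_density_level[OF h, of s] by simp
    qed simp
  qed
  then have "(\<integral>\<^sup>+s. ennreal (weight h / ((omega h)\<^sup>2 - s\<^sup>2)) * indicator {0..1 / e} s \<partial>lborel) \<le> loss h"
    unfolding loss_rescaled[OF h] by (rule nn_integral_mono_AE)
  then show ?thesis
    using integral_level(3)[OF h, of "1 / e"] u e_pos by simp
qed

lemma loss_low: "0 < h \<Longrightarrow> h \<le> 1 \<Longrightarrow> loss h = 0"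
  by (simp add: loss_def slice_density_def)

end

section \<open>Monotonicity of the balance\<close>

lemma artanh_strict_mono:
  fixes x y :: real
  assumes "- 1 < x" "x < y" "y < 1"
  shows "artanh x < artanh y"
proof -
  have "(1 + x) / (1 - x) < (1 + y) / (1 - y)"
    using assms by (simp add: frac_less)
  moreover have "0 < (1 + x) / (1 - x)" using assms by simp
  ultimately show ?thesis by (simp add: artanh_def)
qed

lemma artanh_pos: "0 < x \<Longrightarrow> x < 1 \<Longrightarrow> 0 < artanh (x::real)"
  using artanh_strict_mono[of 0 x] by simp

text \<open>With y = tanh l this is l \<le> sinh l. It serves both the monotonicity and the
  integrability arguments.\<close>

lemma artanh_le:
  fixes y :: real
  assumes "0 \<le> y" "y < 1"
  shows "artanh y \<le> y / sqrt (1 - y\<^sup>2)"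
proof -
  define f where "f x = x / sqrt (1 - x\<^sup>2) - artanh x" for x :: real
  have "\<exists>d. (f has_real_derivative d) (at x) \<and> 0 \<le> d" if "0 \<le> x" "x \<le> y" for x
  proof -
    define v where "v = 1 - x\<^sup>2"
    have x: "\<bar>x\<bar> < 1" "0 < v" "v \<le> 1" using that assms by (auto simp: v_def power_less_one_iff)
    have s: "0 < sqrt v" "sqrt v \<le> 1" "sqrt v * sqrt v = v" using x by auto
    have d1: "((\<lambda>x. sqrt (1 - x\<^sup>2)) has_real_derivative (- x / sqrt v)) (at x)"
      using x unfolding v_def by (auto intro!: derivative_eq_intros simp: field_simps)
    have "(f has_real_derivative (1 * sqrt (1 - x\<^sup>2) - x * (- x / sqrt v)) / (sqrt (1 - x\<^sup>2) * sqrt (1 - x\<^sup>2)) - 1 / (1 - x\<^sup>2)) (at x)"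
      unfolding f_def using x s
      by (intro DERIV_diff DERIV_divide DERIV_ident d1 artanh_real_has_field_derivative) (auto simp: v_def)
    also have "(1 * sqrt (1 - x\<^sup>2) - x * (- x / sqrt v)) / (sqrt (1 - x\<^sup>2) * sqrt (1 - x\<^sup>2)) - 1 / (1 - x\<^sup>2) =
        (1 / sqrt v - 1) / v"
    proof -
      have "1 * sqrt v - x * (- x / sqrt v) = (sqrt v * sqrt v + x\<^sup>2) / sqrt v"
        using s(1) by (simp add: add_divide_distrib power2_eq_square del: real_sqrt_mult_self)
      also have "\<dots> = 1 / sqrt v" unfolding s by (simp add: v_def)
      finally show ?thesis
        unfolding v_def [symmetric] s by (simp add: diff_divide_distrib)
    qed
    finally have "(f has_real_derivative (1 / sqrt v - 1) / v) (at x)" .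
    moreover have "1 \<le> 1 / sqrt v" using s(1,2) by (simp only: le_divide_eq_1_pos)
    then have "0 \<le> (1 / sqrt v - 1) / v" using x by (intro divide_nonneg_pos) linarith+
    ultimately show ?thesis by blast
  qed
  then have "f 0 \<le> f y" by (rule DERIV_nonneg_imp_nondecreasing[OF assms(1)])
  then show ?thesis by (simp add: f_def)
qed

text \<open>The derivative has the sign of t / (1 - t^2) - artanh t, and the bound t / sqrt (1 -
  t^2) for artanh t is smaller than t / (1 - t^2).\<close>

lemma artanh_over_strict_mono:
  fixes x y :: real
  assumes "0 < x" "x < y" "y < 1"
  shows "artanh x / x < artanh y / y"
proof (rule DERIV_pos_imp_increasing[OF \<open>x < y\<close>])
  fix t assume t: "x \<le> t" "t \<le> y"
  define v where "v = 1 - t\<^sup>2"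
  have t': "0 < t" "\<bar>t\<bar> < 1" "0 < v" "v < 1" using t assms by (auto simp: v_def power_less_one_iff)
  have s: "0 < sqrt v" "sqrt v < 1" "sqrt v * sqrt v = v" using t' by auto
  have "v < sqrt v" using mult_strict_right_mono[of "sqrt v" 1 "sqrt v"] s by simp
  then have "t / sqrt v < t / v" using t' by (intro divide_strict_left_mono) auto
  then have "artanh t < t / v" using artanh_le[of t] t' by (simp add: v_def)
  moreover have "((\<lambda>t. artanh t / t) has_real_derivative (1 / (1 - t\<^sup>2) * t - artanh t * 1) / (t * t)) (at t)"
    using t' by (intro DERIV_divide artanh_real_has_field_derivative DERIV_ident) auto
  moreover have "0 < (1 / (1 - t\<^sup>2) * t - artanh t * 1) / (t * t)"
    using t' \<open>artanh t < t / v\<close> by (simp add: v_def)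
  ultimately show "\<exists>d. ((\<lambda>t. artanh t / t) has_real_derivative d) (at t) \<and> 0 < d"
    by blast
qed

text \<open>Measures the singularity at S = 1, where the edge becomes infinitely long. It also
  supplies the parameter with negative balance for e < 1.\<close>

lemma edge_term_le:
  assumes "0 < S" "S \<noteq> 1"
  shows "edge_term S \<le> 1 / sqrt \<bar>S - 1\<bar>"
proof (cases "S < 1")
  case True
  have "artanh (sqrt S) / sqrt S \<le> (sqrt S / sqrt (1 - (sqrt S)\<^sup>2)) / sqrt S"
    using artanh_le[of "sqrt S"] True assms by (intro divide_right_mono) auto
  then show ?thesis using True assms by (simp add: edge_term_def)
next
  case False
  then have S: "1 < S" using assms by simp
  have "artanh (1 / sqrt S) \<le> (1 / sqrt S) / sqrt (1 - (1 / sqrt S)\<^sup>2)"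
    using artanh_le[of "1 / sqrt S"] S by simp
  also have "1 - (1 / sqrt S)\<^sup>2 = (S - 1) / S" using S by (simp add: power_divide field_simps)
  also have "(1 / sqrt S) / sqrt ((S - 1) / S) = 1 / sqrt (S - 1)" using S by (simp add: real_sqrt_divide)
  finally have "artanh (1 / sqrt S) / sqrt S \<le> (1 / sqrt (S - 1)) / sqrt S"
    using S by (intro divide_right_mono) auto
  also have "\<dots> \<le> (1 / sqrt (S - 1)) / 1"
    using S by (intro divide_left_mono) auto
  finally show ?thesis using S by (simp add: edge_term_def)
qed

text \<open>The discriminant is affine in m with value 1 at m = 1.\<close>

lemma discr_pos_between:
  assumes "1 < m" "m \<le> m'" "0 < discr e m'"
  shows "0 < discr e m"
proof -
  have "(m' - 1) * discr e m = (m' - m) + (m - 1) * discr e m'"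
    by (simp add: discr_def algebra_simps)
  moreover have "0 < (m - 1) * discr e m'" using assms by simp
  ultimately have "0 < (m' - 1) * discr e m" using assms by linarith
  then show ?thesis using assms by (simp add: zero_less_mult_iff)
qed

lemma discr_ge_1:
  assumes "0 < e" "e \<le> 1" "1 < m"
  shows "1 \<le> discr e m"
proof -
  have "0 \<le> (m - 1) * (1 - e\<^sup>2)" using assms by (simp add: power_le_one)
  then show ?thesis using discr_minus_1[of e m] by simp
qed

text \<open>For e < 1 the discriminant S grows above 1, and both factors of artanh (1 / sqrt S) /
  sqrt S fall. For e > 1 it falls below 1, and artanh x / x increases in x.\<close>

lemma balance_strict_antimono:
  assumes e: "0 < e" and m: "1 < m" "m < m'" and S': "0 < discr e m'"
  shows "balance e m' < balance e m"
proof -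
  have S: "0 < discr e m" using discr_pos_between[of m m' e] m S' by simp
  have d: "discr e m' - discr e m = (m' - m) * (1 - e\<^sup>2)" by (simp add: discr_def algebra_simps)
  consider "e = 1" | "e < 1" | "1 < e" by linarith
  then show ?thesis
  proof cases
    case 1
    then show ?thesis using m by (simp add: balance_def)
  next
    case 2
    then have "e\<^sup>2 < 1" using e by (simp add: power_less_one_iff)
    then have "0 < (m' - m) * (1 - e\<^sup>2)" "0 < (m - 1) * (1 - e\<^sup>2)" using m by auto
    then have SS: "1 < discr e m" "discr e m < discr e m'" using d discr_minus_1[of e m] by linarith+
    have q: "1 / sqrt (discr e m') < 1 / sqrt (discr e m)" "1 / sqrt (discr e m) < 1" "0 < 1 / sqrt (discr e m')"
      using SS by (auto intro!: divide_strict_left_mono)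
    have "artanh (1 / sqrt (discr e m')) * (1 / sqrt (discr e m')) < artanh (1 / sqrt (discr e m)) * (1 / sqrt (discr e m))"
    proof (rule mult_strict_mono)
      show lt: "artanh (1 / sqrt (discr e m')) < artanh (1 / sqrt (discr e m))"
        using q by (intro artanh_strict_mono) linarith+
      show "0 < artanh (1 / sqrt (discr e m))"
        using q by (intro artanh_pos) linarith+
    qed (use q in linarith)+
    then have "edge_term (discr e m') < edge_term (discr e m)"
      using SS by (simp add: edge_term_def)
    then show ?thesis using 2 e by (simp add: balance_def)
  next
    case 3
    then have "1 < e\<^sup>2" by simp
    then have "(m' - m) * (1 - e\<^sup>2) < 0" "(m - 1) * (1 - e\<^sup>2) < 0" using m by (auto simp: mult_less_0_iff)
    then have SS: "discr e m < 1" "discr e m' < discr e m" using d discr_minus_1[of e m] by linarith+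
    have "artanh (sqrt (discr e m')) / sqrt (discr e m') < artanh (sqrt (discr e m)) / sqrt (discr e m)"
      using SS S' by (intro artanh_over_strict_mono) auto
    then have "edge_term (discr e m') < edge_term (discr e m)"
      using SS by (simp add: edge_term_def)
    then show ?thesis using 3 e by (simp add: balance_def)
  qed
qed

text \<open>As h decreases to 1 the edge P0 P3 becomes arbitrarily long; a value of the discriminant
  close enough to 1 is chosen and solved for m.\<close>

lemma balance_pos_somewhere:
  assumes e: "0 < e"
  obtains m where "1 < m" "0 < discr e m" "0 < balance e m"
proof (cases "e = 1")
  case True
  have "ln (1 / 2 :: real) < 0" by simp
  then have "0 < balance e (3 / 2)" using True by (simp add: balance_def)
  then show ?thesis using that[of "3 / 2"] True by (simp add: discr_def)
next
  case False
  define X where "X = artanh (min e (1 / e)) / e"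
  \<comment> \<open>Since artanh y \<ge> 2 |X| + 1 and y \<ge> 1/2, both y * artanh y and artanh y /
    y exceed \<open>X\<close>. They are the edge terms at S = 1 / y^2, used for e < 1, and at S =
    y^2, used for e > 1.\<close>
  define y where "y = max (1 / 2) (tanh (2 * \<bar>X\<bar> + 1))"
  have y: "1 / 2 \<le> y" "y < 1" by (auto simp: y_def tanh_real_lt_1)
  have ay: "2 * \<bar>X\<bar> + 1 \<le> artanh y"
  proof (cases "tanh (2 * \<bar>X\<bar> + 1) < y")
    case True
    then have "artanh (tanh (2 * \<bar>X\<bar> + 1)) < artanh y"
      using y tanh_real_gt_neg1[of "2 * \<bar>X\<bar> + 1"] by (intro artanh_strict_mono) auto
    then show ?thesis by (simp add: artanh_tanh_real)
  next
    case False
    then have "y = tanh (2 * \<bar>X\<bar> + 1)" by (simp add: y_def)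
    then show ?thesis by (simp add: artanh_tanh_real)
  qed
  have ya: "X < artanh y * y"
  proof -
    have "X < (2 * \<bar>X\<bar> + 1) * (1 / 2)" by (simp add: abs_if)
    also have "\<dots> \<le> artanh y * y" using ay y by (intro mult_mono) auto
    finally show ?thesis .
  qed
  have ya': "X < artanh y / y"
  proof -
    have "artanh y * y \<le> artanh y * (1 / y)"
      using y ay mult_mono[of y 1 y 1] by (intro mult_left_mono) (auto simp: field_simps)
    then show ?thesis using ya by simp
  qed
  have key: ?thesis if "S = discr e m" "1 < m" "0 < S" "X < edge_term S" for S m
  proof -
    have "e * X < e * edge_term S" using that e by simp
    then have "0 < balance e m" using that False e by (simp add: balance_def X_def)
    then show ?thesis using \<open>\<And>m. \<lbrakk>1 < m; 0 < discr e m; 0 < balance e m\<rbrakk> \<Longrightarrow> thesis\<close> that by blast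
  qed
  have inv: "discr e (1 + (S - 1) / (1 - e\<^sup>2)) = S" for S
  proof -
    have "1 - e\<^sup>2 \<noteq> 0" using False e by (simp add: power2_eq_1_iff)
    then show ?thesis using discr_minus_1[of e "1 + (S - 1) / (1 - e\<^sup>2)"] by simp
  qed
  show ?thesis
  proof (cases "e < 1")
    case True
    then have "e\<^sup>2 < 1" using e by (simp add: power_less_one_iff)
    moreover have S: "1 < 1 / y\<^sup>2" using y by (simp add: power_less_one_iff)
    ultimately have "1 < 1 + (1 / y\<^sup>2 - 1) / (1 - e\<^sup>2)" by simp
    moreover have "edge_term (1 / y\<^sup>2) = artanh y * y" using S y by (simp add: edge_term_def real_sqrt_divide)
    ultimately show ?thesis using ya S inv[of "1 / y\<^sup>2"] by (intro key[of "1 / y\<^sup>2" "1 + (1 / y\<^sup>2 - 1) / (1 - e\<^sup>2)"]) auto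
  next
    case F: False
    then have "1 < e\<^sup>2" using False by (simp add: one_less_power)
    moreover have S: "y\<^sup>2 < 1" "0 < y\<^sup>2" using y by (auto simp: power_less_one_iff)
    ultimately have "1 < 1 + (y\<^sup>2 - 1) / (1 - e\<^sup>2)" by (simp add: divide_neg_neg)
    moreover have "edge_term (y\<^sup>2) = artanh y / y" using S y by (simp add: edge_term_def)
    ultimately show ?thesis using ya' S inv[of "y\<^sup>2"] by (intro key[of "y\<^sup>2" "1 + (y\<^sup>2 - 1) / (1 - e\<^sup>2)"]) auto
  qed
qed

lemma balance_neg_somewhere:
  assumes e: "0 < e" "e \<le> 1"
  obtains m where "1 < m" "balance e m < 0"
proof (cases "e = 1")
  case True
  then have "balance e 3 < 0" by (simp add: balance_def)
  then show ?thesis using that[of 3] by simp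
next
  case False
  then have e1: "e < 1" using e by simp
  then have e2: "0 < 1 - e\<^sup>2" using e by (simp add: power_less_one_iff)
  have "1 < 1 / e" using e e1 by simp
  then have xm: "min e (1 / e) = e" using e1 by simp
  define t where "t = artanh e"
  have t: "0 < t" unfolding t_def using e e1 by (intro artanh_pos)
  \<comment> \<open>Chosen so that S - 1 = 1 / t^2: \<open>edge_term_le\<close> then bounds the edge
    term by t = artanh e, and the factor e < 1 makes the balance negative.\<close>
  define m where "m = 1 + (1 / t\<^sup>2) / (1 - e\<^sup>2)"
  have m: "1 < m" using t e2 by (simp add: m_def)
  have S: "discr e m - 1 = 1 / t\<^sup>2" unfolding discr_minus_1 using e2 by (simp add: m_def)
  have "e * edge_term (discr e m) \<le> e * (1 / sqrt \<bar>discr e m - 1\<bar>)"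
  proof -
    have "0 < discr e m - 1" unfolding S using t by simp
    then show ?thesis using e edge_term_le[of "discr e m"] by (intro mult_left_mono) auto
  qed
  also have "1 / sqrt \<bar>discr e m - 1\<bar> = t" unfolding S using t by (simp add: real_sqrt_divide)
  also have "e * t < 1 * t" using e1 t by (intro mult_strict_right_mono)
  finally have "balance e m < 0" using False xm by (simp add: balance_def t_def)
  then show ?thesis using that m by blast
qed

lemma balance_le:
  assumes e: "0 < e" and m: "0 < m" "m \<noteq> 1" and S: "0 < discr e m"
  shows "balance e m \<le> (if e = 1 then 1 else e / sqrt \<bar>1 - e\<^sup>2\<bar>) / sqrt \<bar>m - 1\<bar>"
proof (cases "e = 1")
  case True
  define t where "t = sqrt \<bar>m - 1\<bar>"
  have t: "0 < t" "\<bar>m - 1\<bar> = t\<^sup>2" using m by (auto simp: t_def)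
  have "ln (1 / t) \<le> 1 / t - 1" using t by (intro ln_le_minus_one) auto
  then have "- ln t \<le> 1 / t" using t by (simp add: ln_div)
  then show ?thesis using True t by (simp add: balance_def t_def [symmetric] ln_realpow)
next
  case False
  have ne: "1 - e\<^sup>2 \<noteq> 0" using False e by (simp add: power2_eq_1_iff)
  then have "discr e m \<noteq> 1" using discr_minus_1[of e m] m by auto
  then have "e * edge_term (discr e m) \<le> e * (1 / sqrt \<bar>discr e m - 1\<bar>)"
    using e S edge_term_le[of "discr e m"] by (intro mult_left_mono) auto
  also have "\<dots> = e / sqrt \<bar>1 - e\<^sup>2\<bar> / sqrt \<bar>m - 1\<bar>"
    by (simp add: discr_minus_1 abs_mult real_sqrt_mult)
  finally have "e * edge_term (discr e m) \<le> e / sqrt \<bar>1 - e\<^sup>2\<bar> / sqrt \<bar>m - 1\<bar>" .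
  moreover have "0 < artanh (min e (1 / e))"
  proof (rule artanh_pos)
    show "0 < min e (1 / e)" using e by simp
    show "min e (1 / e) < 1"
    proof (cases "e < 1")
      case False
      then have "1 / e < 1" using \<open>e \<noteq> 1\<close> by simp
      then show ?thesis by simp
    qed simp
  qed
  ultimately show ?thesis using False by (simp add: balance_def)
qed

section \<open>The maximum\<close>

context orthoscheme
begin

lemma measurable_fan_density [measurable]:
  "(\<lambda>w. fan_density (f w) (g w)) \<in> borel_measurable N"
  if [measurable]: "f \<in> borel_measurable N" "g \<in> borel_measurable N"
  unfolding fan_density_def fan_height_def M_def by measurable

lemma measurable_gain [measurable]: "gain \<in> borel_measurable borel"
proof -
  have "gain = (\<lambda>h. \<integral>\<^sup>+s. ennreal (fan_density h s) \<partial>lborel)" by (simp add: gain_def fun_eq_iff)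
  also have "\<dots> \<in> borel_measurable borel" by measurable
  finally show ?thesis .
qed

lemma measurable_loss [measurable]: "loss \<in> borel_measurable borel"
proof -
  have "loss = (\<lambda>h. \<integral>\<^sup>+t. ennreal (slice_density (1 / h) t / h\<^sup>2) \<partial>lborel)" by (simp add: loss_def fun_eq_iff)
  also have "\<dots> \<in> borel_measurable borel" by measurable
  finally show ?thesis .
qed

text \<open>For e > 1 the root of \<open>discr e (M h)\<close>, which equals r / sqrt (r^2 - 1), the
  threshold beyond which the polyhedron is a Lambert cube.\<close>

definition critical :: real where
  "critical = sqrt ((e\<^sup>2 / (e\<^sup>2 - 1) - p\<^sup>2) / k\<^sup>2)"

lemma critical_props:
  assumes "1 < e"
  shows "1 < critical" "discr e (M h) = (e\<^sup>2 - 1) * k\<^sup>2 * (critical\<^sup>2 - h\<^sup>2)"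
proof -
  have e2: "0 < e\<^sup>2 - 1" using assms by simp
  have "1 < e\<^sup>2 / (e\<^sup>2 - 1)" using e2 by simp
  then have "k\<^sup>2 < e\<^sup>2 / (e\<^sup>2 - 1) - p\<^sup>2" by (simp add: k_sq)
  then have g: "1 < (e\<^sup>2 / (e\<^sup>2 - 1) - p\<^sup>2) / k\<^sup>2" using k_pos by simp
  then show "1 < critical" by (simp add: critical_def)
  have "critical\<^sup>2 = (e\<^sup>2 / (e\<^sup>2 - 1) - p\<^sup>2) / k\<^sup>2" using g by (simp add: critical_def)
  then have "k\<^sup>2 * critical\<^sup>2 = e\<^sup>2 / (e\<^sup>2 - 1) - p\<^sup>2" using k_pos by simp
  then have "(e\<^sup>2 - 1) * (k\<^sup>2 * critical\<^sup>2) = e\<^sup>2 - (e\<^sup>2 - 1) * p\<^sup>2"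
    using e2 by (simp add: right_diff_distrib)
  moreover have "(e\<^sup>2 - 1) * k\<^sup>2 * (critical\<^sup>2 - h\<^sup>2) = (e\<^sup>2 - 1) * (k\<^sup>2 * critical\<^sup>2) - (e\<^sup>2 - 1) * k\<^sup>2 * h\<^sup>2"
    by (simp add: algebra_simps)
  ultimately show "discr e (M h) = (e\<^sup>2 - 1) * k\<^sup>2 * (critical\<^sup>2 - h\<^sup>2)"
    by (simp add: discr_def M_def algebra_simps)
qed

lemma discr_sign:
  assumes "1 < h"
  shows "e \<le> 1 \<Longrightarrow> 0 < discr e (M h)"
    and "1 < e \<Longrightarrow> h < critical \<Longrightarrow> 0 < discr e (M h)"
    and "1 < e \<Longrightarrow> critical < h \<Longrightarrow> discr e (M h) < 0"
proof -
  show "0 < discr e (M h)" if "e \<le> 1"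
    using discr_ge_1[OF e_pos that M_greater_1[OF assms]] by simp
  assume e: "1 < e"
  have c: "0 < (e\<^sup>2 - 1) * k\<^sup>2" using e k_pos by simp
  show "0 < discr e (M h)" if "h < critical"
  proof -
    have "h\<^sup>2 < critical\<^sup>2" using that assms by (intro power_strict_mono) auto
    then show ?thesis unfolding critical_props(2)[OF e] using c by (simp only: mult_pos_pos diff_gt_0_iff_gt)
  qed
  show "discr e (M h) < 0" if "critical < h"
  proof -
    have "critical\<^sup>2 < h\<^sup>2" using that critical_props(1)[OF e] by (intro power_strict_mono) auto
    then show ?thesis unfolding critical_props(2)[OF e] using c by (simp only: mult_pos_neg diff_less_0_iff_less)
  qed
qed

text \<open>The first summand bounds the balance near h = 1, the second the artanh term near
  \<open>critical\<close>, where the discriminant vanishes.\<close>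

lemma gain_bound:
  assumes "0 < h" "h \<noteq> 1" "discr e (M h) \<noteq> 0"
  shows "gain h \<le> ennreal (weight h *
    ((if e = 1 then 1 else e / sqrt \<bar>1 - e\<^sup>2\<bar>) / sqrt \<bar>M h - 1\<bar> + (if h < 1 then 0 else e * sqrt (M h) / sqrt \<bar>discr e (M h)\<bar>)))"
    (is "_ \<le> ennreal (weight h * (?A + ?B))")
proof -
  have A: "0 \<le> ?A" using e_pos by simp
  have w: "0 \<le> weight h" using weight_pos[of h] by simp
  have m: "0 < M h" "M h \<noteq> 1" using M_pos M_less_1_iff[of h] M_greater_1[of h] assms by force+
  consider "h < 1" | "1 < h" "0 < discr e (M h)" | "1 < h" "discr e (M h) < 0"
    using assms by linarith
  then show ?thesis
  proof cases
    case 1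
    have "discr e (M h) = M h + e\<^sup>2 * (1 - M h)" by (simp add: discr_def algebra_simps)
    moreover have "M h < 1" using 1 assms M_less_1_iff by simp
    ultimately have S: "0 < discr e (M h)" using m by (simp add: add_pos_nonneg)
    have "gain h = ennreal (weight h * balance e (M h))" by (rule gain_low[OF assms(1) 1])
    also have "\<dots> \<le> ennreal (weight h * (?A + ?B))"
      using balance_le[OF e_pos m S] 1 w by (intro ennreal_leI mult_left_mono) auto
    finally show ?thesis .
  next
    case 2
    note u = e_omega_less_1[OF 2]
    have "artanh (e * omega h) / omega h \<le> (e * omega h / sqrt (1 - (e * omega h)\<^sup>2)) / omega h"
      using artanh_le[of "e * omega h"] u omega_props[OF 2(1)] by (intro divide_right_mono) auto
    also have "\<dots> = e / sqrt (discr e (M h) / M h)"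
      unfolding discr_omega[OF 2(1)] using omega_props(1)[OF 2(1)] by simp
    also have "\<dots> = ?B" using 2 by (simp add: real_sqrt_divide)
    finally have "artanh (e * omega h) / omega h \<le> ?B" .
    then show ?thesis
      unfolding gain_mid[OF 2] using balance_le[OF e_pos m 2(2)] w
      by (intro ennreal_leI mult_left_mono) auto
  next
    case 3
    note u = one_less_e_omega[OF 3]
    note o = omega_props[OF 3(1)]
    have y: "0 \<le> 1 / e / omega h" "1 / e / omega h < 1" using u o e_pos by (auto simp: field_simps)
    have q: "0 < (e * omega h)\<^sup>2 - 1" using u by simp
    have uv: "(1 / v) / sqrt (1 - (1 / v)\<^sup>2) = 1 / sqrt (v\<^sup>2 - 1)" if "1 < v" for v :: real
    proof -
      have "1 - (1 / v)\<^sup>2 = (v\<^sup>2 - 1) / v\<^sup>2" using that by (simp add: field_simps)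
      then have "sqrt (1 - (1 / v)\<^sup>2) = sqrt (v\<^sup>2 - 1) / v" using that by (simp add: real_sqrt_divide)
      then show ?thesis using that by simp
    qed
    have "artanh (1 / e / omega h) / omega h \<le> (1 / (e * omega h) / sqrt (1 - (1 / (e * omega h))\<^sup>2)) / omega h"
      using artanh_le[OF y] o by (intro divide_right_mono) auto
    also have "\<dots> = (1 / sqrt ((e * omega h)\<^sup>2 - 1)) * (1 / omega h)"
      unfolding uv[OF u(1)] by simp
    also have "\<dots> \<le> (1 / sqrt ((e * omega h)\<^sup>2 - 1)) * e"
      using u o q e_pos by (intro mult_left_mono) (auto simp: field_simps)
    also have "(e * omega h)\<^sup>2 - 1 = \<bar>discr e (M h)\<bar> / M h"
      using discr_omega[OF 3(1)] 3 by (simp add: minus_divide_left [symmetric])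
    also have "(1 / sqrt (\<bar>discr e (M h)\<bar> / M h)) * e = ?B"
      unfolding real_sqrt_divide[of "\<bar>discr e (M h)\<bar>"] using 3(1) by simp
    finally have "artanh (1 / e / omega h) / omega h \<le> ?B" .
    moreover have "0 < artanh (1 / e)" using u e_pos by (intro artanh_pos) auto
    ultimately show ?thesis
      unfolding gain_high[OF 3] using A w by (intro ennreal_leI mult_left_mono) auto
  qed
qed

lemma weight_le: "weight h \<le> k / (2 * p)"
proof -
  have "p\<^sup>2 \<le> M h" by (simp add: M_def)
  then have "k * p / (2 * M h) \<le> k * p / (2 * p\<^sup>2)"
    using p_pos k_pos M_pos[of h] by (intro divide_left_mono) auto
  then show ?thesis using p_pos by (simp add: weight_def power2_eq_square)
qed

lemma swept_integral_finite:
  "(\<integral>\<^sup>+h. (if 0 < h \<and> h \<le> b then gain h else 0) \<partial>lborel) < \<infinity>"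
proof -
  define b1 where "b1 = (if e = 1 then 1 else e / sqrt \<bar>1 - e\<^sup>2\<bar>)"
  have b1: "0 \<le> b1" using e_pos by (simp add: b1_def)
  define d where "d = (if e \<le> 1 then 0 else critical)"
  \<comment> \<open>For e \<le> 1 there is no second singularity. With d = 0 the factor sqrt b /
    sqrt h \<ge> 1 merely brings the bound into the same shape.\<close>
  define C where "C = (if e \<le> 1 then e * sqrt (M b) * sqrt b else e * sqrt (M b) / sqrt ((e\<^sup>2 - 1) * k\<^sup>2))"
  have Mb: "sqrt (M h) \<le> sqrt (M b)" if "0 < h" "h \<le> b" for h
    using that k_pos by (auto simp: M_def intro!: mult_left_mono power_mono)
  have CB: "e * sqrt (M h) / sqrt \<bar>discr e (M h)\<bar> \<le> C * (1 / sqrt \<bar>h - d\<bar>)"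
    if h: "1 < h" "h \<le> b" "h \<noteq> d" for h
  proof (cases "e \<le> 1")
    case True
    have "1 \<le> discr e (M h)" by (rule discr_ge_1[OF e_pos True M_greater_1[OF h(1)]])
    then have "e * sqrt (M h) / sqrt \<bar>discr e (M h)\<bar> \<le> e * sqrt (M h) / 1"
      using e_pos M_pos[of h] by (intro divide_left_mono) auto
    also have "\<dots> \<le> e * sqrt (M b) * 1" using Mb[of h] h e_pos by simp
    also have "\<dots> \<le> e * sqrt (M b) * (sqrt b * (1 / sqrt h))"
      using h e_pos M_pos[of b] by (intro mult_left_mono) (auto simp: field_simps)
    finally show ?thesis using True h by (simp add: C_def d_def)
  next
    case False
    then have e1: "1 < e" by simp
    have c: "0 < (e\<^sup>2 - 1) * k\<^sup>2" using e1 k_pos by simp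
    have hd: "d = critical" "h \<noteq> critical" using False h by (auto simp: d_def)
    have "critical\<^sup>2 - h\<^sup>2 = (critical - h) * (critical + h)" by (simp add: power2_eq_square algebra_simps)
    then have "\<bar>critical\<^sup>2 - h\<^sup>2\<bar> = \<bar>h - critical\<bar> * (critical + h)"
      using critical_props(1)[OF e1] h by (simp add: abs_mult abs_minus_commute)
    moreover have "\<bar>h - critical\<bar> * 1 \<le> \<bar>h - critical\<bar> * (critical + h)"
      using critical_props(1)[OF e1] h by (intro mult_left_mono) auto
    ultimately have "\<bar>h - critical\<bar> \<le> \<bar>critical\<^sup>2 - h\<^sup>2\<bar>" by simp
    then have "(e\<^sup>2 - 1) * k\<^sup>2 * \<bar>h - critical\<bar> \<le> (e\<^sup>2 - 1) * k\<^sup>2 * \<bar>critical\<^sup>2 - h\<^sup>2\<bar>"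
      using c by (intro mult_left_mono) auto
    also have "\<dots> = \<bar>discr e (M h)\<bar>"
      unfolding critical_props(2)[OF e1] abs_mult[of "(e\<^sup>2 - 1) * k\<^sup>2"] using c by (simp only: abs_of_pos)
    finally have le: "sqrt ((e\<^sup>2 - 1) * k\<^sup>2 * \<bar>h - critical\<bar>) \<le> sqrt \<bar>discr e (M h)\<bar>" by simp
    have "0 < (e\<^sup>2 - 1) * k\<^sup>2 * \<bar>h - critical\<bar>" using mult_pos_pos[OF c, of "\<bar>h - critical\<bar>"] hd by simp
    then have pos: "0 < sqrt ((e\<^sup>2 - 1) * k\<^sup>2 * \<bar>h - critical\<bar>)" by (simp only: real_sqrt_gt_0_iff)
    have "e * sqrt (M h) / sqrt \<bar>discr e (M h)\<bar> \<le> e * sqrt (M h) / sqrt ((e\<^sup>2 - 1) * k\<^sup>2 * \<bar>h - critical\<bar>)"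
      using le pos e_pos M_pos[of h] by (intro divide_left_mono mult_pos_pos) auto
    also have "\<dots> \<le> e * sqrt (M b) / sqrt ((e\<^sup>2 - 1) * k\<^sup>2 * \<bar>h - critical\<bar>)"
      using pos Mb[of h] h e_pos by (intro divide_right_mono mult_left_mono) auto
    also have "\<dots> = C * (1 / sqrt \<bar>h - d\<bar>)"
      unfolding C_def hd(1) using False by (simp only: real_sqrt_mult[of "(e\<^sup>2 - 1) * k\<^sup>2"] if_False) simp
    finally show ?thesis .
  qed
  let ?g1 = "\<lambda>h. ennreal (k / (2 * p) * (b1 / k)) * (ennreal (1 / sqrt \<bar>h - 1\<bar>) * indicator {0..b} h)"
  let ?g2 = "\<lambda>h. ennreal (k / (2 * p) * \<bar>C\<bar>) * (ennreal (1 / sqrt \<bar>h - d\<bar>) * indicator {0..b} h)"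
  have "AE h in lborel. h \<noteq> 1 \<and> h \<noteq> d"
    using AE_lborel_singleton[of "1::real"] AE_lborel_singleton[of d] by eventually_elim simp
  then have "AE h in lborel. (if 0 < h \<and> h \<le> b then gain h else 0) \<le> ?g1 h + ?g2 h"
  proof eventually_elim
    case (elim h)
    show ?case
    proof (cases "0 < h \<and> h \<le> b")
      case True
      then have h: "0 < h" "h \<le> b" "h \<noteq> 1" "h \<noteq> d" using elim by auto
      have S: "discr e (M h) \<noteq> 0"
      proof (cases "h < 1")
        case True
        have "discr e (M h) = M h + e\<^sup>2 * (1 - M h)" by (simp add: discr_def algebra_simps)
        moreover have "M h < 1" using True h M_less_1_iff by simp
        ultimately show ?thesis using M_pos[of h] by (smt (verit) mult_nonneg_nonneg zero_le_power2)
      next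
        case False
        then show ?thesis using discr_sign[of h] h by (cases "e \<le> 1") (force simp: d_def)+
      qed
      have B1: "1 / sqrt \<bar>M h - 1\<bar> \<le> 1 / (k * sqrt \<bar>h - 1\<bar>)"
      proof -
        have "\<bar>h - 1\<bar> * 1 \<le> \<bar>h - 1\<bar> * (h + 1)" using h by (intro mult_left_mono) auto
        also have "\<dots> = \<bar>h\<^sup>2 - 1\<bar>"
        proof -
          have "h\<^sup>2 - 1 = (h - 1) * (h + 1)" by (simp add: power2_eq_square algebra_simps)
          then show ?thesis using h by (simp add: abs_mult)
        qed
        finally have "k * sqrt \<bar>h - 1\<bar> \<le> k * sqrt \<bar>h\<^sup>2 - 1\<bar>" using k_pos by simp
        also have "\<dots> = sqrt \<bar>M h - 1\<bar>"
          unfolding M_minus_1 using k_pos by (simp add: abs_mult real_sqrt_mult)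
        finally have le: "k * sqrt \<bar>h - 1\<bar> \<le> sqrt \<bar>M h - 1\<bar>" .
        have pos: "0 < k * sqrt \<bar>h - 1\<bar>" using k_pos h by simp
        show ?thesis
          by (rule divide_left_mono[OF le _ mult_pos_pos[OF less_le_trans[OF pos le] pos]]) simp
      qed
      have "b1 / sqrt \<bar>M h - 1\<bar> \<le> b1 / k * (1 / sqrt \<bar>h - 1\<bar>)"
        using mult_left_mono[OF B1 b1] by simp
      moreover have "(if h < 1 then 0 else e * sqrt (M h) / sqrt \<bar>discr e (M h)\<bar>) \<le> \<bar>C\<bar> * (1 / sqrt \<bar>h - d\<bar>)"
      proof (cases "h < 1")
        case False
        then have "e * sqrt (M h) / sqrt \<bar>discr e (M h)\<bar> \<le> C * (1 / sqrt \<bar>h - d\<bar>)"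
          using CB[of h] h by simp
        also have "\<dots> \<le> \<bar>C\<bar> * (1 / sqrt \<bar>h - d\<bar>)" by (intro mult_right_mono) auto
        finally show ?thesis using False by simp
      qed simp
      ultimately have "weight h * (b1 / sqrt \<bar>M h - 1\<bar> + (if h < 1 then 0 else e * sqrt (M h) / sqrt \<bar>discr e (M h)\<bar>)) \<le>
          k / (2 * p) * (b1 / k * (1 / sqrt \<bar>h - 1\<bar>) + \<bar>C\<bar> * (1 / sqrt \<bar>h - d\<bar>))"
        using weight_le[of h] weight_pos[of h] k_pos p_pos b1 e_pos M_pos[of h]
        by (intro mult_mono add_mono) auto
      then have "gain h \<le> ennreal (k / (2 * p) * (b1 / k * (1 / sqrt \<bar>h - 1\<bar>) + \<bar>C\<bar> * (1 / sqrt \<bar>h - d\<bar>)))"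
        using gain_bound[OF h(1,3) S] unfolding b1_def by (meson ennreal_leI order_trans)
      also have "\<dots> = ennreal (k / (2 * p) * (b1 / k)) * ennreal (1 / sqrt \<bar>h - 1\<bar>) +
          ennreal (k / (2 * p) * \<bar>C\<bar>) * ennreal (1 / sqrt \<bar>h - d\<bar>)"
      proof -
        have "ennreal x * ennreal y + ennreal x' * ennreal y' = ennreal (x * y + x' * y')"
          if "0 \<le> x" "0 \<le> y" "0 \<le> x'" "0 \<le> y'" for x y x' y'
          using that by (simp add: ennreal_mult ennreal_plus)
        then show ?thesis
          using k_pos p_pos b1 by (simp add: distrib_left mult.assoc)
      qed
      finally show ?thesis using h by simp
    next
      case False
      show ?thesis unfolding if_not_P[OF False] by (rule zero_le)
    qed
  qed
  then have "(\<integral>\<^sup>+h. (if 0 < h \<and> h \<le> b then gain h else 0) \<partial>lborel) \<le> (\<integral>\<^sup>+h. ?g1 h + ?g2 h \<partial>lborel)"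
    by (rule nn_integral_mono_AE)
  also have "\<dots> = ennreal (k / (2 * p) * (b1 / k)) * (\<integral>\<^sup>+h. ennreal (1 / sqrt \<bar>h - 1\<bar>) * indicator {0..b} h \<partial>lborel) +
      ennreal (k / (2 * p) * \<bar>C\<bar>) * (\<integral>\<^sup>+h. ennreal (1 / sqrt \<bar>h - d\<bar>) * indicator {0..b} h \<partial>lborel)"
    by (subst nn_integral_add) (simp_all add: nn_integral_cmult)
  also have "\<dots> < \<infinity>"
    using nn_integral_inverse_sqrt_finite[of 1 b] nn_integral_inverse_sqrt_finite[of d b]
    by (simp add: ennreal_mult_less_top)
  finally show ?thesis .
qed

section \<open>Comparing the volumes at two parameters\<close>

lemma vol_region_finite: "0 < h \<Longrightarrow> vol (region h) < \<infinity>"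
  using vol_region_plus_removed[of h] swept_integral_finite[of h] unfolding vol_swept
  by (metis ennreal_add_less_top infinity_ennreal_def)

text \<open>The volume changes by gain minus loss. It is stated additively, with the removed volume
  on both sides, because subtraction of extended nonnegative reals is truncated; finiteness allows
  cancellation later.\<close>

lemma vol_region_step:
  assumes "0 < a" "a < b"
  defines "I f \<equiv> \<integral>\<^sup>+h. (if a < h \<and> h \<le> b then f h else 0) \<partial>lborel"
  shows "vol (region b) + (vol (removed a) + I loss) = vol (region a) + (vol (removed a) + I gain)"
    and "vol (removed a) < \<infinity>" "I loss < \<infinity>" "I gain < \<infinity>"
proof -
  have b: "0 < b" using assms by simp
  have G: "vol (swept b) = vol (swept a) + I gain"
    unfolding vol_swept I_def by (rule nn_integral_split_at) (use assms in auto)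
  have L: "vol (removed b) = vol (removed a) + I loss"
    unfolding vol_removed[OF b] vol_removed[OF assms(1)] I_def by (rule nn_integral_split_at) (use assms in auto)
  have Va: "vol (region a) + vol (removed a) = vol (swept a)" by (rule vol_region_plus_removed[OF assms(1)])
  have Vb: "vol (region b) + vol (removed b) = vol (swept b)" by (rule vol_region_plus_removed[OF b])
  show "vol (region b) + (vol (removed a) + I loss) = vol (region a) + (vol (removed a) + I gain)"
    using Va Vb unfolding G L by (metis add.assoc)
  have "vol (swept b) < \<infinity>" unfolding vol_swept by (rule swept_integral_finite)
  then show "I gain < \<infinity>" "vol (removed a) < \<infinity>" "I loss < \<infinity>"
    using G Vb L by (metis ennreal_add_less_top infinity_ennreal_def)+
qed

lemma vol_region_less:
  assumes ab: "0 < a" "a < b" and le: "\<And>h. a < h \<Longrightarrow> h < b \<Longrightarrow> h \<noteq> 1 \<Longrightarrow> loss h \<le> gain h"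
    and c: "c < b" "a \<le> c" "\<And>h. c < h \<Longrightarrow> h < b \<Longrightarrow> loss h < gain h"
  shows "vol (region a) < vol (region b)"
proof -
  note st = vol_region_step[OF ab]
  have "(\<integral>\<^sup>+h. (if a < h \<and> h \<le> b then loss h else 0) \<partial>lborel) <
      (\<integral>\<^sup>+h. (if a < h \<and> h \<le> b then gain h else 0) \<partial>lborel)" (is "?L < ?G")
  proof (rule nn_integral_less)
    show "AE h in lborel. (if a < h \<and> h \<le> b then loss h else 0) \<le> (if a < h \<and> h \<le> b then gain h else 0)"
      using AE_lborel_singleton[of "1::real"] AE_lborel_singleton[of b]
      by eventually_elim (use le in auto)
    show "\<not> (AE h in lborel. (if a < h \<and> h \<le> b then gain h else 0) \<le> (if a < h \<and> h \<le> b then loss h else 0))"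
      using c by (intro not_AE_if_fails_on_interval[OF c(1)]) (auto simp: not_le)
  qed (use st in auto)
  then have "vol (region a) + (vol (removed a) + ?L) < vol (region a) + (vol (removed a) + ?G)"
    using vol_region_finite[OF ab(1)] st by (simp add: ennreal_add_left_cancel_less less_top)
  then have "vol (region a) + (vol (removed a) + ?L) < vol (region b) + (vol (removed a) + ?L)"
    using st by simp
  then show ?thesis by (meson add_mono_thms_linordered_semiring(3) not_le)
qed

text \<open>The exception \<open>d\<close> will be \<open>critical\<close>, where the discriminant
  is 0 and the closed forms with strict sign do not apply.\<close>

lemma vol_region_greater:
  assumes ab: "0 < a" "a < b" and d: "\<And>h. a < h \<Longrightarrow> h < b \<Longrightarrow> h \<noteq> d \<Longrightarrow> gain h < loss h"
  shows "vol (region b) < vol (region a)"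
proof -
  note st = vol_region_step[OF ab]
  \<comment> \<open>A final piece of the interval that avoids \<open>d\<close>, so that the strict
    inequality holds on all of it.\<close>
  obtain c where c: "a \<le> c" "c < b" "c < d \<longrightarrow> b \<le> d"
  proof (cases "d < b")
    case True
    then show ?thesis using that[of "max a d"] ab by simp
  next
    case False
    then show ?thesis using that[of a] ab by simp
  qed
  have "(\<integral>\<^sup>+h. (if a < h \<and> h \<le> b then gain h else 0) \<partial>lborel) <
      (\<integral>\<^sup>+h. (if a < h \<and> h \<le> b then loss h else 0) \<partial>lborel)" (is "?G < ?L")
  proof (rule nn_integral_less)
    show "AE h in lborel. (if a < h \<and> h \<le> b then gain h else 0) \<le> (if a < h \<and> h \<le> b then loss h else 0)"
      using AE_lborel_singleton[of d] AE_lborel_singleton[of b]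
      by eventually_elim (use d in \<open>auto intro: less_imp_le\<close>)
    show "\<not> (AE h in lborel. (if a < h \<and> h \<le> b then loss h else 0) \<le> (if a < h \<and> h \<le> b then gain h else 0))"
    proof (rule not_AE_if_fails_on_interval[OF c(2)])
      fix h assume h: "c < h" "h < b"
      then have "h \<noteq> d" "a < h" using c by auto
      then show "\<not> (if a < h \<and> h \<le> b then loss h else 0) \<le> (if a < h \<and> h \<le> b then gain h else 0)"
        using d[of h] h by (simp add: not_le)
    qed
  qed (use st in auto)
  then have "vol (region b) + (vol (removed a) + ?G) < vol (region b) + (vol (removed a) + ?L)"
    using vol_region_finite[of b] ab st by (simp add: ennreal_add_left_cancel_less less_top)
  then have "vol (region b) + (vol (removed a) + ?G) < vol (region a) + (vol (removed a) + ?G)"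
    using st by simp
  then show ?thesis by (meson add_mono_thms_linordered_semiring(3) not_le)
qed

section \<open>The sign change of the balance and the unique maximum\<close>

lemma M_strict_mono: "0 < h \<Longrightarrow> h < h' \<Longrightarrow> M h < M h'"
  using k_pos by (simp add: M_def power_strict_mono)

lemma M_surj:
  assumes "1 < m"
  obtains h where "1 < h" "M h = m"
proof -
  have "k\<^sup>2 < m - p\<^sup>2" using assms by (simp add: k_sq)
  then have g: "1 < (m - p\<^sup>2) / k\<^sup>2" using k_pos by simp
  then have "(sqrt ((m - p\<^sup>2) / k\<^sup>2))\<^sup>2 = (m - p\<^sup>2) / k\<^sup>2" by simp
  then have "M (sqrt ((m - p\<^sup>2) / k\<^sup>2)) = m" using k_pos by (simp add: M_def)
  then show ?thesis using that[of "sqrt ((m - p\<^sup>2) / k\<^sup>2)"] g by simp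
qed

text \<open>\<open>h0\<close> is the supremum of the parameters with positive discriminant and
  positive balance; monotonicity gives the signs on either side without continuity. The set is
  bounded by a parameter of negative balance for e \<le> 1 and by \<open>critical\<close> for e > 1.
  If e \<ge> artanh (1/e), the balance stays positive up to \<open>critical\<close>, and then
  \<open>h0\<close> = \<open>critical\<close>.\<close>

lemma turning_point:
  obtains h0 where "1 < h0" "e \<le> 1 \<or> h0 \<le> critical"
    "\<And>h. 1 < h \<Longrightarrow> h < h0 \<Longrightarrow> 0 < discr e (M h) \<and> 0 < balance e (M h)"
    "\<And>h. h0 < h \<Longrightarrow> 0 < discr e (M h) \<Longrightarrow> balance e (M h) < 0"
proof -
  define A where "A = {h. 1 < h \<and> 0 < discr e (M h) \<and> 0 < balance e (M h)}"
  have anti: "balance e (M h') < balance e (M h)" if "1 < h" "h < h'" "0 < discr e (M h')" for h h'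
    using that by (intro balance_strict_antimono e_pos M_greater_1 M_strict_mono) auto
  have discr_mono: "0 < discr e (M h)" if "1 < h" "h < h'" "0 < discr e (M h')" for h h'
    using that M_strict_mono[of h h'] by (intro discr_pos_between[of "M h" "M h'"] M_greater_1) auto
  obtain m1 where m1: "1 < m1" "0 < discr e m1" "0 < balance e m1"
    by (rule balance_pos_somewhere[OF e_pos])
  obtain h1 where "1 < h1" "M h1 = m1"
    by (rule M_surj[OF m1(1)])
  then have h1: "h1 \<in> A" using m1 by (simp add: A_def)
  have crit: "h \<le> critical" if "1 < e" "h \<in> A" for h
    using that discr_sign(3)[of h] by (force simp: A_def)
  have bdd: "bdd_above A"
  proof (cases "e \<le> 1")
    case True
    obtain m where m: "1 < m" "balance e m < 0" by (rule balance_neg_somewhere[OF e_pos True])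
    obtain h2 where "1 < h2" "M h2 = m" by (rule M_surj[OF m(1)])
    then have h2: "1 < h2" "balance e (M h2) < 0" using m by auto
    have "h \<le> h2" if "h \<in> A" for h
      using anti[of h2 h] h2 that by (force simp: A_def)
    then show ?thesis by (auto simp: bdd_above_def)
  next
    case False
    then show ?thesis using crit by (auto simp: bdd_above_def)
  qed
  define h0 where "h0 = Sup A"
  have up: "h \<le> h0" if "h \<in> A" for h unfolding h0_def by (rule cSup_upper[OF that bdd])
  have "1 < h0" using up[OF h1] h1 by (simp add: A_def)
  moreover have "e \<le> 1 \<or> h0 \<le> critical"
    unfolding h0_def using crit h1 cSup_least[of A critical] by (metis empty_iff not_le)
  moreover have "0 < discr e (M h) \<and> 0 < balance e (M h)" if h: "1 < h" "h < h0" for h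
  proof -
    obtain h' where h': "h' \<in> A" "h < h'"
      using h h1 less_cSup_iff[OF _ bdd, of h] unfolding h0_def by auto
    then show ?thesis using anti[of h h'] discr_mono[of h h'] h by (auto simp: A_def)
  qed
  moreover have "balance e (M h) < 0" if h: "h0 < h" "0 < discr e (M h)" for h
  proof -
    \<comment> \<open>At this intermediate point the balance is at most 0; strict decrease makes it
      negative at \<open>h\<close>.\<close>
    define h' where "h' = (h0 + h) / 2"
    have h': "1 < h'" "h0 < h'" "h' < h" using h \<open>1 < h0\<close> by (auto simp: h'_def)
    then have "h' \<notin> A" using up[of h'] by auto
    then have "balance e (M h') \<le> 0" using discr_mono[of h' h] h h' by (auto simp: A_def)
    then show ?thesis using anti[of h' h] h h' by simp
  qed
  ultimately show ?thesis by (rule that)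
qed

lemma unique_maximum:
  obtains h0 where "1 < h0" "e \<le> 1 \<or> h0 \<le> critical"
    "\<And>h. 0 < h \<Longrightarrow> h \<noteq> h0 \<Longrightarrow> vol (region h) < vol (region h0)"
proof -
  obtain h0 where h0: "1 < h0" "e \<le> 1 \<or> h0 \<le> critical"
    and below: "\<And>h. 1 < h \<Longrightarrow> h < h0 \<Longrightarrow> 0 < discr e (M h) \<and> 0 < balance e (M h)"
    and above: "\<And>h. h0 < h \<Longrightarrow> 0 < discr e (M h) \<Longrightarrow> balance e (M h) < 0"
    by (rule turning_point) blast
  have gl: "loss h < gain h" if h: "1 < h" "h < h0" for h
  proof -
    have S: "0 < discr e (M h)" "0 < balance e (M h)" using below[OF h] by auto
    have u: "0 < artanh (e * omega h)" using e_omega_less_1[OF h(1) S(1)] by (intro artanh_pos)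
    have o: "0 < omega h" using omega_props[OF h(1)] by simp
    have "weight h * (artanh (e * omega h) / omega h) < weight h * (artanh (e * omega h) / omega h + balance e (M h))"
      using weight_pos[of h] S by (intro mult_strict_left_mono) simp_all
    moreover have "0 \<le> weight h * (artanh (e * omega h) / omega h)" using u o weight_pos[of h] by simp
    ultimately show ?thesis
      unfolding gain_mid[OF h(1) S(1)] loss_mid[OF h(1) S(1)] by (simp only: ennreal_less_iff)
  qed
  have lg: "gain h < loss h" if h: "h0 < h" "h \<noteq> critical" for h
  proof -
    have h1: "1 < h" using h h0 by simp
    consider "0 < discr e (M h)" | "discr e (M h) < 0"
      using discr_sign[OF h1] h by (meson linorder_neqE_linordered_idom not_le)
    then show ?thesis
    proof cases
      case 1
      have u: "0 < artanh (e * omega h)" using e_omega_less_1[OF h1 1] by (intro artanh_pos)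
      have o: "0 < omega h" using omega_props[OF h1] by simp
      have pos: "0 < weight h * (artanh (e * omega h) / omega h)" using u o weight_pos[of h] by simp
      have "weight h * (artanh (e * omega h) / omega h + balance e (M h)) < weight h * (artanh (e * omega h) / omega h)"
        using weight_pos[of h] above[OF h(1) 1] by (intro mult_strict_left_mono) simp_all
      then show ?thesis
        unfolding gain_mid[OF h1 1] loss_mid[OF h1 1] using pos by (intro ennreal_lessI)
    next
      case 2
      note u = one_less_e_omega[OF h1 2]
      have a: "0 < artanh (1 / e)" using u e_pos by (intro artanh_pos) auto
      have y: "0 < 1 / e / omega h" "1 / e / omega h < 1"
        using u omega_props[OF h1] e_pos by (auto simp: field_simps)
      have pos: "0 < weight h * (artanh (1 / e / omega h) / omega h)"
        using artanh_pos[OF y] omega_props[OF h1] weight_pos[of h] by simp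
      have "weight h * (artanh (1 / e / omega h) / omega h - artanh (1 / e)) < weight h * (artanh (1 / e / omega h) / omega h)"
        using weight_pos[of h] a by (intro mult_strict_left_mono) simp_all
      then have "gain h < ennreal (weight h * (artanh (1 / e / omega h) / omega h))"
        unfolding gain_high[OF h1 2] using pos by (intro ennreal_lessI)
      also have "\<dots> \<le> loss h" by (rule loss_high[OF h1 2])
      finally show ?thesis .
    qed
  qed
  have "vol (region h) < vol (region h0)" if h: "0 < h" "h \<noteq> h0" for h
  proof (cases "h < h0")
    case True
    show ?thesis
    proof (rule vol_region_less[where c = "max 1 h"])
      show "loss t \<le> gain t" if "h < t" "t < h0" "t \<noteq> 1" for t
        using gl[of t] loss_low[of t] that h by (cases "t < 1") auto
      show "loss t < gain t" if "max 1 h < t" "t < h0" for t using gl[of t] that by simp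
    qed (use h True h0 in auto)
  next
    case False
    then show ?thesis
      using h h0 lg by (intro vol_region_greater[where d = critical]) auto
  qed
  with h0 show ?thesis by (rule that)
qed

end

section \<open>The polyhedron in coordinates and the return to its volume\<close>

lemma norm_sq_vec3: "(norm (v::real^3))\<^sup>2 = (v $ 1)\<^sup>2 + (v $ 2)\<^sup>2 + (v $ 3)\<^sup>2"
  unfolding power2_norm_eq_inner by (simp add: inner_vec_def sum_3 power2_eq_square)

lemma inner_vec3: "(v::real^3) \<bullet> w = v $ 1 * w $ 1 + v $ 2 * w $ 2 + v $ 3 * w $ 3"
  by (simp add: inner_vec_def sum_3)

lemma tetrahedron_iff:
  fixes p q h :: real and v :: "real^3"
  assumes "0 < p" "0 < q" "0 < h"
  shows "v \<in> convex hull {vector [q, p, 0], vector [0, p, 0], vector [0, 0, 0], vector [0, 0, h]} \<longleftrightarrow>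
    0 \<le> v $ 1 \<and> v $ 1 * p \<le> v $ 2 * q \<and> 0 \<le> v $ 3 \<and> v $ 3 * p \<le> h * (p - v $ 2)"
    (is "v \<in> convex hull {?a, ?b, ?c, ?d} \<longleftrightarrow> _")
proof
  let ?W = "{v::real^3. 0 \<le> v $ 1 \<and> v $ 1 * p \<le> v $ 2 * q \<and> 0 \<le> v $ 3 \<and> v $ 3 * p \<le> h * (p - v $ 2)}"
  have "convex ?W"
  proof (rule convexI)
    fix x y :: "real^3" and u w :: real
    assume x: "x \<in> ?W" and y: "y \<in> ?W" and u: "0 \<le> u" "0 \<le> w" "u + w = 1"
    have 1: "(u * x $ 1 + w * y $ 1) * p \<le> (u * x $ 2 + w * y $ 2) * q"
    proof -
      have "u * (x $ 1 * p) + w * (y $ 1 * p) \<le> u * (x $ 2 * q) + w * (y $ 2 * q)"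
        using x y u by (intro add_mono mult_left_mono) auto
      then show ?thesis by (simp add: algebra_simps)
    qed
    have 2: "(u * x $ 3 + w * y $ 3) * p \<le> h * (p - (u * x $ 2 + w * y $ 2))"
    proof -
      have "u * (x $ 3 * p) + w * (y $ 3 * p) \<le> u * (h * (p - x $ 2)) + w * (h * (p - y $ 2))"
        using x y u by (intro add_mono mult_left_mono) auto
      also have "\<dots> = h * ((u + w) * p - (u * x $ 2 + w * y $ 2))" by (simp add: algebra_simps)
      finally show ?thesis using u by (simp add: algebra_simps)
    qed
    show "u *\<^sub>R x + w *\<^sub>R y \<in> ?W" using 1 2 x y u by simp
  qed
  moreover have "{?a, ?b, ?c, ?d} \<subseteq> ?W" using assms by (auto simp: algebra_simps)
  ultimately have "convex hull {?a, ?b, ?c, ?d} \<subseteq> ?W" by (rule hull_minimal[rotated])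
  then show "v \<in> convex hull {?a, ?b, ?c, ?d} \<Longrightarrow>
      0 \<le> v $ 1 \<and> v $ 1 * p \<le> v $ 2 * q \<and> 0 \<le> v $ 3 \<and> v $ 3 * p \<le> h * (p - v $ 2)" by auto
next
  assume v: "0 \<le> v $ 1 \<and> v $ 1 * p \<le> v $ 2 * q \<and> 0 \<le> v $ 3 \<and> v $ 3 * p \<le> h * (p - v $ 2)"
  \<comment> \<open>The barycentric coordinates of v with respect to P0, P1, P2, P3.\<close>
  define \<alpha> \<beta> \<gamma> \<delta> where "\<alpha> = v $ 1 / q" and "\<beta> = v $ 2 / p - v $ 1 / q"
    and "\<gamma> = 1 - v $ 2 / p - v $ 3 / h" and "\<delta> = v $ 3 / h"
  have nn: "0 \<le> \<alpha>" "0 \<le> \<beta>" "0 \<le> \<gamma>" "0 \<le> \<delta>" and sum: "\<alpha> + \<beta> + \<gamma> + \<delta> = 1"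
    using v assms by (auto simp: \<alpha>_def \<beta>_def \<gamma>_def \<delta>_def field_simps)
  have v_eq: "v = \<alpha> *\<^sub>R ?a + \<beta> *\<^sub>R ?b + \<gamma> *\<^sub>R ?c + \<delta> *\<^sub>R ?d"
    using assms by (simp add: vec_eq_iff forall_3 \<alpha>_def \<beta>_def \<gamma>_def \<delta>_def field_simps)
  \<comment> \<open>Distinct vertices make the weight function \<open>u\<close>, defined by
    comparing with each vertex, take the intended values.\<close>
  have ne: "?a \<noteq> ?b" "?a \<noteq> ?c" "?a \<noteq> ?d" "?b \<noteq> ?c" "?b \<noteq> ?d" "?c \<noteq> ?d"
    using assms by (simp_all add: vec_eq_iff forall_3)
  define u where "u w = (if w = ?a then \<alpha> else if w = ?b then \<beta> else if w = ?c then \<gamma> else \<delta>)" for w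
  have "(\<forall>x\<in>{?a, ?b, ?c, ?d}. 0 \<le> u x) \<and> sum u {?a, ?b, ?c, ?d} = 1 \<and> (\<Sum>x\<in>{?a, ?b, ?c, ?d}. u x *\<^sub>R x) = v"
    using ne ne[symmetric] nn sum v_eq by (simp add: u_def add_ac)
  then show "v \<in> convex hull {?a, ?b, ?c, ?d}"
    by (subst convex_hull_finite) auto
qed

text \<open>One list of inequalities covers all types of orthoscheme, because the inequality of a
  truncation already holds when its vertex is not ultraideal: for P0 it follows from the tetrahedron
  and r \<le> 1, for P3 from the ball and h \<le> 1.\<close>

lemma R_h_iff:
  fixes r \<theta> h :: real and v :: "real^3"
  assumes r: "0 < r" and \<theta>: "0 < \<theta>" "\<theta> < pi / 2" and h: "0 < h"
  defines "p \<equiv> r * cos \<theta>" and "q \<equiv> r * sin \<theta>"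
  assumes p1: "p < 1"
  shows "v \<in> R_h r \<theta> h \<longleftrightarrow> 0 \<le> v $ 1 \<and> v $ 1 * p \<le> v $ 2 * q \<and> 0 \<le> v $ 3 \<and> v $ 3 * p \<le> h * (p - v $ 2) \<and>
    q * v $ 1 + p * v $ 2 \<le> 1 \<and> v $ 3 * h \<le> 1 \<and> (v $ 1)\<^sup>2 + (v $ 2)\<^sup>2 + (v $ 3)\<^sup>2 < 1"
    (is "_ \<longleftrightarrow> ?W1 \<and> ?W2 \<and> ?W3 \<and> ?W4 \<and> ?A \<and> ?B \<and> ?N")
proof -
  let ?W = "?W1 \<and> ?W2 \<and> ?W3 \<and> ?W4"
  have pq: "0 < p" "0 < q" using r \<theta> by (auto simp: p_def q_def cos_gt_zero sin_gt_zero)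
  have r2: "p\<^sup>2 + q\<^sup>2 = r\<^sup>2"
    unfolding p_def q_def power_mult_distrib by (simp add: distrib_left [symmetric])
  have n0: "norm (vector [q, p, 0] :: real^3) = r"
  proof -
    have "(norm (vector [q, p, 0] :: real^3))\<^sup>2 = r\<^sup>2" using r2 by (simp add: norm_sq_vec3 add.commute)
    then show ?thesis using r by simp
  qed
  have n3: "norm (vector [0, 0, h] :: real^3) = h"
  proof -
    have "(norm (vector [0, 0, h] :: real^3))\<^sup>2 = h\<^sup>2" by (simp add: norm_sq_vec3)
    then show ?thesis using h by simp
  qed
  have ball: "v \<in> klein_ball \<longleftrightarrow> ?N"
  proof -
    have "v \<in> klein_ball \<longleftrightarrow> (norm v)\<^sup>2 < 1" by (simp add: klein_ball_def abs_square_less_1)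
    then show ?thesis by (simp add: norm_sq_vec3)
  qed
  have A: "?A" if "?W" "r \<le> 1"
  proof -
    have v1: "0 \<le> v $ 1" "v $ 1 * p \<le> v $ 2 * q" "0 \<le> v $ 3" "v $ 3 * p \<le> h * (p - v $ 2)" using that by auto
    have "0 \<le> v $ 2 * q" using v1 pq by (smt (verit) mult_nonneg_nonneg)
    then have v2: "0 \<le> v $ 2" using pq by (simp add: zero_le_mult_iff)
    have "0 \<le> h * (p - v $ 2)" using v1 pq by (smt (verit) mult_nonneg_nonneg)
    then have v2': "v $ 2 \<le> p" using h by (simp add: zero_le_mult_iff)
    have "p * (q * v $ 1 + p * v $ 2) = q * (v $ 1 * p) + p\<^sup>2 * v $ 2" by (simp add: algebra_simps power2_eq_square)
    also have "\<dots> \<le> q * (v $ 2 * q) + p\<^sup>2 * v $ 2" using v1 pq by (intro add_right_mono mult_left_mono) auto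
    also have "\<dots> = r\<^sup>2 * v $ 2" unfolding r2 [symmetric] by (simp add: algebra_simps power2_eq_square)
    also have "\<dots> \<le> 1 * p" using v2 v2' that r by (intro mult_mono) (auto simp: power_le_one)
    finally have "p * (q * v $ 1 + p * v $ 2) \<le> p * 1" by simp
    then show ?thesis using pq by (simp only: mult_le_cancel_left_pos)
  qed
  have B: "?B" if "?W" "?N" "h \<le> 1"
  proof -
    have "(v $ 3)\<^sup>2 \<le> 1" using that(2) zero_le_power2[of "v $ 1"] zero_le_power2[of "v $ 2"] by linarith
    then have "v $ 3 \<le> 1" using power2_le_imp_le[of "v $ 3" 1] by simp
    then have "v $ 3 * h \<le> 1 * 1" using that h by (intro mult_mono) auto
    then show ?thesis by simp
  qed
  have "v \<in> R_h r \<theta> h \<longleftrightarrow> (?W \<and> ?N) \<and> (1 < r \<longrightarrow> ?A) \<and> (1 < h \<longrightarrow> ?B)"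
    unfolding R_h_def complete_orthoscheme_def truncate_at_def ultraideal_def polar_halfspace_def
      p_def [symmetric] q_def [symmetric] n0 n3
    using tetrahedron_iff[OF pq h, of v] ball by (auto simp: inner_vec3 mult.commute)
  then show ?thesis using A B by (meson not_le)
qed

text \<open>A common point x of the polar planes has third coordinate 1/h, and by Cauchy-Schwarz its
  first two coordinates have square sum at least 1/r^2. Being inside the ball it gives 1/r^2 + 1/h^2
  < 1.\<close>

lemma not_lambert_cube:
  fixes r \<theta> h :: real
  assumes r: "0 < r" and h: "0 < h" and le: "r\<^sup>2 * h\<^sup>2 \<le> r\<^sup>2 + h\<^sup>2"
  shows "\<not> is_lambert_cube (vector [r * sin \<theta>, r * cos \<theta>, 0]) (vector [0, 0, h])"
proof
  assume "is_lambert_cube (vector [r * sin \<theta>, r * cos \<theta>, 0]) (vector [0, 0, h])"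
  then obtain x where x: "x \<in> klein_ball" "x \<bullet> vector [r * sin \<theta>, r * cos \<theta>, 0] = 1" "x \<bullet> vector [0, 0, h] = 1"
    unfolding is_lambert_cube_def polar_plane_def by blast
  define c where "c = x $ 1 * sin \<theta> + x $ 2 * cos \<theta>"
  have 1: "r * c = 1" "x $ 3 * h = 1" using x by (simp_all add: inner_vec3 c_def algebra_simps)
  have "c\<^sup>2 \<le> c\<^sup>2 + (x $ 1 * cos \<theta> - x $ 2 * sin \<theta>)\<^sup>2" by simp
  also have "c\<^sup>2 + (x $ 1 * cos \<theta> - x $ 2 * sin \<theta>)\<^sup>2 =
      ((x $ 1)\<^sup>2 + (x $ 2)\<^sup>2) * ((sin \<theta>)\<^sup>2 + (cos \<theta>)\<^sup>2)"
    unfolding c_def by algebra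
  finally have "c\<^sup>2 \<le> (x $ 1)\<^sup>2 + (x $ 2)\<^sup>2" by simp
  moreover have "(norm x)\<^sup>2 < 1" using x by (simp add: klein_ball_def abs_square_less_1)
  ultimately have "c\<^sup>2 + (x $ 3)\<^sup>2 < 1" by (simp add: norm_sq_vec3)
  then have "(r\<^sup>2 * h\<^sup>2) * (c\<^sup>2 + (x $ 3)\<^sup>2) < (r\<^sup>2 * h\<^sup>2) * 1"
    using r h by (intro mult_strict_left_mono) auto
  also have "(r\<^sup>2 * h\<^sup>2) * (c\<^sup>2 + (x $ 3)\<^sup>2) = h\<^sup>2 * (r * c)\<^sup>2 + r\<^sup>2 * (x $ 3 * h)\<^sup>2"
    by (simp add: algebra_simps power2_eq_square)
  finally show False using le by (simp add: 1)
qed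

lemma (in orthoscheme) V_h_eq_vol:
  fixes r \<theta> h :: real
  assumes r: "0 < r" and \<theta>: "0 < \<theta>" "\<theta> < pi / 2" and h: "0 < h"
    and p: "p = r * cos \<theta>" and q: "k * e = r * sin \<theta>"
  shows "V_h r \<theta> h = enn2real (vol (region h))"
proof -
  define f where "f v = (if v \<in> R_h r \<theta> h then 1 / (1 - (norm v)\<^sup>2)\<^sup>2 else 0)" for v :: "real^3"
  note iff = R_h_iff[OF r \<theta> h, folded p q, OF p_less_1]
  have f_meas: "f \<in> borel_measurable borel"
    unfolding f_def iff norm_sq_vec3 by measurable
  have f_nn: "0 \<le> f v" for v by (simp add: f_def)
  \<comment> \<open>The excluded planes y = 0 and z = 0 are null sets and account for the strict
    inequalities of \<open>prism\<close>.\<close>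
  have f_eq: "f (vector [x, y, z]) = region h x y z" if "y \<noteq> 0" "z \<noteq> 0" for x y z
  proof -
    have 1: "0 < y \<and> y < p" if a: "0 \<le> x" "x * p \<le> y * (k * e)" "0 \<le> z" "z * p \<le> h * (p - y)"
    proof -
      have "0 \<le> y * (k * e)" using a p_pos by (smt (verit) mult_nonneg_nonneg)
      then have "0 \<le> y" using mult_pos_pos[OF k_pos e_pos] by (simp only: zero_le_mult_iff) linarith
      moreover have "0 < z * p" using a \<open>z \<noteq> 0\<close> p_pos by simp
      then have "0 < h * (p - y)" using a by linarith
      then have "y < p" using h by (simp add: zero_less_mult_iff)
      ultimately show ?thesis using \<open>y \<noteq> 0\<close> by simp
    qed
    have "vector [x, y, z] \<in> R_h r \<theta> h \<longleftrightarrow>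
        (prism x y z \<and> z * p \<le> h * (p - y) \<and> z * h \<le> 1) \<and> x\<^sup>2 + y\<^sup>2 + z\<^sup>2 < 1"
      unfolding iff prism_def using 1 \<open>z \<noteq> 0\<close> by (simp add: less_le) blast
    then show ?thesis by (simp add: f_def region_def klein_density_def norm_sq_vec3)
  qed
  have "(\<integral>\<^sup>+v. ennreal (f v) \<partial>lborel) = (\<integral>\<^sup>+y. \<integral>\<^sup>+x. \<integral>\<^sup>+z. ennreal (f (vector [x, y, z])) \<partial>lborel \<partial>lborel \<partial>lborel)"
    using f_meas by (intro nn_integral_vec3) auto
  also have "\<dots> = vol (region h)"
    unfolding vol_def
  proof (rule nn_integral_cong_AE)
    show "AE y in lborel. (\<integral>\<^sup>+x. \<integral>\<^sup>+z. ennreal (f (vector [x, y, z])) \<partial>lborel \<partial>lborel) =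
        (\<integral>\<^sup>+x. \<integral>\<^sup>+z. ennreal (region h x y z) \<partial>lborel \<partial>lborel)"
      using AE_lborel_singleton[of "0::real"]
    proof eventually_elim
      case (elim y)
      have "AE z in lborel. ennreal (f (vector [x, y, z])) = ennreal (region h x y z)" for x
        using AE_lborel_singleton[of "0::real"] by eventually_elim (simp add: f_eq elim)
      then show ?case by (intro nn_integral_cong nn_integral_cong_AE)
    qed
  qed
  also have "\<dots> = ennreal (enn2real (vol (region h)))"
    using vol_region_finite[OF h] by simp
  finally have "(f has_integral enn2real (vol (region h))) UNIV"
    using f_meas f_nn by (intro nn_integral_has_integral) auto
  then have "((\<lambda>v. 1 / (1 - (norm v)\<^sup>2)\<^sup>2) has_integral enn2real (vol (region h))) (R_h r \<theta> h)"
    unfolding f_def by (subst (asm) has_integral_restrict_UNIV)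
  then show ?thesis
    unfolding V_h_def hyp_volume_def by (rule integral_unique)
qed

theorem theorem1:
  fixes r \<theta> :: real
  assumes "r > 0" and "0 < \<theta>" and "\<theta> < pi / 2" and "r * cos \<theta> < 1"
  shows "\<exists>h>1. (\<forall>h'>0. V_h r \<theta> h' \<le> V_h r \<theta> h)
            \<and> (\<forall>h'>0. V_h r \<theta> h' = V_h r \<theta> h \<longrightarrow> h' = h)
            \<and> \<not> is_lambert_cube (vector [r * sin \<theta>, r * cos \<theta>, 0]) (vector [0, 0, h])"
proof -
  define p where "p = r * cos \<theta>"
  define k where "k = sqrt (1 - p\<^sup>2)"
  \<comment> \<open>\<open>k\<close> is half the chord cut out of the ball by the line P0 P1, whose
    midpoint is P1; so \<open>e\<close> is the position of P0 in units of the half-chord.\<close>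
  define e where "e = r * sin \<theta> / k"
  have p: "0 < p" "p < 1" using assms by (auto simp: p_def cos_gt_zero)
  then have p2: "p\<^sup>2 < 1" by (simp add: power_less_one_iff)
  have k: "0 < k" "k\<^sup>2 = 1 - p\<^sup>2" using p2 by (auto simp: k_def)
  have s: "0 < sin \<theta>" using assms by (intro sin_gt_zero) auto
  have e: "0 < e" using s k assms by (simp add: e_def)
  have ke: "k * e = r * sin \<theta>" using k by (simp add: e_def)
  interpret orthoscheme p k e
    by unfold_locales (use p k e in auto)
  have V: "V_h r \<theta> h = enn2real (vol (region h))" if "0 < h" for h
    using assms that ke by (intro V_h_eq_vol) (auto simp: p_def)
  obtain h0 where h0: "1 < h0" "e \<le> 1 \<or> h0 \<le> critical"
    and max: "\<And>h. 0 < h \<Longrightarrow> h \<noteq> h0 \<Longrightarrow> vol (region h) < vol (region h0)"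
    by (rule unique_maximum) blast
  have less: "V_h r \<theta> h < V_h r \<theta> h0" if "0 < h" "h \<noteq> h0" for h
    using max[OF that] vol_region_finite[of h0] h0 that
    by (simp add: V enn2real_less_iff less_top) 
  \<comment> \<open>Equality is the tangent case \<open>h0\<close> = \<open>critical\<close>; it is
    still excluded from the Lambert cubes because the ball is open.\<close>
  have D: "0 \<le> discr e (M h0)"
  proof (cases "e \<le> 1")
    case True
    then show ?thesis using discr_sign(1)[OF h0(1)] by simp
  next
    case False
    then have "h0\<^sup>2 \<le> critical\<^sup>2" using h0 by (intro power_mono) auto
    moreover have "0 \<le> (e\<^sup>2 - 1) * k\<^sup>2" using False by simp
    ultimately show ?thesis using False by (simp only: critical_props(2) not_le mult_nonneg_nonneg diff_ge_0_iff_ge)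
  qed
  have "p\<^sup>2 + (k * e)\<^sup>2 = r\<^sup>2 * ((cos \<theta>)\<^sup>2 + (sin \<theta>)\<^sup>2)"
    unfolding ke p_def by algebra
  then have "p\<^sup>2 + (k * e)\<^sup>2 = r\<^sup>2" by (simp only: sin_cos_squared_add2 mult_1_right)
  then have "discr e (M h0) = r\<^sup>2 + h0\<^sup>2 - r\<^sup>2 * h0\<^sup>2"
    unfolding discr_def M_def using k(2) by algebra
  then have "r\<^sup>2 * h0\<^sup>2 \<le> r\<^sup>2 + h0\<^sup>2" using D by simp
  then have "\<not> is_lambert_cube (vector [r * sin \<theta>, r * cos \<theta>, 0]) (vector [0, 0, h0])"
    using assms h0 by (intro not_lambert_cube) auto
  moreover have "V_h r \<theta> h \<le> V_h r \<theta> h0" if "0 < h" for h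
    using less[OF that] by (cases "h = h0") auto
  moreover have "h = h0" if "0 < h" "V_h r \<theta> h = V_h r \<theta> h0" for h
    using less[OF that(1)] that by auto
  ultimately show ?thesis using h0 by blast
qed

end
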